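(* For $\lambda>0$ let $\nu_\lambda$ denote the distribution of $X(\lambda)$. The family $\nu=(\nu_\lambda)_{\lambda>0}$ is the unique solution in $\mathcal M$ of the distributional identity $$X(\lambda)\overset{\text{law}}{=}U^2X(\lambda U)+(1-U)^2\widetilde X(\lambda(1-U))+\Theta(\lambda,U),\qquad\lambda>0 .\qquad(\ast)$$
   Context: Definition of $X(\lambda)$: Let $\Pi$ be a Poisson point process with intensity $\lambda$ on $\{1,2,\dots\}\times[0,1]$ (for each $n$ the number of points of $\Pi$ in $\{n\}\times[0,1]$ is Poisson with mean $\lambda$, the second coordinates of the points are uniform on $[0,1]$, everything independent). Let $\{U_{k,j}:k\ge0,1\le j\le2^k\}$ be independent uniform random variables on $[0,1]$, independent of $\Pi$. Define recursively $Y_{0,0}=0$, $Y_{0,1}=1$, $Y_{k+1,2j}=Y_{k,j}$ for $0\le j\le2^k$, $Y_{k+1,2j-1}=(1-U_{k,j})Y_{k,j-1}+U_{k,j}Y_{k,j}$ for $1\le j\le2^k$. For $x\in[0,1]$ and $k\ge1$, put $J_k(x)=2j-1$ if $Y_{k-1,j-1}\le x<Y_{k-1,j}$. Then $X(\lambda)=\frac1\lambda\sum_{(k,x)\in\Pi}|x-Y_{k,J_k(x)}|$ (a.s. finite). Meaning of $(\ast)$: $U$ is uniform on $[0,1]$; conditionally given $U=u$, the variables $X(\lambda U)$, $\widetilde X(\lambda(1-U))$, $\Theta(\lambda,U)$ are independent, $X(\lambda U)$ and $\widetilde X(\lambda(1-U))$ are distributed as $X(\lambda u)$ and $X(\lambda(1-u))$,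 and $\Theta(\lambda,U)$ is distributed as $\Theta(\lambda,u)\overset{\text{law}}{=}\frac1\lambda\sum_{i=1}^{N_\lambda}|u-V_i|$, where $N_\lambda$ is Poisson with mean $\lambda$, the $V_i$ are uniform on $[0,1]$, and all are independent. A solution of $(\ast)$ is a family of probability measures $\mu=(\mu_\lambda)_{\lambda>0}$ on $[0,+\infty)$ for which there is a family $Y=(Y(\lambda))_{\lambda>0}$ of random variables on one probability space $(\Omega,\mathcal A,\mathbb P)$ such that (i) for each $\lambda>0$, $\mu_\lambda$ is the distribution of $Y(\lambda)$; (ii) $Y$ is a measurable process, i.e. $(\lambda,\omega)\mapsto Y(\lambda,\omega)$ is measurable from $((0,+\infty)\times\Omega,\mathcal B((0,+\infty))\otimes\mathcal A)$ to $([0,+\infty),\mathcal B([0,+\infty)))$; and such that $(\ast)$ holds for $Y$ (in place of $X$). $\mathcal M$ is the class of families $\mu=(\mu_\lambda)_{\lambda>0}$ satisfying (i) and (ii) (for some $Y$) together with (iii) for some $\alpha\in(0,1)$, the function $\lambda\mapsto\lambda^\alpha\,\mathbb E[Y(\lambda)]$ is bounded on any bounded interval of $(0,+\infty)$ (including intervals of the form $(0,\Lambda)$). *)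

theory Defs
  imports "HOL-Probability.Probability"
begin

section \<open>The recursively split unit interval\<close>

text \<open>For odd \<open>j = 2 i - 1\<close> the new point splits the \<open>i\<close>-th interval of the previous level.
  Only indices \<open>j \<le> 2 ^ k\<close> are meaningful.\<close>

fun split_pt :: "(nat \<times> nat \<Rightarrow> real) \<Rightarrow> nat \<Rightarrow> nat \<Rightarrow> real" where
  "split_pt u 0 j = (if j = 0 then 0 else 1)"
| "split_pt u (Suc k) j =
     (if even j then split_pt u k (j div 2)
      else let i = (j + 1) div 2
           in (1 - u (k, i)) * split_pt u k (i - 1) + u (k, i) * split_pt u k i)"

text \<open>For \<open>0 \<le> x < 1\<close>, \<open>k \<ge> 1\<close> and \<open>u\<close> with values in \<open>[0,1]\<close> there is exactly one index \<open>j\<close> as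
  below, so \<open>LEAST\<close> is merely a total way of naming it; the remaining cases have probability zero.\<close>

definition split_idx :: "(nat \<times> nat \<Rightarrow> real) \<Rightarrow> nat \<Rightarrow> real \<Rightarrow> nat" where
  "split_idx u k x =
     2 * (LEAST j. 1 \<le> j \<and> j \<le> 2 ^ (k - 1) \<and>
            split_pt u (k - 1) (j - 1) \<le> x \<and> x < split_pt u (k - 1) j) - 1"


section \<open>The random variable $X(\lambda)$ and its law\<close>

definition unif01 :: "real measure" where
  "unif01 = uniform_measure lborel {0..1}"

definition tree_index :: "(nat \<times> nat) set" where
  "tree_index = {(k, j). 1 \<le> j \<and> j \<le> 2 ^ k}"

text \<open>A sample \<open>(n, v, u)\<close> consists of the numbers \<open>n k\<close> of points of the Poisson process at level
  \<open>k\<close>, of their potential positions \<open>v (k, 1), v (k, 2), \<dots>\<close> (of which the first \<open>n k\<close> are used), and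
  of the splitting variables \<open>u (k, j)\<close>, all independent.\<close>

type_synonym sample = "(nat \<Rightarrow> nat) \<times> (nat \<times> nat \<Rightarrow> real) \<times> (nat \<times> nat \<Rightarrow> real)"

definition sample_space :: "real \<Rightarrow> sample measure" where
  "sample_space l =
     (\<Pi>\<^sub>M k\<in>{1..}. measure_pmf (poisson_pmf l)) \<Otimes>\<^sub>M
     ((\<Pi>\<^sub>M p\<in>{1..} \<times> {1..}. unif01) \<Otimes>\<^sub>M (\<Pi>\<^sub>M p\<in>tree_index. unif01))"

definition poisson_points :: "(nat \<Rightarrow> nat) \<Rightarrow> (nat \<times> nat \<Rightarrow> real) \<Rightarrow> (nat \<times> real) set" where
  "poisson_points n v = {(k, v (k, i)) | k i. 1 \<le> k \<and> 1 \<le> i \<and> i \<le> n k}"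

text \<open>The sum is almost surely finite; where it diverges, \<open>infsum\<close> returns the value \<open>0\<close>.\<close>

definition X :: "real \<Rightarrow> sample \<Rightarrow> real" where
  "X l = (\<lambda>(n, v, u).
     1 / l * (\<Sum>\<^sub>\<infinity>(k, x)\<in>poisson_points n v. \<bar>x - split_pt u k (split_idx u k x)\<bar>))"

definition nu :: "real \<Rightarrow> real measure" where
  "nu l = distr (sample_space l) borel (X l)"


section \<open>The distributional identity\<close>

definition theta_law :: "real \<Rightarrow> real \<Rightarrow> real measure" where
  "theta_law l u =
     distr (measure_pmf (poisson_pmf l) \<Otimes>\<^sub>M (\<Pi>\<^sub>M i\<in>{1..}. unif01)) borel
       (\<lambda>(n :: nat, v). 1 / l * (\<Sum>i = 1..n. \<bar>u - v i\<bar>))"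

text \<open>The law of the right-hand side: the mixture, over a uniform \<open>u\<close>, of the law of
  \<open>u\<^sup>2 a + (1 - u)\<^sup>2 b + t\<close> with \<open>a\<close>, \<open>b\<close>, \<open>t\<close> independent with laws \<open>\<mu> (l * u)\<close>,
  \<open>\<mu> (l * (1 - u))\<close> and \<open>theta_law l u\<close>. Families of measures are indexed by positive parameters
  only, so the uniform variable is taken on the open unit interval.
  The monadic bind requires the mixed kernel to be measurable; for the laws of a measurable process
  (see \<open>process_with_laws\<close> below) it is.\<close>

definition rhs_law :: "(real \<Rightarrow> real measure) \<Rightarrow> real \<Rightarrow> real measure" where
  "rhs_law \<mu> l =
     restrict_space unif01 {0<..<1} \<bind> (\<lambda>u.
       distr (\<mu> (l * u) \<Otimes>\<^sub>M (\<mu> (l * (1 - u)) \<Otimes>\<^sub>M theta_law l u)) borel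
         (\<lambda>(a, b, t). u\<^sup>2 * a + (1 - u)\<^sup>2 * b + t))"


section \<open>Solutions and the uniqueness class\<close>

text \<open>Families \<open>(\<mu> l)\<close>, \<open>l > 0\<close>, of probability measures on \<open>[0,\<infinity>)\<close> are functions
  \<open>real \<Rightarrow> real measure\<close> of which only the values at positive arguments matter. A measure
  on \<open>[0,\<infinity>)\<close> is a Borel measure on the reals concentrated there, which is enforced by the
  codomain of the process. The probability space carrying the process is existentially
  quantified in the definitions below; its type has to be a parameter, since HOL cannot quantify
  over types. Existence claims are best made for a concrete type, uniqueness claims for all types.\<close>

definition process_with_laws ::
    "'w measure \<Rightarrow> (real \<Rightarrow> 'w \<Rightarrow> real) \<Rightarrow> (real \<Rightarrow> real measure) \<Rightarrow> bool" where
  "process_with_laws P Y \<mu> \<longleftrightarrow>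
     prob_space P \<and>
     (\<forall>l>0. \<mu> l = distr P borel (Y l)) \<and>
     (\<lambda>(l, w). Y l w) \<in> restrict_space borel {0<..} \<Otimes>\<^sub>M P \<rightarrow>\<^sub>M restrict_space borel {0..}"

definition solution :: "'w itself \<Rightarrow> (real \<Rightarrow> real measure) \<Rightarrow> bool" where
  "solution _ \<mu> \<longleftrightarrow>
     (\<exists>(P :: 'w measure) Y. process_with_laws P Y \<mu> \<and>
        (\<forall>l>0. distr P borel (Y l) = rhs_law (\<lambda>r. distr P borel (Y r)) l))"

definition class_M :: "'w itself \<Rightarrow> (real \<Rightarrow> real measure) \<Rightarrow> bool" where
  "class_M _ \<mu> \<longleftrightarrow>
     (\<exists>(P :: 'w measure) Y. process_with_laws P Y \<mu> \<and>
        (\<exists>\<alpha>. 0 < \<alpha> \<and> \<alpha> < 1 \<and>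
          (\<forall>I. is_interval I \<and> bounded I \<and> I \<subseteq> {0<..} \<longrightarrow>
             (\<exists>C :: real. \<forall>l\<in>I.
                ennreal (l powr \<alpha>) * (\<integral>\<^sup>+w. ennreal (Y l w) \<partial>P) \<le> ennreal C))))"

end

theory Submission imports Defs begin

text \<open>The law of a nonnegative variable is determined by its characteristic function, and the whole proof
takes place on that side.

\<^bold>\<open>Existence.\<close> Given the splitting variables \<open>u\<close>, the sum defining \<open>X l\<close> is a sum over independent
Poisson processes, one for each level, so its conditional characteristic function is explicit
(\<open>poisson_pgf_marks\<close>): level \<open>k\<close> contributes the factor
\<open>exp (l * (\<integral> exp (i (t/l) gap k u x) dx - 1))\<close>, where \<open>gap k u x\<close> is the distance from \<open>x\<close> to the
splitting point of the cell of \<open>x\<close>. This formula takes the place of a thinning argument for Poisson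
processes: the integral over \<open>x\<close> is additive in the domain of integration. Cutting the unit interval
at the root splitting point \<open>U\<close>, the gaps of all later levels are those of the left or of the right
subtree, scaled by \<open>U\<close> or by \<open>1 - U\<close> (\<open>gap_glue_left\<close>, \<open>gap_glue_right\<close>), and the factor of the first level
is the characteristic function of \<open>theta_law l U\<close>. The root variable and the two subtrees are
independent, and each subtree has the law of the whole tree (\<open>distr_glue\<close>). Hence the characteristic
function of the sum over \<open>K + 1\<close> levels is expressed through that of the sum over \<open>K\<close> levels
(\<open>char_upto_Suc\<close>). Letting \<open>K\<close> tend to infinity gives the identity for \<open>nu\<close>
(\<open>char_nu_fixed_point\<close>), because the right-hand side \<open>rhs_law\<close> has the corresponding characteristic
function (\<open>char_rhs_law\<close>).

The passage to the limit requires that the full sum is almost surely finite. Its mean is computed level by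
level: the same scaling shows that the mean gap decreases by the factor \<open>E U\<^sup>2 + E (1 - U)\<^sup>2 = 2/3\<close> from one
level to the next (\<open>gap_mean_Suc\<close>), which gives \<open>E (X l) \<le> 3\<close> for all \<open>l\<close>. This bound also puts \<open>nu\<close> into
the class \<open>class_M\<close>. The measurable process that the definitions ask for is obtained by the quantile
transform on the unit interval (\<open>quantile_process\<close>), as soon as \<open>nu l\<close> is a measurable function of \<open>l\<close>
(\<open>nu_kernel\<close>).

\<^bold>\<open>Uniqueness.\<close> Let \<open>\<delta> l t\<close> be the distance at \<open>t\<close> of the characteristic functions of two solutions. The
moment condition and \<open>\<bar>exp (i x) - 1\<bar> \<le> \<bar>x\<bar>\<close> give \<open>\<delta> l t \<le> D \<bar>t\<bar> l powr (- \<alpha>)\<close> for bounded \<open>l\<close>. Inserting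
such a bound into the right-hand side of the identity multiplies the constant by at most
\<open>2 E (U powr (2 - \<alpha>)) \<le> (2 + \<alpha>) / 3 < 1\<close> (\<open>char_contraction\<close>). Iteration forces \<open>\<delta> = 0\<close>.\<close>

section \<open>Cells and gaps of the recursively split interval\<close>

definition gap :: "nat \<Rightarrow> (nat \<times> nat \<Rightarrow> real) \<Rightarrow> real \<Rightarrow> real" where
  "gap k u x = \<bar>x - split_pt u k (split_idx u k x)\<bar>"

definition unit_valued :: "(nat \<times> nat \<Rightarrow> real) \<Rightarrow> bool" where
  "unit_valued u \<longleftrightarrow> (\<forall>p\<in>tree_index. 0 \<le> u p \<and> u p \<le> 1)"

text \<open>The tree whose root variable is \<open>U\<close> and whose left and right subtrees are \<open>a\<close> and \<open>b\<close>: of the \<open>2 ^ (k + 1)\<close>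
variables at level \<open>k + 1\<close>, the first half belongs to \<open>a\<close>, the second half to \<open>b\<close>. Restriction to \<open>tree_index\<close>
makes it a point of the product space.\<close>

definition glue ::
    "real \<Rightarrow> (nat \<times> nat \<Rightarrow> real) \<Rightarrow> (nat \<times> nat \<Rightarrow> real) \<Rightarrow> nat \<times> nat \<Rightarrow> real" where
  "glue U a b = (\<lambda>(k, j)\<in>tree_index.
     if k = 0 then U
     else if j \<le> 2 ^ (k - 1) then a (k - 1, j) else b (k - 1, j - 2 ^ (k - 1)))"

lemma gap_nonneg: "0 \<le> gap k u x"
  by (simp add: gap_def)

lemma split_pt_0 [simp]: "split_pt u k 0 = 0"
  by (induction k) (auto simp: split_pt.simps(2))

lemma split_pt_top [simp]: "split_pt u k (2 ^ k) = 1"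
  by (induction k) (auto simp: split_pt.simps(2))

text \<open>The recursion equation for \<open>split_pt\<close> branches on the parity of the index. The two branches are used as
separate equations, which do not unfold the levels all the way down.\<close>

declare split_pt.simps(2) [simp del]

lemma split_pt_even: "split_pt u (Suc k) (2 * m) = split_pt u k m"
  by (simp add: split_pt.simps(2))

lemma split_pt_odd:
  "split_pt u (Suc k) (2 * m + 1) =
     (1 - u (k, Suc m)) * split_pt u k m + u (k, Suc m) * split_pt u k (Suc m)"
  by (simp add: split_pt.simps(2))

lemma split_pt_Suc_mono:
  assumes "unit_valued u" "j < 2 ^ k"
  shows "split_pt u k j \<le> split_pt u k (Suc j)"
  using assms(2)
proof (induction k arbitrary: j)
  case (Suc k)
  show ?case
  proof (cases "even j")
    case True
    then obtain m where m: "j = 2 * m" by (elim evenE)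
    with Suc.prems have "m < 2 ^ k" by simp
    moreover from this have "(k, Suc m) \<in> tree_index" by (simp add: tree_index_def)
    with assms(1) have "0 \<le> u (k, Suc m)" by (auto simp: unit_valued_def)
    ultimately have "0 \<le> u (k, Suc m) * (split_pt u k (Suc m) - split_pt u k m)"
      using Suc.IH[of m] by simp
    then show ?thesis
      using split_pt_even[of u k m] split_pt_odd[of u k m] by (simp add: m algebra_simps)
  next
    case False
    then obtain m where m: "j = 2 * m + 1" by (elim oddE)
    with Suc.prems have "m < 2 ^ k" by simp
    moreover from this have "(k, Suc m) \<in> tree_index" by (simp add: tree_index_def)
    with assms(1) have "u (k, Suc m) \<le> 1" by (auto simp: unit_valued_def)
    ultimately have "0 \<le> (1 - u (k, Suc m)) * (split_pt u k (Suc m) - split_pt u k m)"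
      using Suc.IH[of m] by simp
    then show ?thesis
      using split_pt_even[of u k "Suc m"] split_pt_odd[of u k m] by (simp add: m algebra_simps)
  qed
qed simp

lemma split_pt_mono:
  assumes "unit_valued u" "i \<le> j" "j \<le> 2 ^ k"
  shows "split_pt u k i \<le> split_pt u k j"
  using assms(2,3)
proof (induction j rule: dec_induct)
  case (step n)
  with split_pt_Suc_mono[OF assms(1), of n k] show ?case by simp
qed simp

lemma split_idx_eq:
  assumes "unit_valued u" "1 \<le> j" "j \<le> 2 ^ k"
    and "split_pt u k (j - 1) \<le> x" "x < split_pt u k j"
  shows "split_idx u (Suc k) x = 2 * j - 1"
proof -
  have "(LEAST j. 1 \<le> j \<and> j \<le> 2 ^ k \<and> split_pt u k (j - 1) \<le> x \<and> x < split_pt u k j) = j"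
  proof (rule Least_equality)
    fix i assume i: "1 \<le> i \<and> i \<le> 2 ^ k \<and> split_pt u k (i - 1) \<le> x \<and> x < split_pt u k i"
    show "j \<le> i"
    proof (rule ccontr)
      assume "\<not> j \<le> i"
      then have "split_pt u k i \<le> split_pt u k (j - 1)"
        using assms(3) by (intro split_pt_mono[OF assms(1)]) auto
      with i assms(4) show False by simp
    qed
  qed (use assms in auto)
  then show ?thesis by (simp add: split_idx_def)
qed

text \<open>The cell ends at the first splitting point to the right of \<open>x\<close>, which exists because the last one is \<open>1\<close>.\<close>

lemma cell_exists:
  assumes "0 \<le> x" "x < 1"
  obtains j where "1 \<le> j" "j \<le> 2 ^ k" "split_pt u k (j - 1) \<le> x" "x < split_pt u k j"
proof -
  define j where "j = (LEAST j. x < split_pt u k j)"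
  have top: "x < split_pt u k (2 ^ k)" using assms by simp
  have j: "x < split_pt u k j" unfolding j_def by (rule LeastI[of _ "2 ^ k"]) (rule top)
  have "j \<noteq> 0" using j assms by (auto intro: ccontr)
  moreover have "j \<le> 2 ^ k" unfolding j_def by (rule Least_le) (rule top)
  moreover have "split_pt u k (j - 1) \<le> x"
    using not_less_Least[of "j - 1" "\<lambda>j. x < split_pt u k j"] \<open>j \<noteq> 0\<close> by (simp add: j_def)
  ultimately show ?thesis using that[of j] j by simp
qed

lemma gap_in_cell:
  assumes "unit_valued u" "0 \<le> x" "x < 1"
  obtains j where "1 \<le> j" "j \<le> 2 ^ k" "split_pt u k (j - 1) \<le> x" "x < split_pt u k j"
    "gap (Suc k) u x = \<bar>x - split_pt u (Suc k) (2 * j - 1)\<bar>"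
proof -
  obtain j where j: "1 \<le> j" "j \<le> 2 ^ k" "split_pt u k (j - 1) \<le> x" "x < split_pt u k j"
    using cell_exists[OF assms(2,3)] .
  then show ?thesis using that[of j] split_idx_eq[OF assms(1) j] by (simp add: gap_def)
qed

lemma gap_1:
  assumes "0 \<le> x" "x < 1"
  shows "gap 1 u x = \<bar>x - u (0, 1)\<bar>"
proof -
  have "(LEAST j. 1 \<le> j \<and> j \<le> 2 ^ 0 \<and> split_pt u 0 (j - 1) \<le> x \<and> x < split_pt u 0 j) = 1"
    by (rule Least_equality) (use assms in auto)
  then have "split_idx u 1 x = 1" by (simp add: split_idx_def)
  then show ?thesis by (simp add: gap_def split_pt.simps(2))
qed

lemma glue_root: "glue U a b (0, 1) = U"
  by (simp add: glue_def tree_index_def)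

lemma glue_left: "1 \<le> j \<Longrightarrow> j \<le> 2 ^ k \<Longrightarrow> glue U a b (Suc k, j) = a (k, j)"
  by (simp add: glue_def tree_index_def)

lemma glue_right: "1 \<le> j \<Longrightarrow> j \<le> 2 ^ k \<Longrightarrow> glue U a b (Suc k, 2 ^ k + j) = b (k, j)"
  by (simp add: glue_def tree_index_def)

lemma unit_valued_glue:
  assumes "0 \<le> U" "U \<le> 1" "unit_valued a" "unit_valued b"
  shows "unit_valued (glue U a b)"
  unfolding unit_valued_def
proof
  fix p assume p: "p \<in> tree_index"
  obtain k j where kj: "p = (k, j)" by (cases p)
  show "0 \<le> glue U a b p \<and> glue U a b p \<le> 1"
  proof (cases k)
    case 0
    with p kj assms show ?thesis by (simp add: glue_def)
  next
    case (Suc l)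
    with p kj have "1 \<le> j" "j \<le> 2 ^ l + 2 ^ l" by (simp_all add: tree_index_def)
    then have "j \<le> 2 ^ l \<Longrightarrow> (l, j) \<in> tree_index"
      "\<not> j \<le> 2 ^ l \<Longrightarrow> (l, j - 2 ^ l) \<in> tree_index" by (auto simp: tree_index_def)
    with p kj Suc assms show ?thesis by (auto simp: glue_def unit_valued_def)
  qed
qed

text \<open>One level below the root, the splitting points to the left of \<open>U\<close> are those of the left subtree scaled to
\<open>[0, U]\<close>; those to the right of \<open>U\<close> are the splitting points of the right subtree scaled to \<open>[U, 1]\<close>. At level
\<open>0\<close> of the subtrees this is the root split, and a further level only forms convex combinations of neighbours,
which commute with affine maps.\<close>

lemma split_pt_glue_left:
  "j \<le> 2 ^ k \<Longrightarrow> split_pt (glue U a b) (Suc k) j = U * split_pt a k j"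
proof (induction k arbitrary: j)
  case 0
  then have "j = 0 \<or> j = 1" by auto
  then show ?case using glue_root by (auto simp: split_pt.simps(2))
next
  case (Suc k)
  show ?case
  proof (cases "even j")
    case True
    then obtain m where m: "j = 2 * m" by (elim evenE)
    with Suc.prems have "m \<le> 2 ^ k" by simp
    from Suc.IH[OF this] show ?thesis
      using split_pt_even[of "glue U a b" "Suc k" "m"] split_pt_even[of a k m]
      by (simp add: m)
  next
    case False
    then obtain m where m: "j = 2 * m + 1" by (elim oddE)
    with Suc.prems have "m < 2 ^ k" by simp
    then have "split_pt (glue U a b) (Suc k) m = U * split_pt a k m"
      "split_pt (glue U a b) (Suc k) (Suc m) = U * split_pt a k (Suc m)"
      "glue U a b (Suc k, Suc m) = a (k, Suc m)"
      using Suc.IH[of m] Suc.IH[of "Suc m"] glue_left[of "Suc m" k] by (simp_all)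
    then have "split_pt (glue U a b) (Suc (Suc k)) (2 * m + 1) = U * split_pt a (Suc k) (2 * m + 1)"
      unfolding split_pt_odd by (simp add: algebra_simps)
    then show ?thesis by (simp add: m)
  qed
qed

lemma split_pt_glue_right:
  "j \<le> 2 ^ k \<Longrightarrow> split_pt (glue U a b) (Suc k) (2 ^ k + j) = U + (1 - U) * split_pt b k j"
proof (induction k arbitrary: j)
  case 0
  then have "j = 0 \<or> j = 1" by auto
  then show ?case using glue_root by (auto simp: split_pt.simps(2))
next
  case (Suc k)
  show ?case
  proof (cases "even j")
    case True
    then obtain m where m: "j = 2 * m" by (elim evenE)
    with Suc.prems have "m \<le> 2 ^ k" by simp
    from Suc.IH[OF this] show ?thesis
      using split_pt_even[of "glue U a b" "Suc k" "2 ^ k + m"] split_pt_even[of b k m]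
      by (simp add: m)
  next
    case False
    then obtain m where m: "j = 2 * m + 1" by (elim oddE)
    with Suc.prems have "m < 2 ^ k" by simp
    then have eqs: "split_pt (glue U a b) (Suc k) (2 ^ k + m) = U + (1 - U) * split_pt b k m"
      "split_pt (glue U a b) (Suc k) (Suc (2 ^ k + m)) = U + (1 - U) * split_pt b k (Suc m)"
      "glue U a b (Suc k, Suc (2 ^ k + m)) = b (k, Suc m)"
      using Suc.IH[of m] Suc.IH[of "Suc m"] glue_right[of "Suc m" k] by (simp_all)
    have "split_pt (glue U a b) (Suc (Suc k)) (2 * (2 ^ k + m) + 1) =
        U + (1 - U) * split_pt b (Suc k) (2 * m + 1)"
      unfolding split_pt_odd eqs by (simp add: algebra_simps)
    then show ?thesis by (simp add: m algebra_simps)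
  qed
qed

text \<open>The self-similarity of the gaps. A cell of a subtree is mapped affinely onto a cell of the glued tree one level
deeper, together with its splitting point.\<close>

lemma gap_glue_left:
  assumes "0 < U" "U < 1" "unit_valued a" "unit_valued b" "0 \<le> x" "x < 1"
  shows "gap (Suc (Suc k)) (glue U a b) (U * x) = U * gap (Suc k) a x"
proof -
  obtain j where j: "1 \<le> j" "j \<le> 2 ^ k" "split_pt a k (j - 1) \<le> x" "x < split_pt a k j"
    and g: "gap (Suc k) a x = \<bar>x - split_pt a (Suc k) (2 * j - 1)\<bar>"
    using gap_in_cell[OF assms(3,5,6)] .
  have "split_idx (glue U a b) (Suc (Suc k)) (U * x) = 2 * j - 1"
    using j assms
    by (intro split_idx_eq unit_valued_glue) (simp_all add: split_pt_glue_left)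
  then have "gap (Suc (Suc k)) (glue U a b) (U * x) = \<bar>U * x - U * split_pt a (Suc k) (2 * j - 1)\<bar>"
    using j by (simp add: gap_def split_pt_glue_left)
  also have "\<dots> = U * gap (Suc k) a x"
    using assms(1) by (simp add: g right_diff_distrib[symmetric] abs_mult)
  finally show ?thesis .
qed

lemma gap_glue_right:
  assumes "0 < U" "U < 1" "unit_valued a" "unit_valued b" "0 \<le> x" "x < 1"
  shows "gap (Suc (Suc k)) (glue U a b) (U + (1 - U) * x) = (1 - U) * gap (Suc k) b x"
proof -
  obtain j where j: "1 \<le> j" "j \<le> 2 ^ k" "split_pt b k (j - 1) \<le> x" "x < split_pt b k j"
    and g: "gap (Suc k) b x = \<bar>x - split_pt b (Suc k) (2 * j - 1)\<bar>"
    using gap_in_cell[OF assms(4,5,6)] .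
  have "split_idx (glue U a b) (Suc (Suc k)) (U + (1 - U) * x) = 2 * (2 ^ k + j) - 1"
  proof (rule split_idx_eq)
    have idx: "2 ^ k + j - 1 = 2 ^ k + (j - 1)" using j by simp
    show "split_pt (glue U a b) (Suc k) (2 ^ k + j - 1) \<le> U + (1 - U) * x"
      unfolding idx by (subst split_pt_glue_right) (use j assms in auto)
  qed (use j assms in \<open>auto simp: split_pt_glue_right unit_valued_glue\<close>)
  moreover have "2 * (2 ^ k + j) - 1 = 2 ^ Suc k + (2 * j - 1)" using j by simp
  ultimately have "gap (Suc (Suc k)) (glue U a b) (U + (1 - U) * x) =
      \<bar>U + (1 - U) * x - (U + (1 - U) * split_pt b (Suc k) (2 * j - 1))\<bar>"
    using j split_pt_glue_right[of "2 * j - 1" "Suc k" U a b] by (simp add: gap_def)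
  also have "\<dots> = \<bar>(1 - U) * (x - split_pt b (Suc k) (2 * j - 1))\<bar>"
    by (simp add: right_diff_distrib)
  also have "\<dots> = (1 - U) * gap (Suc k) b x"
    using assms(2) by (simp add: g abs_mult)
  finally show ?thesis .
qed

section \<open>Uniform variables and infinite products\<close>

abbreviation tree_space :: "(nat \<times> nat \<Rightarrow> real) measure" where
  "tree_space \<equiv> \<Pi>\<^sub>M p\<in>tree_index. unif01"

lemma prob_space_unif01: "prob_space unif01"
  unfolding unif01_def by (rule prob_space_uniform_measure) auto

interpretation unif01: prob_space unif01
  by (rule prob_space_unif01)

lemma sets_unif01 [simp, measurable_cong]: "sets unif01 = sets borel"
  by (simp add: unif01_def)

lemma measurable_unif01_iff [simp]: "f \<in> unif01 \<rightarrow>\<^sub>M N \<longleftrightarrow> f \<in> borel \<rightarrow>\<^sub>M N"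
  unfolding measurable_cong_sets[OF sets_unif01 refl] ..

lemma space_unif01 [simp]: "space unif01 = UNIV"
  by (simp add: unif01_def)

lemma unif01_eq_density: "unif01 = density lborel (indicator {0..1})"
  unfolding unif01_def uniform_measure_def by (simp add: divide_ennreal_def)

lemma AE_unif01: "AE x in unif01. 0 < x \<and> x < 1"
proof -
  have "AE x in lborel. x \<noteq> (0::real)" "AE x in lborel. x \<noteq> (1::real)"
    by (rule AE_lborel_singleton)+
  then have "AE x in lborel. x \<in> {0..1} \<longrightarrow> 0 < x \<and> x < (1::real)" by eventually_elim auto
  then show ?thesis unfolding unif01_def by (intro AE_uniform_measureI) auto
qed

interpretation tree: prob_space tree_space
  by (intro prob_space_PiM prob_space_unif01)

lemma nn_integral_unif01:
  "f \<in> borel_measurable borel \<Longrightarrow>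
    (\<integral>\<^sup>+x. f x \<partial>unif01) = (\<integral>\<^sup>+x. f x * indicator {0..1} x \<partial>lborel)"
  unfolding unif01_eq_density by (subst nn_integral_density) (auto simp: mult.commute)

lemma integral_unif01:
  fixes f :: "real \<Rightarrow> 'a :: {banach, second_countable_topology}"
  assumes [measurable]: "f \<in> borel_measurable borel"
  shows "(\<integral>x. f x \<partial>unif01) = (\<integral>x. indicator {0..1} x *\<^sub>R f x \<partial>lborel)"
proof -
  have eq: "unif01 = density lborel (\<lambda>x. ennreal (indicator {0..1} x))"
    unfolding unif01_eq_density by (simp add: ennreal_indicator)
  show ?thesis by (subst eq, subst integral_density) auto
qed

lemma affine_le_1_iff: "U + (1 - U) * x \<le> 1 \<longleftrightarrow> x \<le> 1" if "U < 1" for U x :: real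
proof -
  have "U + (1 - U) * x \<le> 1 \<longleftrightarrow> (1 - U) * x \<le> (1 - U) * 1"
    by (simp only: mult_1_right le_diff_eq add.commute)
  also have "\<dots> \<longleftrightarrow> x \<le> 1" using that by (subst mult_le_cancel_left_pos) auto
  finally show ?thesis .
qed

text \<open>Given that a uniform point falls into \<open>[0, U]\<close> or into \<open>[U, 1]\<close>, it is uniform there. In the integral over
the position of a point this replaces the thinning of the Poisson process at the root splitting point.\<close>

lemma nn_integral_unif01_split:
  fixes U :: real
  assumes U: "0 < U" "U < 1" and [measurable]: "f \<in> borel_measurable borel"
  shows "(\<integral>\<^sup>+x. f x \<partial>unif01) =
    ennreal U * (\<integral>\<^sup>+x. f (U * x) \<partial>unif01) +
    ennreal (1 - U) * (\<integral>\<^sup>+x. f (U + (1 - U) * x) \<partial>unif01)"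
proof -
  have "(\<integral>\<^sup>+x. f x \<partial>unif01) =
      (\<integral>\<^sup>+x. f x * indicator {0..U} x + f x * indicator {U..1} x \<partial>lborel)"
    unfolding nn_integral_unif01[OF assms(3)]
  proof (rule nn_integral_cong_AE)
    show "AE x in lborel. f x * indicator {0..1} x =
        f x * indicator {0..U} x + f x * indicator {U..1} x"
      using AE_lborel_singleton[of U]
      by eventually_elim (use U in \<open>auto simp: indicator_def\<close>)
  qed
  also have "\<dots> = (\<integral>\<^sup>+x. f x * indicator {0..U} x \<partial>lborel) + (\<integral>\<^sup>+x. f x * indicator {U..1} x \<partial>lborel)"
    by (rule nn_integral_add) auto
  also have "(\<integral>\<^sup>+x. f x * indicator {0..U} x \<partial>lborel) =
      ennreal U * (\<integral>\<^sup>+x. f (U * x) * indicator {0..1} x \<partial>lborel)"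
    by (subst nn_integral_real_affine[where t=0 and c=U])
       (use U in \<open>auto intro!: arg_cong2[where f="(*)"] nn_integral_cong
          simp: indicator_def zero_le_mult_iff mult_le_cancel_left1\<close>)
  also have "(\<integral>\<^sup>+x. f x * indicator {U..1} x \<partial>lborel) =
      ennreal (1 - U) * (\<integral>\<^sup>+x. f (U + (1 - U) * x) * indicator {0..1} x \<partial>lborel)"
  proof -
    have "U \<le> U + (1 - U) * x \<longleftrightarrow> 0 \<le> x" "U + (1 - U) * x \<le> 1 \<longleftrightarrow> x \<le> 1" for x
      using U affine_le_1_iff[of U x] by (auto simp: zero_le_mult_iff)
    then show ?thesis
    by (subst nn_integral_real_affine[where t=U and c="1 - U"])
       (use U in \<open>auto intro!: arg_cong2[where f="(*)"] nn_integral_cong simp: indicator_def\<close>)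
  qed
  finally show ?thesis by (simp add: nn_integral_unif01)
qed

lemma integral_unif01_split:
  fixes f :: "real \<Rightarrow> 'a :: {banach, second_countable_topology}"
  assumes U: "0 < U" "U < 1" and [measurable]: "f \<in> borel_measurable borel"
    and bdd: "\<And>x. norm (f x) \<le> B"
  shows "(\<integral>x. f x \<partial>unif01) =
    U *\<^sub>R (\<integral>x. f (U * x) \<partial>unif01) + (1 - U) *\<^sub>R (\<integral>x. f (U + (1 - U) * x) \<partial>unif01)"
proof -
  have int: "integrable lborel (\<lambda>x. indicator {a..b} x *\<^sub>R f x)" for a b
    by (rule integrableI_bounded_set_indicator[where B=B]) (auto simp: emeasure_lborel_Icc_eq bdd)
  have "(\<integral>x. f x \<partial>unif01) =
      (\<integral>x. indicator {0..U} x *\<^sub>R f x + indicator {U..1} x *\<^sub>R f x \<partial>lborel)"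
    unfolding integral_unif01[OF assms(3)]
  proof (rule integral_cong_AE)
    show "AE x in lborel. indicator {0..1} x *\<^sub>R f x =
        indicator {0..U} x *\<^sub>R f x + indicator {U..1} x *\<^sub>R f x"
      using AE_lborel_singleton[of U]
      by eventually_elim (use U in \<open>auto simp: indicator_def\<close>)
  qed auto
  also have "\<dots> = (\<integral>x. indicator {0..U} x *\<^sub>R f x \<partial>lborel) + (\<integral>x. indicator {U..1} x *\<^sub>R f x \<partial>lborel)"
    by (intro Bochner_Integration.integral_add int)
  also have "(\<integral>x. indicator {0..U} x *\<^sub>R f x \<partial>lborel) =
      U *\<^sub>R (\<integral>x. indicator {0..1} x *\<^sub>R f (U * x) \<partial>lborel)"
    by (subst lborel_integral_real_affine[where t=0 and c=U])
       (use U in \<open>auto intro!: arg_cong2[where f="(*\<^sub>R)"] Bochner_Integration.integral_cong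
          simp: indicator_def zero_le_mult_iff mult_le_cancel_left1\<close>)
  also have "(\<integral>x. indicator {U..1} x *\<^sub>R f x \<partial>lborel) =
      (1 - U) *\<^sub>R (\<integral>x. indicator {0..1} x *\<^sub>R f (U + (1 - U) * x) \<partial>lborel)"
  proof -
    have "U \<le> U + (1 - U) * x \<longleftrightarrow> 0 \<le> x" "U + (1 - U) * x \<le> 1 \<longleftrightarrow> x \<le> 1" for x
      using U affine_le_1_iff[of U x] by (auto simp: zero_le_mult_iff)
    then show ?thesis
    by (subst lborel_integral_real_affine[where t=U and c="1 - U"])
       (use U in \<open>auto intro!: arg_cong2[where f="(*\<^sub>R)"] Bochner_Integration.integral_cong simp: indicator_def\<close>)
  qed
  finally show ?thesis by (simp add: integral_unif01)
qed

text \<open>Outside the index set the points of a product space have the constant value \<open>undefined\<close>, so evaluation is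
measurable at every index. This is needed because \<open>split_idx\<close> takes an unspecified value when \<open>x\<close> lies in no
cell, and measurability has to hold without exceptions.\<close>

lemma measurable_PiM_any_component:
  assumes "space N = UNIV"
  shows "(\<lambda>x. x i) \<in> PiM I (\<lambda>_. N) \<rightarrow>\<^sub>M N"
proof (cases "i \<in> I")
  case False
  have "x i = undefined" if "x \<in> space (PiM I (\<lambda>_. N))" for x
    using that PiE_arb[OF _ False] unfolding space_PiM by blast
  then show ?thesis by (subst measurable_cong[where g="\<lambda>_. undefined"]) (auto simp: assms)
qed measurable

lemma measurable_unif01_component:
  "(\<lambda>u. u p) \<in> borel_measurable (PiM I (\<lambda>_. unif01))"
  using measurable_PiM_any_component[of unif01 p I]
  unfolding measurable_cong_sets[OF refl sets_unif01] by simp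

lemma measurable_split_pt [measurable]: "(\<lambda>u. split_pt u k j) \<in> borel_measurable tree_space"
proof (induction k arbitrary: j)
  case (Suc k)
  note [measurable] = Suc measurable_unif01_component
  show ?case by (cases "even j") (simp_all add: split_pt.simps(2) Let_def)
qed simp

lemma measurable_gap [measurable]:
  "(\<lambda>(u, x). gap k u x) \<in> borel_measurable (tree_space \<Otimes>\<^sub>M borel)"
proof -
  have "(\<lambda>q. split_idx (fst q) k (snd q)) \<in> (tree_space \<Otimes>\<^sub>M borel) \<rightarrow>\<^sub>M count_space UNIV"
    unfolding split_idx_def by measurable
  moreover have "(\<lambda>q. \<bar>snd q - split_pt (fst q) k j\<bar>) \<in> borel_measurable (tree_space \<Otimes>\<^sub>M borel)" for j
    by measurable
  ultimately show ?thesis unfolding gap_def split_beta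
    by (rule measurable_compose_countable[rotated])
qed

lemma measurable_gap2 [measurable (raw)]:
  assumes "f \<in> M \<rightarrow>\<^sub>M tree_space" "g \<in> borel_measurable M"
  shows "(\<lambda>w. gap k (f w) (g w)) \<in> borel_measurable M"
  using measurable_compose[OF measurable_Pair[OF assms] measurable_gap[of k]] by simp

lemma measurable_gap_section [measurable]:
  "u \<in> space tree_space \<Longrightarrow> gap k u \<in> borel_measurable borel"
  using measurable_Pair2[OF measurable_gap, of u k] by simp

lemma AE_PiM_components:
  assumes "\<And>i. prob_space (M i)" "countable I" "\<And>i. i \<in> I \<Longrightarrow> AE x in M i. P i x"
  shows "AE x in PiM I M. \<forall>i\<in>I. P i (x i)"
  using assms by (auto simp: AE_ball_countable intro!: AE_PiM_component)

lemma AE_tree_unit_valued: "AE u in tree_space. unit_valued u"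
  unfolding unit_valued_def
  by (rule AE_PiM_components)
     (auto simp: prob_space_unif01 simp del: AE_conj_iff intro!: eventually_mono[OF AE_unif01])

text \<open>Independence of finitely many coordinates of an arbitrary, possibly infinite, product.\<close>

lemma PiM_integral_prod_components:
  fixes f :: "'i \<Rightarrow> 'a \<Rightarrow> 'b :: {real_normed_field, banach, second_countable_topology}"
  assumes "\<And>i. prob_space (M i)" "finite J" "J \<subseteq> I"
    and int: "\<And>i. i \<in> J \<Longrightarrow> integrable (M i) (f i)"
  shows "(\<integral>x. (\<Prod>i\<in>J. f i (x i)) \<partial>PiM I M) = (\<Prod>i\<in>J. \<integral>y. f i y \<partial>M i)"
proof -
  interpret prob_space "M i" for i by fact
  interpret product_prob_space M I ..
  have [measurable]: "f i \<in> borel_measurable (M i)" if "i \<in> J" for i using int[OF that] by auto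
  have "(\<Prod>i\<in>J. \<integral>y. f i y \<partial>M i) = (\<integral>x. (\<Prod>i\<in>J. f i (x i)) \<partial>PiM J M)"
    by (rule product_integral_prod[symmetric]) fact+
  also have "\<dots> = (\<integral>x. (\<Prod>i\<in>J. f i (x i)) \<partial>distr (PiM I M) (PiM J M) (\<lambda>x. restrict x J))"
    by (simp add: distr_PiM_restrict_finite assms)
  also have "\<dots> = (\<integral>x. (\<Prod>i\<in>J. f i (restrict x J i)) \<partial>PiM I M)"
    by (intro integral_distr measurable_restrict_subset assms) measurable
  also have "\<dots> = (\<integral>x. (\<Prod>i\<in>J. f i (x i)) \<partial>PiM I M)"
    by (intro Bochner_Integration.integral_cong prod.cong) auto
  finally show ?thesis by simp
qed

text \<open>The definition of \<open>X\<close> sums over a set of points, in which coinciding points would be counted once. Since the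
uniform law has no atoms, Fubini's theorem on two coordinates excludes coincidences almost surely.\<close>

lemma AE_PiM_unif01_distinct_components:
  assumes "i \<in> I" "j \<in> I" "i \<noteq> j"
  shows "AE x in PiM I (\<lambda>_. unif01). x i \<noteq> x j"
proof -
  interpret product_prob_space "\<lambda>_. unif01" I ..
  let ?J = "insert i {j}"
  have comp: "(\<lambda>x. x k) \<in> borel_measurable (PiM K (\<lambda>_. unif01))" if "k \<in> K" for k and K :: "'a set"
    using measurable_component_singleton[OF that, of "\<lambda>_. unif01"]
    unfolding measurable_cong_sets[OF refl sets_unif01] .
  have meas: "(\<lambda>x. indicator {x. x i = x j} x :: ennreal) \<in> borel_measurable (PiM K (\<lambda>_. unif01))"
    if [simp]: "i \<in> K" "j \<in> K" for K
  proof -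
    have "(\<lambda>x. indicator {0 :: real} (x i - x j) :: ennreal) \<in> borel_measurable (PiM K (\<lambda>_. unif01))"
      by (rule measurable_compose[OF borel_measurable_diff[OF comp comp]]) auto
    then show ?thesis by (simp add: indicator_def)
  qed
  have null: "emeasure unif01 {y} = 0" for y
    by (simp add: unif01_def Int_insert_right)
  have "(\<integral>\<^sup>+x. indicator {x. x i = x j} x \<partial>PiM I (\<lambda>_. unif01)) =
      (\<integral>\<^sup>+x. indicator {x. x i = x j} (restrict x ?J) \<partial>PiM I (\<lambda>_. unif01))"
    by (intro nn_integral_cong) (auto simp: indicator_def)
  also have "\<dots> = (\<integral>\<^sup>+x. indicator {x. x i = x j} x
      \<partial>distr (PiM I (\<lambda>_. unif01)) (PiM ?J (\<lambda>_. unif01)) (\<lambda>x. restrict x ?J))"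
    using assms meas[of ?J] by (intro nn_integral_distr[symmetric] measurable_restrict_subset) auto
  also have "distr (PiM I (\<lambda>_. unif01)) (PiM ?J (\<lambda>_. unif01)) (\<lambda>x. restrict x ?J) = PiM ?J (\<lambda>_. unif01)"
    using assms by (intro distr_PiM_restrict_finite) auto
  also have "(\<integral>\<^sup>+x. indicator {x. x i = x j} x \<partial>PiM ?J (\<lambda>_. unif01)) =
      (\<integral>\<^sup>+x. (\<integral>\<^sup>+y. indicator {x. x i = x j} (x(i := y)) \<partial>unif01) \<partial>PiM {j} (\<lambda>_. unif01))"
    using assms meas[of ?J] by (intro product_nn_integral_insert) auto
  also have "\<dots> = (\<integral>\<^sup>+x. (\<integral>\<^sup>+y. indicator {x j} y \<partial>unif01) \<partial>PiM {j} (\<lambda>_. unif01))"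
    using \<open>i \<noteq> j\<close> by (intro nn_integral_cong) (auto simp: indicator_def)
  also have "\<dots> = 0" by (simp add: null)
  finally have "AE x in PiM I (\<lambda>_. unif01). indicator {x. x i = x j} x = (0 :: ennreal)"
    using meas[of I] assms by (subst (asm) nn_integral_0_iff_AE) auto
  then show ?thesis by eventually_elim (auto simp: indicator_def split: if_splits)
qed

section \<open>The law of the tree is self-similar\<close>

text \<open>The positions, in the whole tree, of the variables of the left and of the right subtree.\<close>

definition left_index :: "nat \<times> nat \<Rightarrow> nat \<times> nat" where
  "left_index = (\<lambda>(k, j). (Suc k, j))"

definition right_index :: "nat \<times> nat \<Rightarrow> nat \<times> nat" where
  "right_index = (\<lambda>(k, j). (Suc k, 2 ^ k + j))"

lemma inj_left_index: "inj left_index" and inj_right_index: "inj right_index"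
  by (auto simp: inj_def left_index_def right_index_def)

lemma tree_index_eq: "tree_index = {(0, 1)} \<union> left_index ` tree_index \<union> right_index ` tree_index"
proof (intro equalityI subsetI)
  fix p assume "p \<in> tree_index"
  then obtain k j where p: "p = (k, j)" "1 \<le> j" "j \<le> 2 ^ k" by (auto simp: tree_index_def)
  show "p \<in> {(0, 1)} \<union> left_index ` tree_index \<union> right_index ` tree_index"
  proof (cases k)
    case (Suc l)
    consider "j \<le> 2 ^ l" | "1 \<le> j - 2 ^ l" "j - 2 ^ l \<le> 2 ^ l" "j = 2 ^ l + (j - 2 ^ l)"
      using p Suc by fastforce
    then show ?thesis
    proof cases
      case 1
      then have "p = left_index (l, j)" "(l, j) \<in> tree_index"
        using p Suc by (auto simp: left_index_def tree_index_def)
      then show ?thesis by blast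
    next
      case 2
      then have "p = right_index (l, j - 2 ^ l)" "(l, j - 2 ^ l) \<in> tree_index"
        using p Suc by (auto simp: right_index_def tree_index_def)
      then show ?thesis by blast
    qed
  qed (use p in auto)
qed (auto simp: tree_index_def left_index_def right_index_def)

lemma left_index_not_right:
  "p \<in> tree_index \<Longrightarrow> q \<in> tree_index \<Longrightarrow> left_index p \<noteq> right_index q"
  by (auto simp: tree_index_def left_index_def right_index_def)

lemma glue_left_index: "p \<in> tree_index \<Longrightarrow> glue U a b (left_index p) = a p"
  by (cases p) (auto simp: left_index_def tree_index_def glue_left)

lemma glue_right_index: "p \<in> tree_index \<Longrightarrow> glue U a b (right_index p) = b p"
  by (cases p) (auto simp: right_index_def tree_index_def glue_right)

lemma measurable_glue [measurable (raw)]: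
  assumes [measurable]: "f \<in> borel_measurable M" "g \<in> M \<rightarrow>\<^sub>M tree_space" "h \<in> M \<rightarrow>\<^sub>M tree_space"
  shows "(\<lambda>w. glue (f w) (g w) (h w)) \<in> M \<rightarrow>\<^sub>M tree_space"
  unfolding glue_def
proof (rule measurable_restrict)
  fix p :: "nat \<times> nat"
  obtain k j where "p = (k, j)" by (cases p)
  moreover have "(\<lambda>w. g w q) \<in> borel_measurable M" "(\<lambda>w. h w q) \<in> borel_measurable M" for q
    by (rule measurable_compose[OF _ measurable_unif01_component], fact)+
  ultimately show "(\<lambda>w. case p of (k, j) \<Rightarrow> if k = 0 then f w
      else if j \<le> 2 ^ (k - 1) then g w (k - 1, j) else h w (k - 1, j - 2 ^ (k - 1))) \<in> M \<rightarrow>\<^sub>M unif01"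
    unfolding measurable_cong_sets[OF refl sets_unif01]
    by (cases "k = 0"; cases "j \<le> 2 ^ (k - 1)") simp_all
qed

text \<open>A product measure is determined by cylinder sets. The index set is the disjoint union of the root and of two
copies of itself, so the preimage of a cylinder under gluing is a rectangle with cylinders as sides, and both
measures are the same finite product.\<close>

lemma distr_glue:
  "distr (unif01 \<Otimes>\<^sub>M (tree_space \<Otimes>\<^sub>M tree_space)) tree_space (\<lambda>(U, a, b). glue U a b) = tree_space"
proof -
  interpret product_prob_space "\<lambda>_. unif01" tree_index ..
  interpret TT: pair_prob_space tree_space tree_space ..
  show ?thesis
  proof (rule PiM_eq)
    fix J and F :: "nat \<times> nat \<Rightarrow> real set"
    assume J: "finite J" "J \<subseteq> tree_index" and F: "\<And>j. j \<in> J \<Longrightarrow> F j \<in> sets unif01"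
    define g where "g p = emeasure unif01 (F p)" for p
    \<comment> \<open>The cylinder condition at the root, if there is one, and those on the left and right subtree.\<close>
    define A where "A = (if (0, 1) \<in> J then F (0, 1) else UNIV)"
    define L where "L = {p\<in>tree_index. left_index p \<in> J}"
    define R where "R = {p\<in>tree_index. right_index p \<in> J}"
    define SL where "SL = {a\<in>space tree_space. \<forall>p\<in>L. a p \<in> F (left_index p)}"
    define SR where "SR = {a\<in>space tree_space. \<forall>p\<in>R. a p \<in> F (right_index p)}"
    have fin: "finite L" "finite R"
      unfolding L_def R_def using J inj_left_index inj_right_index
      by (auto intro: finite_subset[OF _ finite_vimageI[OF J(1)]])
    have J_eq: "J = (J \<inter> {(0, 1)}) \<union> left_index ` L \<union> right_index ` R"
    proof (intro equalityI subsetI)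
      fix p assume "p \<in> J"
      moreover from this have "p = (0, 1) \<or> (\<exists>q\<in>tree_index. p = left_index q) \<or> (\<exists>q\<in>tree_index. p = right_index q)"
        using J(2) tree_index_eq by blast
      ultimately show "p \<in> (J \<inter> {(0, 1)}) \<union> left_index ` L \<union> right_index ` R"
        by (auto simp: L_def R_def)
    qed (auto simp: L_def R_def)
    have disj: "J \<inter> {(0, 1)} \<inter> left_index ` L = {}"
      "(J \<inter> {(0, 1)} \<union> left_index ` L) \<inter> right_index ` R = {}"
      using left_index_not_right by (auto simp: L_def R_def left_index_def right_index_def)
    have "(\<Prod>p\<in>J. g p) = (\<Prod>p\<in>J \<inter> {(0, 1)}. g p) * (\<Prod>p\<in>left_index ` L. g p) * (\<Prod>p\<in>right_index ` R. g p)"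
      using fin J(1) disj by (subst J_eq, subst prod.union_disjoint, simp, simp, simp)
        (subst prod.union_disjoint, auto)
    also have "(\<Prod>p\<in>J \<inter> {(0, 1)}. g p) = emeasure unif01 A"
      using unif01.emeasure_space_1 by (auto simp: A_def g_def)
    also have "(\<Prod>p\<in>left_index ` L. g p) = emeasure tree_space SL"
      using fin(1) F unfolding SL_def
      by (subst emeasure_PiM_Collect)
        (auto simp: L_def g_def prod.reindex inj_on_subset[OF inj_left_index])
    also have "(\<Prod>p\<in>right_index ` R. g p) = emeasure tree_space SR"
      using fin(2) F unfolding SR_def
      by (subst emeasure_PiM_Collect)
        (auto simp: R_def g_def prod.reindex inj_on_subset[OF inj_right_index])
    finally have prod_eq: "(\<Prod>p\<in>J. g p) = emeasure unif01 A * emeasure tree_space SL * emeasure tree_space SR" .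
    have [measurable]: "A \<in> sets unif01" using F by (auto simp: A_def)
    have [measurable]: "SL \<in> sets tree_space" "SR \<in> sets tree_space"
    proof -
      have *: "{a\<in>space tree_space. \<forall>p\<in>K. a p \<in> F (f p)} \<in> sets tree_space"
        if "finite K" "\<And>p. p \<in> K \<Longrightarrow> f p \<in> J" for K f
      proof (rule sets.sets_Collect_finite_All)
        fix p assume "p \<in> K"
        then have "F (f p) \<in> sets borel" using F that by auto
        then show "{a \<in> space tree_space. a p \<in> F (f p)} \<in> sets tree_space"
          using measurable_sets[OF measurable_unif01_component, of "F (f p)" p tree_index]
          by (simp add: vimage_def Int_def conj_commute)
      qed (rule that)
      show "SL \<in> sets tree_space" "SR \<in> sets tree_space"
        unfolding SL_def SR_def by (rule *; use fin in \<open>auto simp: L_def R_def\<close>)+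
    qed
    have "emeasure (distr (unif01 \<Otimes>\<^sub>M (tree_space \<Otimes>\<^sub>M tree_space)) tree_space (\<lambda>(U, a, b). glue U a b))
        (prod_emb tree_index (\<lambda>_. unif01) J (Pi\<^sub>E J F)) =
      emeasure (unif01 \<Otimes>\<^sub>M (tree_space \<Otimes>\<^sub>M tree_space)) (A \<times> (SL \<times> SR))"
    proof (subst emeasure_distr)
      show "prod_emb tree_index (\<lambda>_. unif01) J (Pi\<^sub>E J F) \<in> sets tree_space"
        using J F by (intro sets_PiM_I) auto
      have *: "glue U a b \<in> prod_emb tree_index (\<lambda>_. unif01) J (Pi\<^sub>E J F) \<longleftrightarrow>
          U \<in> A \<and> (\<forall>p\<in>L. a p \<in> F (left_index p)) \<and> (\<forall>p\<in>R. b p \<in> F (right_index p))" for U a b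
      proof -
        have "glue U a b \<in> prod_emb tree_index (\<lambda>_. unif01) J (Pi\<^sub>E J F) \<longleftrightarrow> (\<forall>p\<in>J. glue U a b p \<in> F p)"
          using J(2) by (auto simp: prod_emb_def space_PiM PiE_iff glue_def extensional_def)
        also have "\<dots> \<longleftrightarrow> (\<forall>p\<in>J \<inter> {(0, 1)}. glue U a b p \<in> F p) \<and>
            (\<forall>p\<in>L. glue U a b (left_index p) \<in> F (left_index p)) \<and>
            (\<forall>p\<in>R. glue U a b (right_index p) \<in> F (right_index p))"
          by (subst J_eq) blast
        also have "\<dots> \<longleftrightarrow> U \<in> A \<and> (\<forall>p\<in>L. a p \<in> F (left_index p)) \<and> (\<forall>p\<in>R. b p \<in> F (right_index p))"
          using glue_root by (auto simp: A_def L_def R_def glue_left_index glue_right_index)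
        finally show ?thesis .
      qed
      show "emeasure (unif01 \<Otimes>\<^sub>M (tree_space \<Otimes>\<^sub>M tree_space))
          ((\<lambda>(U, a, b). glue U a b) -` prod_emb tree_index (\<lambda>_. unif01) J (Pi\<^sub>E J F) \<inter>
            space (unif01 \<Otimes>\<^sub>M (tree_space \<Otimes>\<^sub>M tree_space))) =
        emeasure (unif01 \<Otimes>\<^sub>M (tree_space \<Otimes>\<^sub>M tree_space)) (A \<times> (SL \<times> SR))"
        by (rule arg_cong[where f="emeasure _"])
          (auto simp: space_pair_measure SL_def SR_def * simp del: space_PiM)
    qed measurable
    also have "\<dots> = emeasure unif01 A * (emeasure tree_space SL * emeasure tree_space SR)"
      by (subst TT.emeasure_pair_measure_Times, measurable)
        (subst tree.emeasure_pair_measure_Times, auto)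
    finally show "emeasure (distr (unif01 \<Otimes>\<^sub>M (tree_space \<Otimes>\<^sub>M tree_space)) tree_space (\<lambda>(U, a, b). glue U a b))
        (prod_emb tree_index (\<lambda>_. unif01) J (Pi\<^sub>E J F)) = (\<Prod>p\<in>J. emeasure unif01 (F p))"
      using prod_eq by (simp add: g_def mult.assoc)
  qed simp
qed

section \<open>Sums over Poisson many uniform marks\<close>

lemma poisson_pgf:
  fixes z :: complex
  assumes "0 < l"
  shows "(\<integral>n. z ^ n \<partial>measure_pmf (poisson_pmf l)) = exp (of_real l * (z - 1))"
proof -
  have pm: "pmf (poisson_pmf l) n *\<^sub>R z ^ n = exp (- of_real l) * ((of_real l * z) ^ n /\<^sub>R fact n)" for n
    using assms by (simp add: power_mult_distrib scaleR_conv_of_real exp_of_real[symmetric] field_simps)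
  have sm: "(\<lambda>n. pmf (poisson_pmf l) n *\<^sub>R z ^ n) sums (exp (- of_real l) * exp (of_real l * z))"
    unfolding pm by (intro sums_mult exp_converges)
  have "summable (\<lambda>n. norm ((of_real l * z) ^ n /\<^sub>R fact n))"
    by (rule summable_norm_exp)
  then have "summable (\<lambda>n. norm (pmf (poisson_pmf l) n *\<^sub>R z ^ n))"
    unfolding pm norm_mult by (rule summable_mult)
  then have "integrable (count_space UNIV) (\<lambda>n. pmf (poisson_pmf l) n *\<^sub>R z ^ n)"
    by (simp add: integrable_count_space_nat_iff)
  then have "(\<integral>n. z ^ n \<partial>measure_pmf (poisson_pmf l)) = (\<Sum>n. pmf (poisson_pmf l) n *\<^sub>R z ^ n)"
    unfolding measure_pmf_eq_density by (subst integral_density) (auto simp: integral_count_space_nat)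
  also have "\<dots> = exp (of_real l * (z - 1))"
    using sums_unique[OF sm] by (simp add: exp_add[symmetric] algebra_simps)
  finally show ?thesis .
qed

lemma poisson_mean:
  assumes "0 < l"
  shows "(\<integral>\<^sup>+n. ennreal (real n) \<partial>measure_pmf (poisson_pmf l)) = ennreal l"
proof -
  have pm: "pmf (poisson_pmf l) n = exp (- l) * (l ^ n /\<^sub>R fact n)" for n
    using assms by (simp add: field_simps)
  have "(\<lambda>n. pmf (poisson_pmf l) n) sums (exp (- l) * exp l)"
    unfolding pm by (intro sums_mult exp_converges)
  then have "(\<lambda>n. l * pmf (poisson_pmf l) n) sums (l * 1)"
    by (intro sums_mult) (simp add: exp_add[symmetric])
  \<comment> \<open>The weights satisfy a shift identity, which turns the mean into the total mass.\<close>
  moreover have "real (Suc n) * pmf (poisson_pmf l) (Suc n) = l * pmf (poisson_pmf l) n" for n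
    using assms by (simp add: fact_Suc divide_simps del: of_nat_Suc)
  ultimately have "(\<lambda>n. real (Suc n) * pmf (poisson_pmf l) (Suc n)) sums l" by simp
  then have sm: "(\<lambda>n. real n * pmf (poisson_pmf l) n) sums l"
    by (subst (asm) sums_Suc_iff) simp
  have "(\<integral>\<^sup>+n. ennreal (real n) \<partial>measure_pmf (poisson_pmf l)) = (\<Sum>n. ennreal (real n * pmf (poisson_pmf l) n))"
    unfolding measure_pmf_eq_density
    by (subst nn_integral_density) (auto simp: nn_integral_count_space_nat ennreal_mult'' mult.commute intro!: suminf_cong)
  also have "\<dots> = ennreal l"
    using sums_unique[OF sm] sums_summable[OF sm] by (subst suminf_ennreal2) auto
  finally show ?thesis .
qed

abbreviation poisson_counts :: "real \<Rightarrow> (nat \<Rightarrow> nat) measure" where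
  "poisson_counts l \<equiv> \<Pi>\<^sub>M k\<in>{1..}. measure_pmf (poisson_pmf l)"

abbreviation mark_space :: "(nat \<times> nat \<Rightarrow> real) measure" where
  "mark_space \<equiv> \<Pi>\<^sub>M p\<in>{1..} \<times> {1..}. unif01"

interpretation marks: prob_space mark_space
  by (intro prob_space_PiM prob_space_unif01)

interpretation counts: prob_space "poisson_counts l" for l
  by (intro prob_space_PiM prob_space_measure_pmf)

lemma measurable_count:
  "(\<lambda>n. n k) \<in> PiM I (\<lambda>_. measure_pmf (poisson_pmf l)) \<rightarrow>\<^sub>M count_space UNIV"
  using measurable_PiM_any_component[of "measure_pmf (poisson_pmf l)" k I]
  unfolding measurable_cong_sets[OF refl sets_measure_pmf_count_space] by simp

lemma measurable_prod_upto_count [measurable (raw)]: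
  fixes f :: "nat \<Rightarrow> 'a \<Rightarrow> 'b :: {real_normed_field, second_countable_topology}"
  assumes [measurable]: "m \<in> M \<rightarrow>\<^sub>M count_space UNIV" "\<And>i. f i \<in> borel_measurable M"
  shows "(\<lambda>w. \<Prod>i=1..m w. f i w) \<in> borel_measurable M"
  by (rule measurable_compose_countable[where f="\<lambda>m w. \<Prod>i=1..m. f i w", OF _ assms(1)]) measurable

lemma measurable_sum_upto_count [measurable (raw)]:
  fixes f :: "nat \<Rightarrow> 'a \<Rightarrow> 'b :: {second_countable_topology, topological_comm_monoid_add}"
  assumes [measurable]: "m \<in> M \<rightarrow>\<^sub>M count_space UNIV" "\<And>i. f i \<in> borel_measurable M"
  shows "(\<lambda>w. \<Sum>i=1..m w. f i w) \<in> borel_measurable M"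
  by (rule measurable_compose_countable[where f="\<lambda>m w. \<Sum>i=1..m. f i w", OF _ assms(1)]) measurable

lemma norm_prod_le_1:
  fixes f :: "'i \<Rightarrow> 'a :: {real_normed_field}"
  assumes "\<And>i. i \<in> A \<Longrightarrow> norm (f i) \<le> 1"
  shows "norm (\<Prod>i\<in>A. f i) \<le> 1"
  by (rule order_trans[OF norm_prod_le prod_le_1]) (use assms in auto)

lemma norm_integral_le_1:
  fixes f :: "'a \<Rightarrow> 'b :: {banach, second_countable_topology}"
  assumes "prob_space M" "\<And>x. norm (f x) \<le> 1"
  shows "norm (\<integral>x. f x \<partial>M) \<le> 1"
proof (cases "integrable M f")
  case True
  interpret prob_space M by fact
  have "norm (\<integral>x. f x \<partial>M) \<le> (\<integral>x. norm (f x) \<partial>M)" by (rule integral_norm_bound)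
  also have "\<dots> \<le> (\<integral>x. 1 \<partial>M)" using True assms(2) by (intro integral_mono) auto
  finally show ?thesis by (simp add: prob_space)
qed (simp add: not_integrable_integral_eq)

text \<open>The characteristic functional of a marked Poisson process, restricted to the levels \<open>1, \<dots>, K\<close>. Given the
counts, independence of the marks yields the powers \<open>(\<integral> h k) ^ n k\<close>; the generating function of the Poisson
law then applies to each level.\<close>

lemma poisson_pgf_marks:
  fixes h :: "nat \<Rightarrow> real \<Rightarrow> complex"
  assumes l: "0 < l" and [measurable]: "\<And>k. h k \<in> borel_measurable borel"
    and h: "\<And>k x. norm (h k x) \<le> 1"
  shows "(\<integral>(n, v). (\<Prod>k=1..K. \<Prod>i=1..n k. h k (v (k, i))) \<partial>(poisson_counts l \<Otimes>\<^sub>M mark_space)) =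
    exp (of_real l * (\<Sum>k=1..K. (\<integral>x. h k x \<partial>unif01) - 1))"
proof -
  interpret pair_prob_space "poisson_counts l" mark_space ..
  note [measurable] = measurable_unif01_component measurable_count
  have int_h: "integrable unif01 (h k)" for k
    by (rule unif01.integrable_const_bound[where B=1]) (use assms(2) in \<open>simp_all add: h\<close>)
  have "(\<integral>(n, v). (\<Prod>k=1..K. \<Prod>i=1..n k. h k (v (k, i))) \<partial>(poisson_counts l \<Otimes>\<^sub>M mark_space)) =
      (\<integral>n. (\<integral>v. (\<Prod>k=1..K. \<Prod>i=1..n k. h k (v (k, i))) \<partial>mark_space) \<partial>poisson_counts l)"
  proof (rule integral_fst[symmetric])
    show "integrable (poisson_counts l \<Otimes>\<^sub>M mark_space)
        (\<lambda>(n, v). \<Prod>k=1..K. \<Prod>i=1..n k. h k (v (k, i)))"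
    proof (rule P.integrable_const_bound[where B=1])
      show "AE x in poisson_counts l \<Otimes>\<^sub>M mark_space.
          cmod (case x of (n, v) \<Rightarrow> \<Prod>k=1..K. \<Prod>i=1..n k. h k (v (k, i))) \<le> 1"
        by (auto intro!: AE_I2 norm_prod_le_1 h)
    qed measurable
  qed
  also have "\<dots> = (\<integral>n. (\<Prod>k=1..K. (\<integral>x. h k x \<partial>unif01) ^ n k) \<partial>poisson_counts l)"
  proof (rule Bochner_Integration.integral_cong[OF refl])
    fix n :: "nat \<Rightarrow> nat"
    have "(\<integral>v. (\<Prod>k=1..K. \<Prod>i=1..n k. h k (v (k, i))) \<partial>mark_space) =
        (\<integral>v. (\<Prod>p\<in>(SIGMA k:{1..K}. {1..n k}). h (fst p) (v p)) \<partial>mark_space)"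
      by (simp add: prod.Sigma split_beta)
    also have "\<dots> = (\<Prod>p\<in>(SIGMA k:{1..K}. {1..n k}). \<integral>x. h (fst p) x \<partial>unif01)"
      by (rule PiM_integral_prod_components) (auto simp: int_h prob_space_unif01)
    also have "\<dots> = (\<Prod>k=1..K. (\<integral>x. h k x \<partial>unif01) ^ n k)"
    proof -
      have "(\<Prod>k=1..K. (\<integral>x. h k x \<partial>unif01) ^ n k) = (\<Prod>k=1..K. \<Prod>i=1..n k. \<integral>x. h k x \<partial>unif01)"
        by simp
      also have "\<dots> = (\<Prod>p\<in>(SIGMA k:{1..K}. {1..n k}). \<integral>x. h (fst p) x \<partial>unif01)"
        by (subst prod.Sigma) (auto simp: split_beta)
      finally show ?thesis by simp
    qed
    finally show "(\<integral>v. (\<Prod>k=1..K. \<Prod>i=1..n k. h k (v (k, i))) \<partial>mark_space) =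
        (\<Prod>k=1..K. (\<integral>x. h k x \<partial>unif01) ^ n k)" .
  qed
  also have "\<dots> = (\<Prod>k=1..K. (\<integral>m. (\<integral>x. h k x \<partial>unif01) ^ m \<partial>measure_pmf (poisson_pmf l)))"
  proof (rule PiM_integral_prod_components)
    show "integrable (measure_pmf (poisson_pmf l)) (\<lambda>m. (\<integral>x. h k x \<partial>unif01) ^ m)" for k
      using norm_integral_le_1[OF prob_space_unif01, of "h k"] h
      by (intro measure_pmf.integrable_const_bound[where B=1]) (auto simp: norm_power power_le_one)
  qed (auto simp: prob_space_measure_pmf)
  also have "\<dots> = (\<Prod>k=1..K. exp (of_real l * ((\<integral>x. h k x \<partial>unif01) - 1)))"
    by (intro prod.cong refl poisson_pgf l)
  also have "\<dots> = exp (of_real l * (\<Sum>k=1..K. (\<integral>x. h k x \<partial>unif01) - 1))"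
    by (simp add: exp_sum sum_distrib_left)
  finally show ?thesis .
qed

lemma poisson_pgf_single_mark:
  fixes h :: "real \<Rightarrow> complex"
  assumes l: "0 < l" and [measurable]: "h \<in> borel_measurable borel"
    and h: "\<And>x. norm (h x) \<le> 1"
  shows "(\<integral>(n, v). (\<Prod>i=1..n. h (v i)) \<partial>(measure_pmf (poisson_pmf l) \<Otimes>\<^sub>M (\<Pi>\<^sub>M i\<in>{1..}. unif01))) =
    exp (of_real l * ((\<integral>x. h x \<partial>unif01) - 1))"
proof -
  interpret V: prob_space "\<Pi>\<^sub>M i\<in>{1::nat..}. unif01"
    by (intro prob_space_PiM prob_space_unif01)
  interpret pair_prob_space "measure_pmf (poisson_pmf l)" "\<Pi>\<^sub>M i\<in>{1::nat..}. unif01" ..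
  note [measurable] = measurable_unif01_component
  have int_h: "integrable unif01 h"
    by (rule unif01.integrable_const_bound[where B=1]) (use assms(2) in \<open>simp_all add: h\<close>)
  have [measurable]: "(\<lambda>x. fst x) \<in> measure_pmf (poisson_pmf l) \<Otimes>\<^sub>M (\<Pi>\<^sub>M i\<in>{1::nat..}. unif01)
      \<rightarrow>\<^sub>M count_space UNIV"
    using measurable_fst[of "measure_pmf (poisson_pmf l)" "\<Pi>\<^sub>M i\<in>{1::nat..}. unif01"]
    unfolding measurable_cong_sets[OF refl sets_measure_pmf_count_space] .
  have "(\<integral>(n, v). (\<Prod>i=1..n. h (v i)) \<partial>(measure_pmf (poisson_pmf l) \<Otimes>\<^sub>M (\<Pi>\<^sub>M i\<in>{1..}. unif01))) =
      (\<integral>n. (\<integral>v. (\<Prod>i=1..n. h (v i)) \<partial>(\<Pi>\<^sub>M i\<in>{1::nat..}. unif01)) \<partial>measure_pmf (poisson_pmf l))"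
  proof (rule integral_fst[symmetric])
    show "integrable (measure_pmf (poisson_pmf l) \<Otimes>\<^sub>M (\<Pi>\<^sub>M i\<in>{1..}. unif01))
        (\<lambda>(n, v). \<Prod>i=1..n. h (v i))"
    proof (rule P.integrable_const_bound[where B=1])
      show "AE x in measure_pmf (poisson_pmf l) \<Otimes>\<^sub>M (\<Pi>\<^sub>M i\<in>{1..}. unif01).
          cmod (case x of (n, v) \<Rightarrow> \<Prod>i=1..n. h (v i)) \<le> 1"
        by (auto intro!: AE_I2 norm_prod_le_1 h)
      show "(\<lambda>(n, v). \<Prod>i=1..n. h (v i)) \<in>
          borel_measurable (measure_pmf (poisson_pmf l) \<Otimes>\<^sub>M (\<Pi>\<^sub>M i\<in>{1..}. unif01))"
        unfolding split_beta by (intro measurable_prod_upto_count) measurable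
    qed
  qed
  also have "\<dots> = (\<integral>n. (\<integral>x. h x \<partial>unif01) ^ n \<partial>measure_pmf (poisson_pmf l))"
  proof (rule Bochner_Integration.integral_cong[OF refl])
    fix n :: nat
    have "(\<integral>v. (\<Prod>i=1..n. h (v i)) \<partial>(\<Pi>\<^sub>M i\<in>{1::nat..}. unif01)) = (\<Prod>i=1..n. \<integral>x. h x \<partial>unif01)"
      by (rule PiM_integral_prod_components) (auto simp: int_h prob_space_unif01)
    then show "(\<integral>v. (\<Prod>i=1..n. h (v i)) \<partial>(\<Pi>\<^sub>M i\<in>{1::nat..}. unif01)) = (\<integral>x. h x \<partial>unif01) ^ n"
      by simp
  qed
  finally show ?thesis by (simp add: poisson_pgf l)
qed

text \<open>Campbell's formula for one level.\<close>

lemma poisson_marks_mean: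
  assumes l: "0 < l" and [measurable]: "h \<in> borel_measurable borel" and k: "1 \<le> k"
  shows "(\<integral>\<^sup>+(n, v). (\<Sum>i=1..n k. h (v (k, i))) \<partial>(poisson_counts l \<Otimes>\<^sub>M mark_space)) =
    ennreal l * (\<integral>\<^sup>+x. h x \<partial>unif01)"
proof -
  note [measurable] = measurable_unif01_component measurable_count
  have "(\<integral>\<^sup>+(n, v). (\<Sum>i=1..n k. h (v (k, i))) \<partial>(poisson_counts l \<Otimes>\<^sub>M mark_space)) =
      (\<integral>\<^sup>+n. (\<integral>\<^sup>+v. (\<Sum>i=1..n k. h (v (k, i))) \<partial>mark_space) \<partial>poisson_counts l)"
    by (subst marks.nn_integral_fst[symmetric]) auto
  also have "\<dots> = (\<integral>\<^sup>+n. ennreal (real (n k)) * (\<integral>\<^sup>+x. h x \<partial>unif01) \<partial>poisson_counts l)"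
  proof (rule nn_integral_cong)
    fix n :: "nat \<Rightarrow> nat"
    have "(\<integral>\<^sup>+v. h (v (k, i)) \<partial>mark_space) = (\<integral>\<^sup>+x. h x \<partial>unif01)" if "1 \<le> i" for i
    proof -
      have "distr mark_space unif01 (\<lambda>v. v (k, i)) = unif01"
        using that k by (intro distr_PiM_component prob_space_unif01) auto
      then have "(\<integral>\<^sup>+x. h x \<partial>unif01) = (\<integral>\<^sup>+x. h x \<partial>distr mark_space unif01 (\<lambda>v. v (k, i)))" by simp
      also have "\<dots> = (\<integral>\<^sup>+v. h (v (k, i)) \<partial>mark_space)"
        using that k by (intro nn_integral_distr measurable_component_singleton) auto
      finally show ?thesis by simp
    qed
    then show "(\<integral>\<^sup>+v. (\<Sum>i=1..n k. h (v (k, i))) \<partial>mark_space) =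
        ennreal (real (n k)) * (\<integral>\<^sup>+x. h x \<partial>unif01)"
      by (subst nn_integral_sum) (auto simp: ennreal_of_nat_eq_real_of_nat)
  qed
  also have "\<dots> = (\<integral>\<^sup>+n. ennreal (real (n k)) \<partial>poisson_counts l) * (\<integral>\<^sup>+x. h x \<partial>unif01)"
    by (intro nn_integral_multc measurable_compose[OF measurable_count]) simp
  also have "(\<integral>\<^sup>+n. ennreal (real (n k)) \<partial>poisson_counts l) =
      (\<integral>\<^sup>+m. ennreal (real m) \<partial>distr (poisson_counts l) (measure_pmf (poisson_pmf l)) (\<lambda>n. n k))"
    using k by (intro nn_integral_distr[symmetric] measurable_component_singleton) auto
  also have "distr (poisson_counts l) (measure_pmf (poisson_pmf l)) (\<lambda>n. n k) = measure_pmf (poisson_pmf l)"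
    using k by (intro distr_PiM_component prob_space_measure_pmf) auto
  finally show ?thesis by (simp add: poisson_mean l)
qed

section \<open>Conditioning on the tree\<close>

text \<open>Integration over a sample starts with the counts and the marks; conditioning on the splitting variables means
integrating over them last. Both orders give the same measure by Fubini's theorem.\<close>

lemma pair_measure_rotate:
  assumes "sigma_finite_measure M" "sigma_finite_measure N" "sigma_finite_measure L"
  shows "M \<Otimes>\<^sub>M (N \<Otimes>\<^sub>M L) =
    distr (L \<Otimes>\<^sub>M (M \<Otimes>\<^sub>M N)) (M \<Otimes>\<^sub>M (N \<Otimes>\<^sub>M L)) (\<lambda>(z, x, y). (x, y, z))" (is "?A = ?B")
proof (rule measure_eqI)
  interpret M: sigma_finite_measure M by fact
  interpret N: sigma_finite_measure N by fact
  interpret L: sigma_finite_measure L by fact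
  interpret NL: pair_sigma_finite N L ..
  interpret MN: pair_sigma_finite M N ..
  interpret MxL: pair_sigma_finite M L ..
  interpret M_NL: pair_sigma_finite M "N \<Otimes>\<^sub>M L" ..
  interpret L_MN: pair_sigma_finite L "M \<Otimes>\<^sub>M N" ..
  fix A assume [measurable]: "A \<in> sets ?A"
  have "emeasure ?A A = (\<integral>\<^sup>+w. indicator A w \<partial>?A)" by simp
  also have "\<dots> = (\<integral>\<^sup>+x. (\<integral>\<^sup>+w. indicator A (x, w) \<partial>(N \<Otimes>\<^sub>M L)) \<partial>M)"
    by (rule NL.P.nn_integral_fst[symmetric]) simp
  also have "\<dots> = (\<integral>\<^sup>+x. (\<integral>\<^sup>+z. (\<integral>\<^sup>+y. indicator A (x, y, z) \<partial>N) \<partial>L) \<partial>M)"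
  proof (rule nn_integral_cong)
    fix x assume [measurable]: "x \<in> space M"
    show "(\<integral>\<^sup>+w. indicator A (x, w) \<partial>(N \<Otimes>\<^sub>M L)) = (\<integral>\<^sup>+z. (\<integral>\<^sup>+y. indicator A (x, y, z) \<partial>N) \<partial>L)"
      by (subst NL.nn_integral_snd[symmetric]) auto
  qed
  also have "\<dots> = (\<integral>\<^sup>+z. (\<integral>\<^sup>+x. (\<integral>\<^sup>+y. indicator A (x, y, z) \<partial>N) \<partial>M) \<partial>L)"
    by (rule MxL.Fubini'[symmetric]) measurable
  also have "\<dots> = (\<integral>\<^sup>+z. (\<integral>\<^sup>+w. indicator A (fst w, snd w, z) \<partial>(M \<Otimes>\<^sub>M N)) \<partial>L)"
  proof (rule nn_integral_cong)
    fix z assume [measurable]: "z \<in> space L"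
    show "(\<integral>\<^sup>+x. (\<integral>\<^sup>+y. indicator A (x, y, z) \<partial>N) \<partial>M) =
        (\<integral>\<^sup>+w. indicator A (fst w, snd w, z) \<partial>(M \<Otimes>\<^sub>M N))"
      by (subst N.nn_integral_fst[symmetric]) auto
  qed
  also have "\<dots> = (\<integral>\<^sup>+w. indicator A (fst (snd w), snd (snd w), fst w) \<partial>(L \<Otimes>\<^sub>M (M \<Otimes>\<^sub>M N)))"
    by (subst MN.P.nn_integral_fst[symmetric]) auto
  also have "\<dots> = (\<integral>\<^sup>+w. indicator A w \<partial>?B)"
    by (subst nn_integral_distr) (auto simp: split_beta)
  also have "\<dots> = emeasure ?B A" by simp
  finally show "emeasure ?A A = emeasure ?B A" .
qed simp

text \<open>Index sets start at \<open>1\<close>; this keeps the simplifier from rewriting them to \<open>{Suc 0..}\<close>.\<close>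

declare One_nat_def [simp del]

lemma prob_space_sample: "prob_space (sample_space l)"
  unfolding sample_space_def
  by (intro prob_space_pair counts.prob_space_axioms marks.prob_space_axioms tree.prob_space_axioms)

interpretation sample: prob_space "sample_space l" for l
  by (rule prob_space_sample)

lemma sample_space_eq_distr:
  "sample_space l = distr (tree_space \<Otimes>\<^sub>M (poisson_counts l \<Otimes>\<^sub>M mark_space)) (sample_space l)
     (\<lambda>(u, n, v). (n, v, u))"
  unfolding sample_space_def
  by (rule pair_measure_rotate)
    (auto intro: prob_space_imp_sigma_finite counts.prob_space_axioms marks.prob_space_axioms tree.prob_space_axioms)

lemma measurable_sample_rotate [measurable]:
  "(\<lambda>(u, n, v). (n, v, u)) \<in> tree_space \<Otimes>\<^sub>M (poisson_counts l \<Otimes>\<^sub>M mark_space) \<rightarrow>\<^sub>M sample_space l"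
  unfolding sample_space_def by measurable

interpretation counts_marks: pair_prob_space "poisson_counts l" mark_space for l ..

interpretation tree_cm: pair_prob_space tree_space "poisson_counts l \<Otimes>\<^sub>M mark_space" for l
  by unfold_locales

lemma nn_integral_sample:
  assumes [measurable]: "f \<in> borel_measurable (sample_space l)"
  shows "(\<integral>\<^sup>+w. f w \<partial>sample_space l) =
    (\<integral>\<^sup>+u. (\<integral>\<^sup>+(n, v). f (n, v, u) \<partial>(poisson_counts l \<Otimes>\<^sub>M mark_space)) \<partial>tree_space)"
proof -
  have [measurable]: "(\<lambda>q. f (fst (snd q), snd (snd q), fst q)) \<in>
      borel_measurable (tree_space \<Otimes>\<^sub>M (poisson_counts l \<Otimes>\<^sub>M mark_space))"
    using measurable_compose[OF measurable_sample_rotate assms(1)] by (simp add: case_prod_unfold)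
  have "(\<integral>\<^sup>+w. f w \<partial>sample_space l) =
      (\<integral>\<^sup>+q. f (case q of (u, n, v) \<Rightarrow> (n, v, u)) \<partial>(tree_space \<Otimes>\<^sub>M (poisson_counts l \<Otimes>\<^sub>M mark_space)))"
    by (subst sample_space_eq_distr, subst nn_integral_distr) (auto simp: sample_space_eq_distr[symmetric])
  also have "\<dots> = (\<integral>\<^sup>+u. (\<integral>\<^sup>+(n, v). f (n, v, u) \<partial>(poisson_counts l \<Otimes>\<^sub>M mark_space)) \<partial>tree_space)"
    by (subst counts_marks.P.nn_integral_fst[symmetric]) (auto simp: case_prod_unfold)
  finally show ?thesis .
qed

lemma integral_sample:
  fixes f :: "sample \<Rightarrow> complex"
  assumes [measurable]: "f \<in> borel_measurable (sample_space l)" and bdd: "\<And>w. norm (f w) \<le> 1"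
  shows "(\<integral>w. f w \<partial>sample_space l) =
    (\<integral>u. (\<integral>(n, v). f (n, v, u) \<partial>(poisson_counts l \<Otimes>\<^sub>M mark_space)) \<partial>tree_space)"
proof -
  have [measurable]: "(\<lambda>q. f (fst (snd q), snd (snd q), fst q)) \<in>
      borel_measurable (tree_space \<Otimes>\<^sub>M (poisson_counts l \<Otimes>\<^sub>M mark_space))"
    using measurable_compose[OF measurable_sample_rotate assms(1)] by (simp add: case_prod_unfold)
  have "(\<integral>w. f w \<partial>sample_space l) =
      (\<integral>q. f (case q of (u, n, v) \<Rightarrow> (n, v, u)) \<partial>(tree_space \<Otimes>\<^sub>M (poisson_counts l \<Otimes>\<^sub>M mark_space)))"
    by (subst sample_space_eq_distr, subst integral_distr) (auto simp: sample_space_eq_distr[symmetric])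
  also have "\<dots> = (\<integral>u. (\<integral>(n, v). f (n, v, u) \<partial>(poisson_counts l \<Otimes>\<^sub>M mark_space)) \<partial>tree_space)"
    by (subst tree_cm.integral_fst'[symmetric])
      (auto simp: case_prod_unfold bdd intro!: tree_cm.P.integrable_const_bound[where B=1])
  finally show ?thesis .
qed

interpretation tree_tree: pair_prob_space tree_space tree_space ..

interpretation unif01_tree_tree: pair_prob_space unif01 "tree_space \<Otimes>\<^sub>M tree_space"
  by unfold_locales

text \<open>Conditioning on the root: the form in which \<open>distr_glue\<close> is used.\<close>

lemma nn_integral_tree_split:
  assumes [measurable]: "f \<in> borel_measurable tree_space"
  shows "(\<integral>\<^sup>+u. f u \<partial>tree_space) =
    (\<integral>\<^sup>+U. (\<integral>\<^sup>+a. (\<integral>\<^sup>+b. f (glue U a b) \<partial>tree_space) \<partial>tree_space) \<partial>unif01)"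
proof -
  have [measurable]: "(\<lambda>(U, a, b). glue U a b) \<in> unif01 \<Otimes>\<^sub>M (tree_space \<Otimes>\<^sub>M tree_space) \<rightarrow>\<^sub>M tree_space"
    by measurable
  have "(\<integral>\<^sup>+u. f u \<partial>tree_space) =
      (\<integral>\<^sup>+q. f (case q of (U, a, b) \<Rightarrow> glue U a b) \<partial>(unif01 \<Otimes>\<^sub>M (tree_space \<Otimes>\<^sub>M tree_space)))"
    by (subst distr_glue[symmetric], subst nn_integral_distr) auto
  also have "\<dots> = (\<integral>\<^sup>+U. (\<integral>\<^sup>+q. f (glue U (fst q) (snd q)) \<partial>(tree_space \<Otimes>\<^sub>M tree_space)) \<partial>unif01)"
    by (subst tree_tree.P.nn_integral_fst[symmetric]) (auto simp: split_beta)
  also have "\<dots> = (\<integral>\<^sup>+U. (\<integral>\<^sup>+a. (\<integral>\<^sup>+b. f (glue U a b) \<partial>tree_space) \<partial>tree_space) \<partial>unif01)"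
    by (intro nn_integral_cong) (subst tree.nn_integral_fst[symmetric], auto)
  finally show ?thesis .
qed

lemma integral_tree_split:
  fixes f :: "(nat \<times> nat \<Rightarrow> real) \<Rightarrow> complex"
  assumes [measurable]: "f \<in> borel_measurable tree_space" and bdd: "\<And>u. norm (f u) \<le> 1"
  shows "(\<integral>u. f u \<partial>tree_space) =
    (\<integral>U. (\<integral>a. (\<integral>b. f (glue U a b) \<partial>tree_space) \<partial>tree_space) \<partial>unif01)"
proof -
  have [measurable]: "(\<lambda>(U, a, b). glue U a b) \<in> unif01 \<Otimes>\<^sub>M (tree_space \<Otimes>\<^sub>M tree_space) \<rightarrow>\<^sub>M tree_space"
    by measurable
  have "(\<integral>u. f u \<partial>tree_space) =
      (\<integral>q. f (case q of (U, a, b) \<Rightarrow> glue U a b) \<partial>(unif01 \<Otimes>\<^sub>M (tree_space \<Otimes>\<^sub>M tree_space)))"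
    by (subst distr_glue[symmetric], subst integral_distr) auto
  also have "\<dots> = (\<integral>U. (\<integral>q. f (glue U (fst q) (snd q)) \<partial>(tree_space \<Otimes>\<^sub>M tree_space)) \<partial>unif01)"
    by (subst unif01_tree_tree.integral_fst'[symmetric])
      (auto simp: split_beta bdd intro!: unif01_tree_tree.P.integrable_const_bound[where B=1])
  also have "\<dots> = (\<integral>U. (\<integral>a. (\<integral>b. f (glue U a b) \<partial>tree_space) \<partial>tree_space) \<partial>unif01)"
    by (intro Bochner_Integration.integral_cong refl, subst tree_tree.integral_fst'[symmetric])
      (auto simp: bdd intro!: tree_tree.P.integrable_const_bound[where B=1])
  finally show ?thesis .
qed

section \<open>The mean gap of a level\<close>

definition gap_mean :: "nat \<Rightarrow> ennreal" where
  "gap_mean k = (\<integral>\<^sup>+u. (\<integral>\<^sup>+x. ennreal (gap k u x) \<partial>unif01) \<partial>tree_space)"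

lemma nn_integral_gap_glue:
  assumes U: "0 < U" "U < 1" and ab: "unit_valued a" "unit_valued b"
    and [measurable]: "a \<in> space tree_space" "b \<in> space tree_space"
  shows "(\<integral>\<^sup>+x. ennreal (gap (Suc (Suc k)) (glue U a b) x) \<partial>unif01) =
    ennreal (U\<^sup>2) * (\<integral>\<^sup>+x. ennreal (gap (Suc k) a x) \<partial>unif01) +
    ennreal ((1 - U)\<^sup>2) * (\<integral>\<^sup>+x. ennreal (gap (Suc k) b x) \<partial>unif01)"
proof -
  have [measurable]: "glue U a b \<in> space tree_space"
    by (auto simp: space_PiM glue_def)
  have "(\<integral>\<^sup>+x. ennreal (gap (Suc (Suc k)) (glue U a b) x) \<partial>unif01) =
      ennreal U * (\<integral>\<^sup>+x. ennreal (gap (Suc (Suc k)) (glue U a b) (U * x)) \<partial>unif01) +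
      ennreal (1 - U) * (\<integral>\<^sup>+x. ennreal (gap (Suc (Suc k)) (glue U a b) (U + (1 - U) * x)) \<partial>unif01)"
    by (rule nn_integral_unif01_split[OF U]) measurable
  also have "(\<integral>\<^sup>+x. ennreal (gap (Suc (Suc k)) (glue U a b) (U * x)) \<partial>unif01) =
      (\<integral>\<^sup>+x. ennreal U * ennreal (gap (Suc k) a x) \<partial>unif01)"
    by (rule nn_integral_cong_AE, use AE_unif01 in eventually_elim)
      (use U ab in \<open>auto simp: gap_glue_left ennreal_mult' gap_nonneg\<close>)
  also have "\<dots> = ennreal U * (\<integral>\<^sup>+x. ennreal (gap (Suc k) a x) \<partial>unif01)"
    by (intro nn_integral_cmult measurable_compose[OF _ measurable_ennreal])
      (use measurable_gap_section[OF assms(5)] in simp)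
  also have "(\<integral>\<^sup>+x. ennreal (gap (Suc (Suc k)) (glue U a b) (U + (1 - U) * x)) \<partial>unif01) =
      (\<integral>\<^sup>+x. ennreal (1 - U) * ennreal (gap (Suc k) b x) \<partial>unif01)"
    by (rule nn_integral_cong_AE, use AE_unif01 in eventually_elim)
      (use U ab in \<open>auto simp: gap_glue_right ennreal_mult' gap_nonneg\<close>)
  also have "\<dots> = ennreal (1 - U) * (\<integral>\<^sup>+x. ennreal (gap (Suc k) b x) \<partial>unif01)"
    by (intro nn_integral_cmult measurable_compose[OF _ measurable_ennreal])
      (use measurable_gap_section[OF assms(6)] in simp)
  finally show ?thesis
    using U by (simp add: power2_eq_square ennreal_mult mult.assoc)
qed

text \<open>The first gap is a distance in the unit interval. The exact value \<open>1/3\<close> would lead to \<open>E (X l) = 1\<close>, but any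
finite bound serves the purpose.\<close>

lemma gap_mean_1: "gap_mean 1 \<le> 1"
proof -
  have "gap_mean 1 \<le> (\<integral>\<^sup>+u. (\<integral>\<^sup>+x. 1 \<partial>unif01) \<partial>tree_space)"
    unfolding gap_mean_def
  proof (rule nn_integral_mono_AE, use AE_tree_unit_valued in eventually_elim)
    fix u assume "unit_valued u"
    then have "0 \<le> u (0, 1)" "u (0, 1) \<le> 1" by (auto simp: unit_valued_def tree_index_def)
    then show "(\<integral>\<^sup>+x. ennreal (gap 1 u x) \<partial>unif01) \<le> (\<integral>\<^sup>+x. 1 \<partial>unif01)"
      by (intro nn_integral_mono_AE, use AE_unif01 in eventually_elim)
        (use gap_1[of _ u] in auto)
  qed
  then show ?thesis by (simp add: unif01.emeasure_space_1[simplified] tree.emeasure_space_1)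
qed

lemma nn_integral_unif01_square: "(\<integral>\<^sup>+U. ennreal (U\<^sup>2) \<partial>unif01) = ennreal (1 / 3)"
proof -
  have "(\<integral>\<^sup>+U. ennreal (U\<^sup>2) * indicator {0..1} U \<partial>lborel) = ennreal (1 ^ 3 / 3 - 0 ^ 3 / 3)"
    by (rule nn_integral_FTC_Icc) (auto intro!: derivative_eq_intros)
  then show ?thesis by (subst nn_integral_unif01) auto
qed

lemma nn_integral_unif01_reflect:
  assumes [measurable]: "f \<in> borel_measurable borel"
  shows "(\<integral>\<^sup>+U. f (1 - U) \<partial>unif01) = (\<integral>\<^sup>+U. f U \<partial>unif01)"
proof -
  have "(\<integral>\<^sup>+U. f U \<partial>unif01) = (\<integral>\<^sup>+U. f U * indicator {0..1} U \<partial>lborel)"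
    by (rule nn_integral_unif01) fact
  also have "\<dots> = (\<integral>\<^sup>+U. f (1 - U) * indicator {0..1} (1 - U) \<partial>lborel)"
    by (subst nn_integral_real_affine[where c="-1" and t=1]) auto
  also have "\<dots> = (\<integral>\<^sup>+U. f (1 - U) * indicator {0..1} U \<partial>lborel)"
    by (intro nn_integral_cong) (auto simp: indicator_def)
  also have "\<dots> = (\<integral>\<^sup>+U. f (1 - U) \<partial>unif01)"
    by (rule nn_integral_unif01[symmetric]) measurable
  finally show ?thesis by simp
qed

text \<open>The subtree contributions carry the factors \<open>U\<^sup>2\<close> and \<open>(1 - U)\<^sup>2\<close>: one power of the length for the chance to hit
the subinterval, one for the scaling of the distance. Each factor has mean \<open>1/3\<close>.\<close>

lemma gap_mean_Suc: "gap_mean (Suc (Suc k)) = ennreal (2 / 3) * gap_mean (Suc k)"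
proof -
  let ?g = "\<lambda>u. \<integral>\<^sup>+x. ennreal (gap (Suc k) u x) \<partial>unif01"
  have [measurable]: "?g \<in> borel_measurable tree_space" by measurable
  have "gap_mean (Suc (Suc k)) = (\<integral>\<^sup>+U. (\<integral>\<^sup>+a. (\<integral>\<^sup>+b.
      (\<integral>\<^sup>+x. ennreal (gap (Suc (Suc k)) (glue U a b) x) \<partial>unif01) \<partial>tree_space) \<partial>tree_space) \<partial>unif01)"
    unfolding gap_mean_def by (rule nn_integral_tree_split) measurable
  also have "\<dots> = (\<integral>\<^sup>+U. (\<integral>\<^sup>+a. (\<integral>\<^sup>+b. ennreal (U\<^sup>2) * ?g a + ennreal ((1 - U)\<^sup>2) * ?g b
      \<partial>tree_space) \<partial>tree_space) \<partial>unif01)"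
  proof (rule nn_integral_cong_AE, use AE_unif01 in eventually_elim)
    fix U :: real assume U: "0 < U \<and> U < 1"
    have good: "AE a in tree_space. unit_valued a \<and> a \<in> space tree_space"
      using AE_tree_unit_valued AE_space by eventually_elim auto
    show "(\<integral>\<^sup>+a. (\<integral>\<^sup>+b. (\<integral>\<^sup>+x. ennreal (gap (Suc (Suc k)) (glue U a b) x) \<partial>unif01)
        \<partial>tree_space) \<partial>tree_space) =
      (\<integral>\<^sup>+a. (\<integral>\<^sup>+b. ennreal (U\<^sup>2) * ?g a + ennreal ((1 - U)\<^sup>2) * ?g b \<partial>tree_space) \<partial>tree_space)"
    proof (rule nn_integral_cong_AE, use good in eventually_elim)
      case (elim a)
      show ?case
        by (rule nn_integral_cong_AE, use good in eventually_elim)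
          (use U elim in \<open>auto intro!: nn_integral_gap_glue\<close>)
    qed
  qed
  also have "\<dots> = (\<integral>\<^sup>+U. ennreal (U\<^sup>2) * gap_mean (Suc k) + ennreal ((1 - U)\<^sup>2) * gap_mean (Suc k) \<partial>unif01)"
    by (simp add: nn_integral_add nn_integral_cmult gap_mean_def tree.emeasure_space_1)
  also have "\<dots> = (\<integral>\<^sup>+U. ennreal (U\<^sup>2) \<partial>unif01) * gap_mean (Suc k) +
      (\<integral>\<^sup>+U. ennreal ((1 - U)\<^sup>2) \<partial>unif01) * gap_mean (Suc k)"
    by (subst nn_integral_add) (auto simp: nn_integral_multc)
  also have "(\<integral>\<^sup>+U. ennreal ((1 - U)\<^sup>2) \<partial>unif01) = (\<integral>\<^sup>+U. ennreal (U\<^sup>2) \<partial>unif01)"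
    by (rule nn_integral_unif01_reflect) measurable
  also have "\<dots> = ennreal (1 / 3)" by (rule nn_integral_unif01_square)
  finally show ?thesis
    by (simp flip: distrib_right ennreal_plus)
qed

lemma gap_mean_le: "gap_mean (Suc k) \<le> ennreal ((2 / 3) ^ k)"
proof (induction k)
  case (Suc k)
  have "gap_mean (Suc (Suc k)) \<le> ennreal (2 / 3) * ennreal ((2 / 3) ^ k)"
    unfolding gap_mean_Suc by (intro mult_left_mono Suc) auto
  then show ?case by (simp flip: ennreal_mult)
qed (use gap_mean_1 in \<open>simp add: One_nat_def\<close>)

lemma suminf_gap_mean_le: "(\<Sum>k. gap_mean (Suc k)) \<le> 3"
proof -
  have "(\<Sum>k. gap_mean (Suc k)) \<le> (\<Sum>k. ennreal ((2 / 3) ^ k))"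
    by (intro suminf_le gap_mean_le) auto
  also have "\<dots> = ennreal (\<Sum>k. (2 / 3) ^ k)"
    by (intro suminf_ennreal2) (auto intro: summable_geometric)
  also have "(\<Sum>k. (2 / 3 :: real) ^ k) = 3"
    by (subst suminf_geometric) auto
  finally show ?thesis by simp
qed

section \<open>The sum over all points as a series over the levels\<close>

definition level_sum :: "nat \<Rightarrow> sample \<Rightarrow> real" where
  "level_sum k = (\<lambda>(n, v, u). \<Sum>i=1..n k. gap k u (v (k, i)))"

definition X_upto :: "nat \<Rightarrow> real \<Rightarrow> sample \<Rightarrow> real" where
  "X_upto K l w = 1 / l * (\<Sum>k<K. level_sum (Suc k) w)"

lemma level_sum_nonneg: "0 \<le> level_sum k w"
  by (auto simp: level_sum_def split_beta intro!: sum_nonneg gap_nonneg)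

lemma measurable_sample_count [measurable]:
  "(\<lambda>w. fst w k) \<in> sample_space l \<rightarrow>\<^sub>M count_space UNIV"
  unfolding sample_space_def by (rule measurable_compose[OF measurable_fst measurable_count])

lemma measurable_sample_mark [measurable]:
  "(\<lambda>w. fst (snd w) p) \<in> borel_measurable (sample_space l)"
  unfolding sample_space_def
  by (rule measurable_compose[OF _ measurable_unif01_component, of "\<lambda>w. fst (snd w)"]) measurable

lemma measurable_sample_tree [measurable]:
  "(\<lambda>w. snd (snd w)) \<in> sample_space l \<rightarrow>\<^sub>M tree_space"
  unfolding sample_space_def by measurable

lemma measurable_level_sum [measurable]: "level_sum k \<in> borel_measurable (sample_space l)"
  unfolding level_sum_def split_beta
  by (intro measurable_sum_upto_count measurable_sample_count measurable_gap2
      measurable_sample_tree measurable_sample_mark)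

lemma measurable_X_upto [measurable]: "X_upto K l \<in> borel_measurable (sample_space r)"
  unfolding X_upto_def by measurable

text \<open>A nonnegative sum over a countable set is the value of an extended nonnegative series, converted to a real number. The value \<open>0\<close> of
\<open>infsum\<close> at divergence agrees with the value of \<open>enn2real\<close> at infinity.\<close>

lemma borel_measurable_infsum_nonneg:
  fixes f :: "nat \<times> nat \<Rightarrow> 'a \<Rightarrow> real"
  assumes [measurable]: "\<And>p. f p \<in> borel_measurable M" and nonneg: "\<And>p w. 0 \<le> f p w"
  shows "(\<lambda>w. \<Sum>\<^sub>\<infinity>p. f p w) \<in> borel_measurable M"
proof -
  have "(\<Sum>\<^sub>\<infinity>p. f p w) = enn2real (\<Sum>m. ennreal (f (prod_decode m) w))" for w
  proof -
    let ?g = "\<lambda>m. f (prod_decode m) w"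
    have *: "(\<Sum>\<^sub>\<infinity>p. f p w) = (\<Sum>\<^sub>\<infinity>m. ?g m)"
      by (rule infsum_reindex_bij_betw[symmetric]) (rule bij_prod_decode)
    show ?thesis
    proof (cases "summable ?g")
      case True
      then have "(?g has_sum suminf ?g) UNIV"
        by (intro sums_nonneg_imp_has_sum summable_sums nonneg)
      then have a: "(\<Sum>\<^sub>\<infinity>m. ?g m) = suminf ?g" by (rule infsumI)
      have b: "(\<Sum>m. ennreal (?g m)) = ennreal (suminf ?g)"
        by (rule suminf_ennreal2[OF nonneg True])
      show ?thesis
        unfolding * a b by (rule enn2real_ennreal[symmetric], rule suminf_nonneg[OF True nonneg])
    next
      case False
      then have a: "(\<Sum>m. ennreal (?g m)) = top"
        using summable_suminf_not_top[of ?g, OF nonneg] by blast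
      have "\<not> ?g summable_on UNIV"
        using False summable_on_UNIV_nonneg_real_iff[of ?g, OF nonneg] by blast
      then have b: "(\<Sum>\<^sub>\<infinity>m. ?g m) = 0" by (rule infsum_not_exists)
      show ?thesis unfolding * a b by simp
    qed
  qed
  then show ?thesis by simp
qed

text \<open>A sum over a random set is rewritten as a sum over a fixed index set: a point that occurs several times at the
same level is represented by its first occurrence. The identity holds for every sample, since the law \<open>nu l\<close>
presupposes that \<open>X l\<close> is measurable everywhere and not merely almost everywhere.\<close>

lemma infsum_poisson_points:
  fixes F :: "nat \<times> real \<Rightarrow> real"
  shows "infsum F (poisson_points n v) =
    (\<Sum>\<^sub>\<infinity>p. if 1 \<le> fst p \<and> 1 \<le> snd p \<and> snd p \<le> n (fst p) \<and>
        (\<forall>i\<in>{1..<snd p}. v (fst p, i) \<noteq> v p) then F (fst p, v p) else 0)"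
proof -
  define A where "A = {p. 1 \<le> fst p \<and> 1 \<le> snd p \<and> snd p \<le> n (fst p) \<and>
        (\<forall>i\<in>{1..<snd p}. v (fst p, i) \<noteq> v p)}"
  have "poisson_points n v = (\<lambda>p. (fst p, v p)) ` A"
  proof (intro equalityI subsetI)
    fix q assume "q \<in> poisson_points n v"
    then obtain k i where q: "q = (k, v (k, i))" "1 \<le> k" "1 \<le> i" "i \<le> n k"
      by (auto simp: poisson_points_def)
    \<comment> \<open>The first occurrence of the point represents it.\<close>
    define j where "j = (LEAST j. 1 \<le> j \<and> v (k, j) = v (k, i))"
    have j: "1 \<le> j \<and> v (k, j) = v (k, i)" unfolding j_def by (rule LeastI[of _ i]) (use q in auto)
    have "j \<le> i" unfolding j_def by (rule Least_le) (use q in auto)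
    moreover have "v (k, i') \<noteq> v (k, j)" if "i' \<in> {1..<j}" for i'
      using that not_less_Least[of i' "\<lambda>j. 1 \<le> j \<and> v (k, j) = v (k, i)"] j by (auto simp: j_def)
    ultimately have "(k, j) \<in> A" using q j by (auto simp: A_def)
    moreover have "q = (fst (k, j), v (k, j))" using q j by simp
    ultimately show "q \<in> (\<lambda>p. (fst p, v p)) ` A" by blast
  qed (auto simp: A_def poisson_points_def)
  moreover have "inj_on (\<lambda>p. (fst p, v p)) A"
  proof (rule inj_onI)
    fix p q assume pq: "p \<in> A" "q \<in> A" "(fst p, v p) = (fst q, v q)"
    have "\<not> snd p < snd q" "\<not> snd q < snd p"
      using pq by (auto simp: A_def prod_eq_iff) (metis atLeastLessThan_iff prod.collapse)+
    with pq show "p = q" by (simp add: prod_eq_iff)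
  qed
  ultimately have "infsum F (poisson_points n v) = infsum (F \<circ> (\<lambda>p. (fst p, v p))) A"
    by (simp add: infsum_reindex)
  also have "\<dots> = (\<Sum>\<^sub>\<infinity>p. if p \<in> A then F (fst p, v p) else 0)"
    by (rule infsum_cong_neutral) auto
  finally show ?thesis by (simp add: A_def)
qed

lemma measurable_X [measurable]: "X l \<in> borel_measurable (sample_space r)"
proof -
  have "X l = (\<lambda>w. 1 / l * (\<Sum>\<^sub>\<infinity>p. if 1 \<le> fst p \<and> 1 \<le> snd p \<and> snd p \<le> fst w (fst p) \<and>
        (\<forall>i\<in>{1..<snd p}. fst (snd w) (fst p, i) \<noteq> fst (snd w) p)
      then gap (fst p) (snd (snd w)) (fst (snd w) p) else 0))"
  proof
    fix w :: sample
    obtain n v u where w: "w = (n, v, u)" by (cases w) auto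
    show "X l w = 1 / l * (\<Sum>\<^sub>\<infinity>p. if 1 \<le> fst p \<and> 1 \<le> snd p \<and> snd p \<le> fst w (fst p) \<and>
        (\<forall>i\<in>{1..<snd p}. fst (snd w) (fst p, i) \<noteq> fst (snd w) p)
      then gap (fst p) (snd (snd w)) (fst (snd w) p) else 0)"
      unfolding w X_def prod.case infsum_poisson_points gap_def fst_conv snd_conv ..
  qed
  moreover have "\<dots> \<in> borel_measurable (sample_space r)"
  proof (intro borel_measurable_times borel_measurable_infsum_nonneg)
    fix p :: "nat \<times> nat"
    have [measurable]: "(\<lambda>w. gap (fst p) (snd (snd w)) (fst (snd w) p)) \<in> borel_measurable (sample_space r)"
      by (intro measurable_gap2 measurable_sample_tree measurable_sample_mark)
    have [measurable]: "Measurable.pred (sample_space r) (\<lambda>w. snd p \<le> fst w (fst p))"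
      by (rule measurable_compose[OF measurable_sample_count]) simp
    have "Measurable.pred (sample_space r) (\<lambda>w. fst (snd w) q \<noteq> fst (snd w) p)" for q
      unfolding pred_def by (rule borel_measurable_neq) (rule measurable_sample_mark)+
    then have [measurable]: "Measurable.pred (sample_space r)
        (\<lambda>w. \<forall>i\<in>{1..<snd p}. fst (snd w) (fst p, i) \<noteq> fst (snd w) p)"
      by (intro pred_intros_finite) auto
    show "(\<lambda>w. if 1 \<le> fst p \<and> 1 \<le> snd p \<and> snd p \<le> fst w (fst p) \<and>
        (\<forall>i\<in>{1..<snd p}. fst (snd w) (fst p, i) \<noteq> fst (snd w) p)
      then gap (fst p) (snd (snd w)) (fst (snd w) p) else 0) \<in> borel_measurable (sample_space r)"
      by (intro measurable_If pred_intros_logic) measurable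
  qed (auto simp: gap_nonneg)
  ultimately show ?thesis by simp
qed

lemma X_nonneg: "0 < l \<Longrightarrow> 0 \<le> X l w"
  unfolding X_def split_beta by (intro mult_nonneg_nonneg infsum_nonneg) auto

text \<open>For distinct marks and a convergent series of level sums, the unordered sum of nonnegative terms may be
arranged by levels.\<close>

lemma infsum_distinct_points:
  assumes distinct: "\<And>p q. p \<in> {1..} \<times> {1..} \<Longrightarrow> q \<in> {1..} \<times> {1..} \<Longrightarrow> p \<noteq> q \<Longrightarrow> v p \<noteq> v q"
    and summable: "summable (\<lambda>k. level_sum (Suc k) (n, v, u))"
  shows "(\<Sum>\<^sub>\<infinity>(k, x)\<in>poisson_points n v. gap k u x) = (\<Sum>k. level_sum (Suc k) (n, v, u))"
proof -
  let ?S = "SIGMA k:{1..}. {1..n k}"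
  let ?g = "\<lambda>k. level_sum k (n, v, u)"
  have points: "poisson_points n v = (\<lambda>p. (fst p, v p)) ` ?S"
    by (force simp: poisson_points_def)
  have inj: "inj_on (\<lambda>p. (fst p, v p)) ?S"
    by (rule inj_onI) (use distinct in fastforce)
  have "((\<lambda>k. ?g (Suc k)) has_sum (\<Sum>k. ?g (Suc k))) UNIV"
    by (intro sums_nonneg_imp_has_sum summable_sums summable level_sum_nonneg)
  then have "(?g has_sum (\<Sum>k. ?g (Suc k))) (range Suc)"
    by (simp add: has_sum_reindex comp_def)
  also have "range Suc = {1..}" by (auto simp: image_iff) presburger
  finally have g: "(?g has_sum (\<Sum>k. ?g (Suc k))) {1..}" .
  have inner: "((\<lambda>i. gap (fst (k, i)) u (v (k, i))) has_sum ?g k) {1..n k}" for k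
    unfolding level_sum_def by (simp add: has_sum_finite)
  have "((\<lambda>p. gap (fst p) u (v p)) has_sum (\<Sum>k. ?g (Suc k))) ?S"
    by (rule has_sum_SigmaI[OF inner g], rule summable_on_SigmaI[OF inner])
      (use g in \<open>auto simp: gap_nonneg summable_on_def\<close>)
  then have "((\<lambda>(k, x). gap k u x) has_sum (\<Sum>k. ?g (Suc k))) (poisson_points n v)"
    unfolding points by (subst has_sum_reindex[OF inj]) (simp add: comp_def)
  then show ?thesis by (rule infsumI)
qed

lemma nn_integral_level_sum:
  assumes "0 < l" "1 \<le> k"
  shows "(\<integral>\<^sup>+w. ennreal (level_sum k w) \<partial>sample_space l) = ennreal l * gap_mean k"
proof -
  have "(\<integral>\<^sup>+w. ennreal (level_sum k w) \<partial>sample_space l) =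
      (\<integral>\<^sup>+u. (\<integral>\<^sup>+(n, v). ennreal (level_sum k (n, v, u)) \<partial>(poisson_counts l \<Otimes>\<^sub>M mark_space)) \<partial>tree_space)"
    by (rule nn_integral_sample) measurable
  also have "\<dots> = (\<integral>\<^sup>+u. ennreal l * (\<integral>\<^sup>+x. ennreal (gap k u x) \<partial>unif01) \<partial>tree_space)"
  proof (rule nn_integral_cong)
    fix u assume u: "u \<in> space tree_space"
    have "(\<integral>\<^sup>+(n, v). ennreal (level_sum k (n, v, u)) \<partial>(poisson_counts l \<Otimes>\<^sub>M mark_space)) =
        (\<integral>\<^sup>+(n, v). (\<Sum>i=1..n k. ennreal (gap k u (v (k, i)))) \<partial>(poisson_counts l \<Otimes>\<^sub>M mark_space))"
      by (simp add: level_sum_def sum_ennreal gap_nonneg)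
    also have "\<dots> = ennreal l * (\<integral>\<^sup>+x. ennreal (gap k u x) \<partial>unif01)"
      by (rule poisson_marks_mean[OF assms(1) _ assms(2)])
        (rule measurable_compose[OF measurable_gap_section[OF u] measurable_ennreal])
    finally show "(\<integral>\<^sup>+(n, v). ennreal (level_sum k (n, v, u)) \<partial>(poisson_counts l \<Otimes>\<^sub>M mark_space)) =
        ennreal l * (\<integral>\<^sup>+x. ennreal (gap k u x) \<partial>unif01)" .
  qed
  also have "\<dots> = ennreal l * gap_mean k"
    unfolding gap_mean_def by (rule nn_integral_cmult) measurable
  finally show ?thesis .
qed

lemma nn_integral_total_le:
  assumes "0 < l"
  shows "(\<integral>\<^sup>+w. (\<Sum>k. ennreal (level_sum (Suc k) w)) \<partial>sample_space l) \<le> ennreal l * 3"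
proof -
  have "(\<integral>\<^sup>+w. (\<Sum>k. ennreal (level_sum (Suc k) w)) \<partial>sample_space l) =
      (\<Sum>k. \<integral>\<^sup>+w. ennreal (level_sum (Suc k) w) \<partial>sample_space l)"
    by (rule nn_integral_suminf) measurable
  also have "\<dots> = (\<Sum>k. ennreal l * gap_mean (Suc k))"
    using assms by (simp add: nn_integral_level_sum)
  also have "\<dots> = ennreal l * (\<Sum>k. gap_mean (Suc k))" by simp
  also have "\<dots> \<le> ennreal l * 3" by (intro mult_left_mono suminf_gap_mean_le) auto
  finally show ?thesis .
qed

lemma distr_pair_snd:
  assumes "prob_space M" "sigma_finite_measure N"
  shows "distr (M \<Otimes>\<^sub>M N) N snd = N"
proof (rule measure_eqI)
  interpret M: prob_space M by fact
  interpret N: sigma_finite_measure N by fact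
  fix A assume "A \<in> sets (distr (M \<Otimes>\<^sub>M N) N snd)"
  then have A: "A \<in> sets N" by simp
  then have "snd -` A \<inter> space (M \<Otimes>\<^sub>M N) = space M \<times> A"
    using sets.sets_into_space[of A N] by (auto simp: space_pair_measure)
  then show "emeasure (distr (M \<Otimes>\<^sub>M N) N snd) A = emeasure N A"
    using A by (simp add: emeasure_distr N.emeasure_pair_measure_Times M.emeasure_space_1)
qed simp

lemma AE_distinct_marks:
  "AE w in sample_space l. \<forall>p\<in>{1..} \<times> {1..}. \<forall>q\<in>{1..} \<times> {1..}. p \<noteq> q \<longrightarrow> fst (snd w) p \<noteq> fst (snd w) q"
proof -
  have "AE v in mark_space. \<forall>p\<in>{1..} \<times> {1..}. \<forall>q\<in>{1..} \<times> {1..}. p \<noteq> q \<longrightarrow> v p \<noteq> v q"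
    unfolding AE_ball_countable[OF countableI_type]
  proof (intro ballI)
    fix p q :: "nat \<times> nat" assume "p \<in> {1..} \<times> {1..}" "q \<in> {1..} \<times> {1..}"
    then show "AE v in mark_space. p \<noteq> q \<longrightarrow> v p \<noteq> v q"
      by (cases "p = q") (simp_all only: simp_thms AE_PiM_unif01_distinct_components eventually_True)
  qed
  moreover have eq: "distr (sample_space l) mark_space (\<lambda>w. fst (snd w)) = mark_space"
  proof -
    interpret MT: prob_space "mark_space \<Otimes>\<^sub>M tree_space"
      by (intro prob_space_pair marks.prob_space_axioms tree.prob_space_axioms)
    have "distr (sample_space l) mark_space (fst \<circ> snd) =
        distr (distr (sample_space l) (mark_space \<Otimes>\<^sub>M tree_space) snd) mark_space fst"
      unfolding sample_space_def by (rule distr_distr[symmetric]) measurable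
    also have "distr (sample_space l) (mark_space \<Otimes>\<^sub>M tree_space) snd = mark_space \<Otimes>\<^sub>M tree_space"
      unfolding sample_space_def by (rule distr_pair_snd[OF counts.prob_space_axioms MT.sigma_finite_measure_axioms])
    also have "distr (mark_space \<Otimes>\<^sub>M tree_space) mark_space fst = mark_space"
      by (rule tree.distr_pair_fst)
    finally show ?thesis by (simp add: comp_def)
  qed
  ultimately have "AE v in distr (sample_space l) mark_space (\<lambda>w. fst (snd w)).
      \<forall>p\<in>{1..} \<times> {1..}. \<forall>q\<in>{1..} \<times> {1..}. p \<noteq> q \<longrightarrow> v p \<noteq> v q"
    by (simp only: eq)
  moreover have "(\<lambda>w. fst (snd w)) \<in> sample_space l \<rightarrow>\<^sub>M mark_space"
    unfolding sample_space_def by measurable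
  ultimately show ?thesis
    by (rule AE_distrD[rotated])
qed

text \<open>Finite mean makes the series over the levels converge almost surely.\<close>

lemma AE_X_eq_suminf:
  assumes "0 < l"
  shows "AE w in sample_space l. summable (\<lambda>k. level_sum (Suc k) w) \<and>
    X l w = 1 / l * (\<Sum>k. level_sum (Suc k) w)"
proof -
  have "(\<integral>\<^sup>+w. (\<Sum>k. ennreal (level_sum (Suc k) w)) \<partial>sample_space l) \<noteq> \<infinity>"
    using nn_integral_total_le[OF assms] by (auto simp: top_unique ennreal_mult_eq_top_iff)
  then have "AE w in sample_space l. (\<Sum>k. ennreal (level_sum (Suc k) w)) \<noteq> \<infinity>"
    by (intro nn_integral_PInf_AE) measurable
  with AE_distinct_marks[of l] show ?thesis
  proof eventually_elim
    case (elim w)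
    obtain n v u where w: "w = (n, v, u)" by (cases w) auto
    have summable: "summable (\<lambda>k. level_sum (Suc k) w)"
      using elim by (intro summable_suminf_not_top level_sum_nonneg) auto
    moreover have "X l w = 1 / l * (\<Sum>\<^sub>\<infinity>(k, x)\<in>poisson_points n v. gap k u x)"
      by (simp add: X_def gap_def w)
    moreover have "(\<Sum>\<^sub>\<infinity>(k, x)\<in>poisson_points n v. gap k u x) = (\<Sum>k. level_sum (Suc k) w)"
      unfolding w using elim summable w by (intro infsum_distinct_points) auto
    ultimately show ?case by simp
  qed
qed

lemma AE_X_upto_tendsto:
  assumes "0 < l"
  shows "AE w in sample_space l. (\<lambda>K. X_upto K l w) \<longlonglongrightarrow> X l w"
  using AE_X_eq_suminf[OF assms]
  by eventually_elim (use assms in \<open>auto simp: X_upto_def intro!: tendsto_intros summable_LIMSEQ\<close>)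

lemma nn_integral_X_le:
  assumes "0 < l"
  shows "(\<integral>\<^sup>+w. ennreal (X l w) \<partial>sample_space l) \<le> 3"
proof -
  have "(\<integral>\<^sup>+w. ennreal (X l w) \<partial>sample_space l) =
      (\<integral>\<^sup>+w. ennreal (1 / l) * (\<Sum>k. ennreal (level_sum (Suc k) w)) \<partial>sample_space l)"
  proof (rule nn_integral_cong_AE, use AE_X_eq_suminf[OF assms] in eventually_elim)
    case (elim w)
    then have sm: "summable (\<lambda>k. level_sum (Suc k) w)"
      and "X l w = 1 / l * (\<Sum>k. level_sum (Suc k) w)" by auto
    then show ?case
      using assms suminf_nonneg[OF sm level_sum_nonneg]
      by (simp only: suminf_ennreal2[OF level_sum_nonneg sm]) (simp flip: ennreal_mult)
  qed
  also have "\<dots> = ennreal (1 / l) * (\<integral>\<^sup>+w. (\<Sum>k. ennreal (level_sum (Suc k) w)) \<partial>sample_space l)"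
    by (rule nn_integral_cmult) measurable
  also have "\<dots> \<le> ennreal (1 / l) * (ennreal l * 3)"
    by (intro mult_left_mono nn_integral_total_le assms) auto
  also have "\<dots> = 3"
    using assms by (simp add: mult.assoc[symmetric] ennreal_mult[symmetric])
  finally show ?thesis .
qed

section \<open>The characteristic function of X and its recursion\<close>

text \<open>For a fixed tree \<open>u\<close>, the level \<open>k\<close> contributes the factor \<open>exp (l * level_exponent k (t / l) u)\<close> to the
characteristic function of \<open>X l\<close> at \<open>t\<close>; the factor \<open>1 / l\<close> in \<open>X l\<close> accounts for the argument \<open>t / l\<close>.\<close>

definition level_exponent :: "nat \<Rightarrow> real \<Rightarrow> (nat \<times> nat \<Rightarrow> real) \<Rightarrow> complex" where
  "level_exponent k s u = (CLINT x|unif01. iexp (s * gap k u x)) - 1"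

text \<open>The conditional characteristic function, given the tree, of the part of \<open>X l\<close> that comes from the first \<open>K\<close>
levels. Truncation turns the recursion along the tree into a step from \<open>K\<close> to \<open>K + 1\<close>.\<close>

definition tree_char :: "nat \<Rightarrow> real \<Rightarrow> real \<Rightarrow> (nat \<times> nat \<Rightarrow> real) \<Rightarrow> complex" where
  "tree_char K l t u = exp (of_real l * (\<Sum>k<K. level_exponent (Suc k) (t / l) u))"

definition char_upto :: "nat \<Rightarrow> real \<Rightarrow> real \<Rightarrow> complex" where
  "char_upto K l t = (CLINT u|tree_space. tree_char K l t u)"

lemma sum_from_1: "(\<Sum>k=1..K. f k) = (\<Sum>k<K. f (Suc k))" for K :: nat
  unfolding One_nat_def by (rule sum.atLeast1_atMost_eq)

lemma measurable_iexp [measurable (raw)]: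
  "f \<in> borel_measurable M \<Longrightarrow> (\<lambda>w. iexp (f w)) \<in> borel_measurable M"
  by measurable

lemma norm_iexp [simp]: "norm (iexp x) = 1"
  by (simp add: norm_exp_i_times)

text \<open>The exponents have nonpositive real parts, being averages of points of the unit circle minus \<open>1\<close>.\<close>

lemma norm_tree_char_le: "0 \<le> l \<Longrightarrow> norm (tree_char K l t u) \<le> 1"
proof -
  assume "0 \<le> l"
  have "Re (level_exponent k s u) \<le> 0" for k s
  proof -
    have "norm (CLINT x|unif01. iexp (s * gap k u x)) \<le> 1"
      by (rule norm_integral_le_1[OF prob_space_unif01]) (simp only: norm_iexp order_refl)
    then show ?thesis using complex_Re_le_cmod[of "CLINT x|unif01. iexp (s * gap k u x)"]
      by (simp add: level_exponent_def)
  qed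
  then have "(\<Sum>k<K. Re (level_exponent (Suc k) (t / l) u)) \<le> 0" by (intro sum_nonpos) auto
  with \<open>0 \<le> l\<close> show ?thesis by (simp add: tree_char_def mult_nonneg_nonpos)
qed

lemma measurable_level_exponent [measurable (raw)]:
  assumes [measurable]: "f \<in> borel_measurable M" "g \<in> M \<rightarrow>\<^sub>M tree_space"
  shows "(\<lambda>w. level_exponent k (f w) (g w)) \<in> borel_measurable M"
proof -
  have "(\<lambda>q. iexp (f (fst q) * gap k (g (fst q)) (snd q))) \<in> borel_measurable (M \<Otimes>\<^sub>M unif01)"
  proof -
    have "(\<lambda>q. gap k (g (fst q)) (snd q)) \<in> borel_measurable (M \<Otimes>\<^sub>M unif01)"
      by (rule measurable_gap2) measurable
    then show ?thesis by measurable
  qed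
  then have "(\<lambda>w. CLINT x|unif01. iexp (f w * gap k (g w) x)) \<in> borel_measurable M"
    by (intro unif01.borel_measurable_lebesgue_integral) (simp add: case_prod_unfold)
  then show ?thesis unfolding level_exponent_def by measurable
qed

lemma measurable_tree_char [measurable (raw)]:
  assumes [measurable]: "l \<in> borel_measurable M" "t \<in> borel_measurable M" "g \<in> M \<rightarrow>\<^sub>M tree_space"
  shows "(\<lambda>w. tree_char K (l w) (t w) (g w)) \<in> borel_measurable M"
  unfolding tree_char_def by measurable

lemma measurable_char_upto [measurable (raw)]:
  assumes [measurable]: "l \<in> borel_measurable M" "t \<in> borel_measurable M"
  shows "(\<lambda>w. char_upto K (l w) (t w)) \<in> borel_measurable M"
  unfolding char_upto_def
  by (intro tree.borel_measurable_lebesgue_integral) (simp add: case_prod_unfold)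

lemma norm_char_upto_le: "0 \<le> l \<Longrightarrow> norm (char_upto K l t) \<le> 1"
proof (cases "integrable tree_space (tree_char K l t)")
  case True
  assume l: "0 \<le> l"
  have "norm (char_upto K l t) \<le> (\<integral>u. norm (tree_char K l t u) \<partial>tree_space)"
    unfolding char_upto_def by (rule integral_norm_bound)
  also have "\<dots> \<le> (\<integral>u. 1 \<partial>tree_space)"
    using True l by (intro integral_mono) (auto intro: norm_tree_char_le)
  finally show ?thesis by (simp add: tree.prob_space)
qed (simp add: char_upto_def not_integrable_integral_eq)

lemma char_X_upto:
  assumes l: "0 < l"
  shows "(CLINT w|sample_space l. iexp (t * X_upto K l w)) = char_upto K l t"
proof -
  have "(CLINT w|sample_space l. iexp (t * X_upto K l w)) =
      (\<integral>u. (\<integral>(n, v). iexp (t * X_upto K l (n, v, u)) \<partial>(poisson_counts l \<Otimes>\<^sub>M mark_space)) \<partial>tree_space)"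
    by (rule integral_sample)
      (intro measurable_iexp borel_measurable_times borel_measurable_const measurable_X_upto, simp only: norm_iexp order_refl)
  also have "\<dots> = char_upto K l t"
    unfolding char_upto_def
  proof (rule Bochner_Integration.integral_cong[OF refl])
    fix u assume u: "u \<in> space tree_space"
    define h where "h k x = iexp (t / l * gap k u x)" for k x
    have "iexp (t * X_upto K l (n, v, u)) = (\<Prod>k=1..K. \<Prod>i=1..n k. h k (v (k, i)))" for n v
    proof -
      have "t * X_upto K l (n, v, u) = (\<Sum>k=1..K. \<Sum>i=1..n k. t / l * gap k u (v (k, i)))"
        by (simp add: X_upto_def level_sum_def sum_distrib_left sum_from_1)
      then show ?thesis
        by (simp only: of_real_sum sum_distrib_left exp_sum finite_atLeastAtMost h_def)
    qed
    then have "(\<integral>(n, v). iexp (t * X_upto K l (n, v, u)) \<partial>(poisson_counts l \<Otimes>\<^sub>M mark_space)) =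
        (\<integral>(n, v). (\<Prod>k=1..K. \<Prod>i=1..n k. h k (v (k, i))) \<partial>(poisson_counts l \<Otimes>\<^sub>M mark_space))"
      by simp
    also have "\<dots> = exp (of_real l * (\<Sum>k=1..K. (\<integral>x. h k x \<partial>unif01) - 1))"
    proof (rule poisson_pgf_marks[OF l])
      show "h k \<in> borel_measurable borel" for k
        unfolding h_def using measurable_gap_section[OF u, of k] by measurable
      show "norm (h k x) \<le> 1" for k x
        unfolding h_def by (simp only: norm_iexp order_refl)
    qed
    also have "\<dots> = tree_char K l t u"
      by (simp add: tree_char_def level_exponent_def h_def sum_from_1)
    finally show "(\<integral>(n, v). iexp (t * X_upto K l (n, v, u)) \<partial>(poisson_counts l \<Otimes>\<^sub>M mark_space)) =
        tree_char K l t u" .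
  qed
  finally show ?thesis .
qed

text \<open>Almost sure convergence of the partial sums and the bound \<open>1\<close> for the exponentials allow dominated
convergence.\<close>

lemma char_upto_tendsto:
  assumes l: "0 < l"
  shows "(\<lambda>K. char_upto K l t) \<longlonglongrightarrow> char (nu l) t"
proof -
  have "(\<lambda>K. CLINT w|sample_space l. iexp (t * X_upto K l w)) \<longlonglongrightarrow>
      (CLINT w|sample_space l. iexp (t * X l w))"
  proof (rule integral_dominated_convergence[where w="\<lambda>_. 1"])
    show "AE w in sample_space l. (\<lambda>K. iexp (t * X_upto K l w)) \<longlonglongrightarrow> iexp (t * X l w)"
      using AE_X_upto_tendsto[OF l] by eventually_elim (intro tendsto_intros)
    show "AE w in sample_space l. norm (iexp (t * X_upto K l w)) \<le> 1" for K
      by (simp only: norm_iexp order_refl eventually_True)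
  qed (auto intro!: measurable_iexp)
  also have "(CLINT w|sample_space l. iexp (t * X l w)) = char (nu l) t"
    unfolding nu_def char_def by (subst integral_distr) auto
  finally show ?thesis using char_X_upto[OF l] by simp
qed

lemma measurable_poisson_count_fst [measurable]:
  "fst \<in> measure_pmf (poisson_pmf l) \<Otimes>\<^sub>M N \<rightarrow>\<^sub>M count_space UNIV"
  using measurable_fst[of "measure_pmf (poisson_pmf l)" N]
  unfolding measurable_cong_sets[OF refl sets_measure_pmf_count_space] .

lemma measurable_theta_variable:
  "(\<lambda>q. 1 / l * (\<Sum>i=1..fst (snd q). \<bar>fst q - snd (snd q) i\<bar>)) \<in>
    borel_measurable (borel \<Otimes>\<^sub>M (measure_pmf (poisson_pmf l) \<Otimes>\<^sub>M (\<Pi>\<^sub>M i\<in>{1::nat..}. unif01)))"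
proof -
  have [measurable]: "(\<lambda>q. snd (snd q) i) \<in>
      borel_measurable (borel \<Otimes>\<^sub>M (measure_pmf (poisson_pmf l) \<Otimes>\<^sub>M (\<Pi>\<^sub>M i\<in>{1::nat..}. unif01)))" for i
    by (rule measurable_compose[OF _ measurable_unif01_component, of "\<lambda>q. snd (snd q)"]) measurable
  show ?thesis
    by (intro borel_measurable_times measurable_sum_upto_count
        measurable_compose[OF measurable_snd measurable_poisson_count_fst]) measurable
qed

lemma measurable_theta_section:
  "(\<lambda>(n, v). 1 / l * (\<Sum>i=1..n. \<bar>u - v i\<bar>)) \<in>
    borel_measurable (measure_pmf (poisson_pmf l) \<Otimes>\<^sub>M (\<Pi>\<^sub>M i\<in>{1::nat..}. unif01))"
  using measurable_compose[OF measurable_Pair1' measurable_theta_variable, of u]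
  by (simp add: case_prod_unfold)

lemma prob_space_theta_source:
  "prob_space (measure_pmf (poisson_pmf l) \<Otimes>\<^sub>M (\<Pi>\<^sub>M i\<in>{1::nat..}. unif01))"
  by (intro prob_space_pair prob_space_measure_pmf prob_space_PiM prob_space_unif01)

text \<open>This is the factor that the first level contributes to the characteristic function of \<open>X l\<close> when the root variable
is \<open>u\<close>; compare \<open>level_exponent_root\<close>.\<close>

lemma char_theta_law:
  assumes l: "0 < l"
  shows "char (theta_law l u) t = exp (of_real l * ((CLINT x|unif01. iexp (t / l * \<bar>u - x\<bar>)) - 1))"
proof -
  let ?P = "measure_pmf (poisson_pmf l) \<Otimes>\<^sub>M (\<Pi>\<^sub>M i\<in>{1::nat..}. unif01)"
  have "char (theta_law l u) t = (\<integral>(n, v). iexp (t * (1 / l * (\<Sum>i=1..n. \<bar>u - v i\<bar>))) \<partial>?P)"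
    unfolding theta_law_def char_def
    by (subst integral_distr[OF measurable_theta_section]) (auto simp: case_prod_unfold)
  also have "\<dots> = (\<integral>(n, v). (\<Prod>i=1..n. iexp (t / l * \<bar>u - v i\<bar>)) \<partial>?P)"
  proof -
    have "t * (1 / l * (\<Sum>i=1..n. \<bar>u - v i\<bar>)) = (\<Sum>i=1..n. t / l * \<bar>u - v i\<bar>)" for n and v :: "nat \<Rightarrow> real"
      by (simp add: sum_distrib_left)
    then show ?thesis
      by (simp only: of_real_sum sum_distrib_left exp_sum finite_atLeastAtMost)
  qed
  also have "\<dots> = exp (of_real l * ((CLINT x|unif01. iexp (t / l * \<bar>u - x\<bar>)) - 1))"
    by (rule poisson_pgf_single_mark[OF l]; (measurable | simp only: norm_iexp order_refl))
  finally show ?thesis .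
qed

lemma norm_char_theta_law_le: "norm (char (theta_law l u) t) \<le> 1"
proof -
  interpret real_distribution "theta_law l u"
    unfolding theta_law_def
    by (intro prob_space.real_distribution_distr prob_space_theta_source measurable_theta_section)
  show ?thesis by (rule cmod_char_le_1)
qed

lemma measurable_char_theta_law [measurable]:
  "0 < l \<Longrightarrow> (\<lambda>u. char (theta_law l u) t) \<in> borel_measurable borel"
proof -
  assume "0 < l"
  have "(\<lambda>u. CLINT x|unif01. iexp (t / l * \<bar>u - x\<bar>)) \<in> borel_measurable borel"
    by (rule unif01.borel_measurable_lebesgue_integral) (simp add: case_prod_unfold)
  then show ?thesis unfolding char_theta_law[OF \<open>0 < l\<close>] by measurable
qed

lemma level_exponent_glue:
  assumes U: "0 < U" "U < 1" and ab: "unit_valued a" "unit_valued b"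
    and sp: "a \<in> space tree_space" "b \<in> space tree_space"
  shows "level_exponent (Suc (Suc k)) s (glue U a b) =
    of_real U * level_exponent (Suc k) (s * U) a + of_real (1 - U) * level_exponent (Suc k) (s * (1 - U)) b"
proof -
  have sp_glue: "glue U a b \<in> space tree_space"
    by (auto simp: space_PiM glue_def)
  note [measurable] = measurable_gap_section[OF sp(1)] measurable_gap_section[OF sp(2)]
    measurable_gap_section[OF sp_glue]
  have "(CLINT x|unif01. iexp (s * gap (Suc (Suc k)) (glue U a b) x)) =
      U *\<^sub>R (CLINT x|unif01. iexp (s * gap (Suc (Suc k)) (glue U a b) (U * x))) +
      (1 - U) *\<^sub>R (CLINT x|unif01. iexp (s * gap (Suc (Suc k)) (glue U a b) (U + (1 - U) * x)))"
    by (rule integral_unif01_split[OF U, where B=1]; (measurable | simp only: norm_iexp order_refl))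
  also have "(CLINT x|unif01. iexp (s * gap (Suc (Suc k)) (glue U a b) (U * x))) =
      (CLINT x|unif01. iexp (s * U * gap (Suc k) a x))"
  proof (rule integral_cong_AE)
    show "AE x in unif01. iexp (s * gap (Suc (Suc k)) (glue U a b) (U * x)) = iexp (s * U * gap (Suc k) a x)"
      using AE_unif01 by eventually_elim (use U ab in \<open>simp add: gap_glue_left mult.assoc\<close>)
  qed (simp_all, measurable)
  also have "(CLINT x|unif01. iexp (s * gap (Suc (Suc k)) (glue U a b) (U + (1 - U) * x))) =
      (CLINT x|unif01. iexp (s * (1 - U) * gap (Suc k) b x))"
  proof (rule integral_cong_AE)
    show "AE x in unif01. iexp (s * gap (Suc (Suc k)) (glue U a b) (U + (1 - U) * x)) =
        iexp (s * (1 - U) * gap (Suc k) b x)"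
      using AE_unif01 by eventually_elim (use U ab in \<open>simp add: gap_glue_right mult.assoc\<close>)
  qed (simp_all, measurable)
  finally show ?thesis
    by (simp add: level_exponent_def scaleR_conv_of_real algebra_simps)
qed

lemma level_exponent_root:
  assumes sp: "u \<in> space tree_space"
  shows "level_exponent 1 s u = (CLINT x|unif01. iexp (s * \<bar>u (0, 1) - x\<bar>)) - 1"
proof -
  note [measurable] = measurable_gap_section[OF sp]
  have "(CLINT x|unif01. iexp (s * gap 1 u x)) = (CLINT x|unif01. iexp (s * \<bar>u (0, 1) - x\<bar>))"
  proof (rule integral_cong_AE)
    show "AE x in unif01. iexp (s * gap 1 u x) = iexp (s * \<bar>u (0, 1) - x\<bar>)"
      using AE_unif01 by eventually_elim (simp add: gap_1 abs_minus_commute)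
  qed (simp_all, measurable)
  then show ?thesis by (simp add: level_exponent_def)
qed

text \<open>The intensities \<open>l * U\<close> and \<open>l * (1 - U)\<close> come from the additivity of the exponents, the arguments \<open>U\<^sup>2 * t\<close> and
\<open>(1 - U)\<^sup>2 * t\<close> from keeping the quotient of argument and intensity equal to \<open>(t / l) * U\<close> and
\<open>(t / l) * (1 - U)\<close>, respectively. This is how the coefficients \<open>U\<^sup>2\<close> and \<open>(1 - U)\<^sup>2\<close> of the distributional
identity arise.\<close>

lemma tree_char_glue:
  assumes l: "0 < l" and U: "0 < U" "U < 1" and ab: "unit_valued a" "unit_valued b"
    and sp: "a \<in> space tree_space" "b \<in> space tree_space"
  shows "tree_char (Suc K) l t (glue U a b) =
    char (theta_law l U) t *
      (tree_char K (l * U) (U\<^sup>2 * t) a * tree_char K (l * (1 - U)) ((1 - U)\<^sup>2 * t) b)"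
proof -
  have sp_glue: "glue U a b \<in> space tree_space"
    by (auto simp: space_PiM glue_def)
  \<comment> \<open>The quotients of argument and intensity in the two subtrees.\<close>
  have s: "U\<^sup>2 * t / (l * U) = t / l * U" "(1 - U)\<^sup>2 * t / (l * (1 - U)) = t / l * (1 - U)"
    using U l by (simp_all add: power2_eq_square)
  have "(\<Sum>k<Suc K. level_exponent (Suc k) (t / l) (glue U a b)) =
      level_exponent 1 (t / l) (glue U a b) + (\<Sum>k<K. level_exponent (Suc (Suc k)) (t / l) (glue U a b))"
    by (subst sum.lessThan_Suc_shift) (simp add: One_nat_def)
  also have "\<dots> = (CLINT x|unif01. iexp (t / l * \<bar>U - x\<bar>)) - 1 +
      (\<Sum>k<K. of_real U * level_exponent (Suc k) (t / l * U) a + of_real (1 - U) * level_exponent (Suc k) (t / l * (1 - U)) b)"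
    by (simp only: level_exponent_root[OF sp_glue] glue_root level_exponent_glue[OF U ab sp])
  finally have "of_real l * (\<Sum>k<Suc K. level_exponent (Suc k) (t / l) (glue U a b)) =
      of_real l * ((CLINT x|unif01. iexp (t / l * \<bar>U - x\<bar>)) - 1) +
      (of_real (l * U) * (\<Sum>k<K. level_exponent (Suc k) (t / l * U) a) +
       of_real (l * (1 - U)) * (\<Sum>k<K. level_exponent (Suc k) (t / l * (1 - U)) b))"
    by (simp only: sum.distrib sum_distrib_left[symmetric] distrib_left of_real_mult mult.assoc)
  then show ?thesis
    unfolding tree_char_def s char_theta_law[OF l] by (simp only: exp_add)
qed

text \<open>Averaging the recursion over the independent root, left and right subtree. The indicator discards the null set of
degenerate splits, at which the intensity of a subtree would vanish.\<close>

lemma char_upto_Suc: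
  assumes l: "0 < l"
  shows "char_upto (Suc K) l t =
    (CLINT U|unif01. indicator {0<..<1} U *\<^sub>R (char (theta_law l U) t *
      (char_upto K (l * U) (U\<^sup>2 * t) * char_upto K (l * (1 - U)) ((1 - U)\<^sup>2 * t))))"
proof -
  note [measurable] = measurable_char_theta_law[OF l]
  have "char_upto (Suc K) l t =
      (\<integral>U. (\<integral>a. (\<integral>b. tree_char (Suc K) l t (glue U a b) \<partial>tree_space) \<partial>tree_space) \<partial>unif01)"
    unfolding char_upto_def
    by (rule integral_tree_split) (use l in \<open>auto intro: norm_tree_char_le\<close>)
  also have "\<dots> = (CLINT U|unif01. indicator {0<..<1} U *\<^sub>R (char (theta_law l U) t *
      (char_upto K (l * U) (U\<^sup>2 * t) * char_upto K (l * (1 - U)) ((1 - U)\<^sup>2 * t))))"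
  proof (rule integral_cong_AE)
    have good: "AE a in tree_space. unit_valued a \<and> a \<in> space tree_space"
      using AE_tree_unit_valued AE_space by eventually_elim auto
    show "AE U in unif01. (\<integral>a. (\<integral>b. tree_char (Suc K) l t (glue U a b) \<partial>tree_space) \<partial>tree_space) =
        indicator {0<..<1} U *\<^sub>R (char (theta_law l U) t *
      (char_upto K (l * U) (U\<^sup>2 * t) * char_upto K (l * (1 - U)) ((1 - U)\<^sup>2 * t)))"
      using AE_unif01
    proof eventually_elim
      fix U :: real assume U: "0 < U \<and> U < 1"
      let ?A = "tree_char K (l * U) (U\<^sup>2 * t)" and ?B = "tree_char K (l * (1 - U)) ((1 - U)\<^sup>2 * t)"
      have "(\<integral>a. (\<integral>b. tree_char (Suc K) l t (glue U a b) \<partial>tree_space) \<partial>tree_space) =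
          (\<integral>a. (\<integral>b. char (theta_law l U) t * (?A a * ?B b) \<partial>tree_space) \<partial>tree_space)"
      proof (rule integral_cong_AE)
        show "AE a in tree_space. (\<integral>b. tree_char (Suc K) l t (glue U a b) \<partial>tree_space) =
            (\<integral>b. char (theta_law l U) t * (?A a * ?B b) \<partial>tree_space)"
          using good
        proof eventually_elim
          case (elim a)
          show ?case
          proof (rule integral_cong_AE)
            show "AE b in tree_space. tree_char (Suc K) l t (glue U a b) =
                char (theta_law l U) t * (?A a * ?B b)"
              using good by eventually_elim (use l U elim in \<open>auto intro!: tree_char_glue\<close>)
            show "(\<lambda>b. tree_char (Suc K) l t (glue U a b)) \<in> borel_measurable tree_space"
              using elim by (intro measurable_tree_char measurable_glue) auto
          qed measurable
        qed
        show "(\<lambda>a. \<integral>b. tree_char (Suc K) l t (glue U a b) \<partial>tree_space) \<in> borel_measurable tree_space"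
          by (rule tree.borel_measurable_lebesgue_integral)
            (unfold case_prod_unfold, intro measurable_tree_char measurable_glue, measurable)
        show "(\<lambda>a. \<integral>b. char (theta_law l U) t * (?A a * ?B b) \<partial>tree_space) \<in> borel_measurable tree_space"
          by (rule tree.borel_measurable_lebesgue_integral) measurable
      qed
      also have "\<dots> = char (theta_law l U) t * (char_upto K (l * U) (U\<^sup>2 * t) *
          char_upto K (l * (1 - U)) ((1 - U)\<^sup>2 * t))"
        by (simp add: char_upto_def)
      finally show "(\<integral>a. (\<integral>b. tree_char (Suc K) l t (glue U a b) \<partial>tree_space) \<partial>tree_space) =
        indicator {0<..<1} U *\<^sub>R (char (theta_law l U) t *
          (char_upto K (l * U) (U\<^sup>2 * t) * char_upto K (l * (1 - U)) ((1 - U)\<^sup>2 * t)))"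
        using U by simp
    qed
    show "(\<lambda>U. \<integral>a. (\<integral>b. tree_char (Suc K) l t (glue U a b) \<partial>tree_space) \<partial>tree_space) \<in> borel_measurable unif01"
      by (intro tree.borel_measurable_lebesgue_integral, unfold case_prod_unfold,
          rule tree.borel_measurable_lebesgue_integral, unfold case_prod_unfold,
          intro measurable_tree_char measurable_glue) measurable
  qed measurable
  finally show ?thesis .
qed

lemma char_nu_fixed_point:
  assumes l: "0 < l"
  shows "char (nu l) t =
    (CLINT U|unif01. indicator {0<..<1} U *\<^sub>R (char (theta_law l U) t *
      (char (nu (l * U)) (U\<^sup>2 * t) * char (nu (l * (1 - U))) ((1 - U)\<^sup>2 * t))))"
proof -
  note [measurable] = measurable_char_theta_law[OF l]
  let ?f = "\<lambda>K U. indicator {0<..<1} U *\<^sub>R (char (theta_law l U) t *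
      (char_upto K (l * U) (U\<^sup>2 * t) * char_upto K (l * (1 - U)) ((1 - U)\<^sup>2 * t)))"
  let ?g = "\<lambda>U. indicator {0<..<1} U *\<^sub>R (char (theta_law l U) t *
      (char (nu (l * U)) (U\<^sup>2 * t) * char (nu (l * (1 - U))) ((1 - U)\<^sup>2 * t)))"
  have lim: "(\<lambda>K. ?f K U) \<longlonglongrightarrow> ?g U" for U
  proof (cases "U \<in> {0<..<1}")
    case True
    with l show ?thesis by (auto intro!: tendsto_intros char_upto_tendsto)
  qed simp
  have [measurable]: "?f K \<in> borel_measurable borel" for K by measurable
  have "(\<lambda>K. integral\<^sup>L unif01 (?f K)) \<longlonglongrightarrow> integral\<^sup>L unif01 ?g"
  proof (rule integral_dominated_convergence[where w="\<lambda>_. 1"])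
    show "?g \<in> borel_measurable unif01"
      by (rule borel_measurable_LIMSEQ_metric[OF _ lim]) simp
    show "AE U in unif01. norm (?f K U) \<le> 1" for K
    proof (rule AE_I2)
      fix U :: real
      have "norm (char (theta_law l U) t * (char_upto K (l * U) (U\<^sup>2 * t) * char_upto K (l * (1 - U)) ((1 - U)\<^sup>2 * t)))
          \<le> 1 * (1 * 1)" if "U \<in> {0<..<1}"
        unfolding norm_mult using that l
        by (intro mult_mono norm_char_theta_law_le norm_char_upto_le) auto
      then show "norm (?f K U) \<le> 1" by (cases "U \<in> {0<..<1}") auto
    qed
  qed (auto intro!: AE_I2 lim)
  moreover have "(\<lambda>K. integral\<^sup>L unif01 (?f K)) \<longlonglongrightarrow> char (nu l) t"
    unfolding char_upto_Suc[OF l, symmetric] by (rule LIMSEQ_Suc) (rule char_upto_tendsto[OF l])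
  ultimately show ?thesis by (rule LIMSEQ_unique[rotated])
qed

section \<open>The law of the right-hand side\<close>

text \<open>Families of laws are treated as Markov kernels, that is, as measurable maps from the positive reals to
probability measures. A measurable process provides such a kernel, and the identity depends on nothing else.\<close>

abbreviation pos_reals :: "real measure" where
  "pos_reals \<equiv> restrict_space borel {0<..}"

abbreviation unif01_open :: "real measure" where
  "unif01_open \<equiv> restrict_space unif01 {0<..<1}"

lemma prob_space_unif01_open: "prob_space unif01_open"
proof (rule prob_spaceI)
  have "emeasure unif01 {0<..<1} = emeasure unif01 UNIV"
    by (rule emeasure_eq_AE) (use AE_unif01 in \<open>auto elim: eventually_mono\<close>)
  then show "emeasure unif01_open (space unif01_open) = 1"
    using unif01.emeasure_space_1 by (simp add: emeasure_restrict_space space_restrict_space)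
qed

lemma space_unif01_open: "space unif01_open = {0<..<1}"
  by (simp add: space_restrict_space)

lemma measurable_unif01_open_id [measurable]: "(\<lambda>x. x) \<in> borel_measurable unif01_open"
  by (rule measurable_restrict_space1) simp

lemma prob_algebraD:
  assumes "M \<in> space (prob_algebra borel)"
  shows "prob_space M" "sets M = sets (borel :: real measure)" "real_distribution M"
  using assms
  by (auto simp: space_prob_algebra real_distribution_def real_distribution_axioms_def
      dest: sets_eq_imp_space_eq)

lemma pos_kernelD:
  assumes "\<kappa> \<in> pos_reals \<rightarrow>\<^sub>M prob_algebra borel" "0 < l"
  shows "prob_space (\<kappa> l)" "sets (\<kappa> l) = sets (borel :: real measure)" "real_distribution (\<kappa> l)"
  using prob_algebraD[OF measurable_space[OF assms(1)], of l] assms(2)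
  by (simp_all add: space_restrict_space)

lemma process_kernel:
  assumes "process_with_laws P Y \<mu>"
  shows "(\<lambda>l. distr P borel (Y l)) \<in> pos_reals \<rightarrow>\<^sub>M prob_algebra borel"
proof (rule measurable_distr_prob_space2)
  have P: "prob_space P"
    and Y: "(\<lambda>(l, w). Y l w) \<in> pos_reals \<Otimes>\<^sub>M P \<rightarrow>\<^sub>M restrict_space borel {0..}"
    using assms by (auto simp: process_with_laws_def)
  show "(\<lambda>l. P) \<in> pos_reals \<rightarrow>\<^sub>M prob_algebra P"
    using P by (intro measurable_const) (simp add: space_prob_algebra)
  show "(\<lambda>(l, w). Y l w) \<in> borel_measurable (pos_reals \<Otimes>\<^sub>M P)"
    using Y by (simp add: measurable_restrict_space2_iff)
qed

definition rhs_kernel :: "(real \<Rightarrow> real measure) \<Rightarrow> real \<Rightarrow> real \<Rightarrow> real measure" where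
  "rhs_kernel \<kappa> l u =
     distr (\<kappa> (l * u) \<Otimes>\<^sub>M (\<kappa> (l * (1 - u)) \<Otimes>\<^sub>M theta_law l u)) borel
       (\<lambda>(a, b, t). u\<^sup>2 * a + (1 - u)\<^sup>2 * b + t)"

lemma theta_law_kernel: "theta_law l \<in> borel \<rightarrow>\<^sub>M prob_algebra borel"
proof -
  have "(\<lambda>u. distr (measure_pmf (poisson_pmf l) \<Otimes>\<^sub>M (\<Pi>\<^sub>M i\<in>{1::nat..}. unif01)) borel
       (\<lambda>(n, v). 1 / l * (\<Sum>i = 1..n. \<bar>u - v i\<bar>))) \<in> borel \<rightarrow>\<^sub>M prob_algebra borel"
  proof (rule measurable_distr_prob_space2)
    show "(\<lambda>u::real. measure_pmf (poisson_pmf l) \<Otimes>\<^sub>M (\<Pi>\<^sub>M i\<in>{1::nat..}. unif01)) \<in>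
        borel \<rightarrow>\<^sub>M prob_algebra (measure_pmf (poisson_pmf l) \<Otimes>\<^sub>M (\<Pi>\<^sub>M i\<in>{1::nat..}. unif01))"
      using prob_space_theta_source by (intro measurable_const) (simp add: space_prob_algebra)
    show "(\<lambda>(u, n, v). 1 / l * (\<Sum>i = 1..n. \<bar>u - v i\<bar>)) \<in>
        borel_measurable (borel \<Otimes>\<^sub>M (measure_pmf (poisson_pmf l) \<Otimes>\<^sub>M (\<Pi>\<^sub>M i\<in>{1::nat..}. unif01)))"
      using measurable_theta_variable[of l] by (simp add: case_prod_unfold)
  qed
  then show ?thesis by (simp add: theta_law_def[abs_def])
qed

lemma rhs_kernel_measurable:
  assumes \<kappa>: "\<kappa> \<in> pos_reals \<rightarrow>\<^sub>M prob_algebra borel" and l: "0 < l"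
  shows "rhs_kernel \<kappa> l \<in> unif01_open \<rightarrow>\<^sub>M prob_algebra borel"
  unfolding rhs_kernel_def
proof (rule measurable_distr_prob_space2)
  have "(\<lambda>u. l * u) \<in> unif01_open \<rightarrow>\<^sub>M pos_reals" "(\<lambda>u. l * (1 - u)) \<in> unif01_open \<rightarrow>\<^sub>M pos_reals"
    using l by (auto simp: measurable_restrict_space2_iff space_restrict_space)
  then show "(\<lambda>u. \<kappa> (l * u) \<Otimes>\<^sub>M (\<kappa> (l * (1 - u)) \<Otimes>\<^sub>M theta_law l u)) \<in>
      unif01_open \<rightarrow>\<^sub>M prob_algebra (borel \<Otimes>\<^sub>M (borel \<Otimes>\<^sub>M borel))"
    by (intro measurable_pair_prob measurable_compose[OF _ \<kappa>]
        measurable_compose[OF measurable_unif01_open_id theta_law_kernel])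
  have [measurable]: "(\<lambda>q. fst q) \<in> borel_measurable (unif01_open \<Otimes>\<^sub>M (borel \<Otimes>\<^sub>M (borel \<Otimes>\<^sub>M borel)))"
    by (rule measurable_compose[OF measurable_fst measurable_unif01_open_id])
  show "(\<lambda>(u, a, b, t). u\<^sup>2 * a + (1 - u)\<^sup>2 * b + t) \<in>
      borel_measurable (unif01_open \<Otimes>\<^sub>M (borel \<Otimes>\<^sub>M (borel \<Otimes>\<^sub>M borel)))"
    unfolding case_prod_unfold by measurable
qed

lemma char_distr_affine_combination:
  assumes "real_distribution A" "real_distribution B" "real_distribution T"
  shows "char (distr (A \<Otimes>\<^sub>M (B \<Otimes>\<^sub>M T)) borel (\<lambda>(a, b, t). p * a + q * b + t)) s =
    char T s * (char A (p * s) * char B (q * s))"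
proof -
  interpret A: real_distribution A by fact
  interpret B: real_distribution B by fact
  interpret T: real_distribution T by fact
  interpret BT: pair_prob_space B T ..
  interpret ABT: pair_prob_space A "B \<Otimes>\<^sub>M T" ..
  have "char (distr (A \<Otimes>\<^sub>M (B \<Otimes>\<^sub>M T)) borel (\<lambda>(a, b, t). p * a + q * b + t)) s =
      (\<integral>w. iexp (s * (p * fst w + q * fst (snd w) + snd (snd w))) \<partial>(A \<Otimes>\<^sub>M (B \<Otimes>\<^sub>M T)))"
    unfolding char_def by (subst integral_distr) (auto simp: case_prod_unfold)
  also have "\<dots> = (\<integral>w. iexp (p * s * fst w) * (iexp (q * s * fst (snd w)) * iexp (s * snd (snd w))) \<partial>(A \<Otimes>\<^sub>M (B \<Otimes>\<^sub>M T)))"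
    by (intro Bochner_Integration.integral_cong refl) (simp add: exp_add[symmetric] algebra_simps)
  also have "\<dots> = (\<integral>a. (\<integral>w. iexp (p * s * a) * (iexp (q * s * fst w) * iexp (s * snd w)) \<partial>(B \<Otimes>\<^sub>M T)) \<partial>A)"
    by (subst ABT.integral_fst'[symmetric])
      (auto intro!: ABT.P.integrable_const_bound[where B=1] simp: norm_mult)
  also have "\<dots> = (\<integral>a. iexp (p * s * a) * (\<integral>w. iexp (q * s * fst w) * iexp (s * snd w) \<partial>(B \<Otimes>\<^sub>M T)) \<partial>A)"
    by simp
  also have "(\<integral>w. iexp (q * s * fst w) * iexp (s * snd w) \<partial>(B \<Otimes>\<^sub>M T)) =
      (\<integral>b. (\<integral>t. iexp (q * s * b) * iexp (s * t) \<partial>T) \<partial>B)"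
    by (subst BT.integral_fst'[symmetric])
      (auto intro!: BT.P.integrable_const_bound[where B=1] simp: norm_mult)
  finally show ?thesis by (simp add: char_def mult.commute mult.left_commute)
qed

lemma char_rhs_kernel:
  assumes \<kappa>: "\<kappa> \<in> pos_reals \<rightarrow>\<^sub>M prob_algebra borel" and l: "0 < l" and u: "0 < u" "u < 1"
  shows "char (rhs_kernel \<kappa> l u) t =
    char (theta_law l u) t * (char (\<kappa> (l * u)) (u\<^sup>2 * t) * char (\<kappa> (l * (1 - u))) ((1 - u)\<^sup>2 * t))"
  unfolding rhs_kernel_def
  by (rule char_distr_affine_combination)
    (use l u in \<open>auto intro!: pos_kernelD[OF \<kappa>] prob_algebraD(3)[OF measurable_space[OF theta_law_kernel]]\<close>)

text \<open>Integration against a mixture is integration against the components, followed by mixing; real and imaginary parts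
are treated separately.\<close>

lemma char_bind:
  assumes M: "prob_space M" and N: "N \<in> M \<rightarrow>\<^sub>M prob_algebra borel"
  shows "real_distribution (M \<bind> N)" "char (M \<bind> N) t = (\<integral>x. char (N x) t \<partial>M)"
    "integrable M (\<lambda>x. char (N x) t)"
proof -
  interpret M: prob_space M by fact
  have N': "N \<in> M \<rightarrow>\<^sub>M subprob_algebra borel" by (rule measurable_prob_algebraD[OF N])
  have dist: "real_distribution (N x)" if "x \<in> space M" for x
    by (rule prob_algebraD(3)[OF measurable_space[OF N that]])
  have Nprob: "prob_space (N x)" if "x \<in> space M" for x
    by (rule prob_algebraD(1)[OF measurable_space[OF N that]])
  have "sets (M \<bind> N) = sets borel"
    using M.not_empty prob_algebraD(2)[OF measurable_space[OF N]] by (intro sets_bind) auto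
  moreover have "prob_space (M \<bind> N)"
    by (rule M.prob_space_bind[OF _ N']) (auto intro: Nprob)
  ultimately show bind: "real_distribution (M \<bind> N)"
    by (auto simp: real_distribution_def real_distribution_axioms_def dest: sets_eq_imp_space_eq)
  interpret MN: real_distribution "M \<bind> N" by fact
  have meas: "(\<lambda>x. char (N x) t) \<in> borel_measurable M"
    unfolding char_def by (rule measurable_compose[OF N' integral_measurable_subprob_algebra]) measurable
  show int: "integrable M (\<lambda>x. char (N x) t)"
    by (rule M.integrable_const_bound[where B=1])
      (auto intro!: AE_I2 real_distribution.cmod_char_le_1 dist meas)
  have bnd: "AE x in M. emeasure (N x) (space (N x)) \<le> ennreal 1"
    using Nprob by (auto intro!: AE_I2 simp: prob_space.emeasure_space_1)
  have iexp_int: "integrable K (\<lambda>x. iexp (t * x))" if "real_distribution K" for K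
  proof -
    interpret K: real_distribution K by fact
    show ?thesis by (rule K.integrable_const_bound[where B=1]) auto
  qed
  have Re: "Re (char K t) = (\<integral>x. Re (iexp (t * x)) \<partial>K)"
    and Im: "Im (char K t) = (\<integral>x. Im (iexp (t * x)) \<partial>K)" if "real_distribution K" for K
    unfolding char_def by (simp_all only: integral_Re[OF iexp_int[OF that]] integral_Im[OF iexp_int[OF that]])
  have bounds: "\<bar>Re (iexp (t * x))\<bar> \<le> 1" "\<bar>Im (iexp (t * x))\<bar> \<le> 1" for x
    using abs_Re_le_cmod[of "iexp (t * x)"] abs_Im_le_cmod[of "iexp (t * x)"] by simp_all
  show "char (M \<bind> N) t = (\<integral>x. char (N x) t \<partial>M)"
  proof (rule complex_eqI)
    have "Re (char (M \<bind> N) t) = (\<integral>x. (\<integral>y. Re (iexp (t * y)) \<partial>N x) \<partial>M)"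
      unfolding Re[OF bind]
      by (rule integral_bind[OF _ bounds(1) N' M.finite_measure_axioms bnd]) measurable
    also have "\<dots> = (\<integral>x. Re (char (N x) t) \<partial>M)"
      by (intro Bochner_Integration.integral_cong refl) (simp add: Re[OF dist])
    finally show "Re (char (M \<bind> N) t) = Re (\<integral>x. char (N x) t \<partial>M)"
      by (simp add: integral_Re[OF int])
    have "Im (char (M \<bind> N) t) = (\<integral>x. (\<integral>y. Im (iexp (t * y)) \<partial>N x) \<partial>M)"
      unfolding Im[OF bind]
      by (rule integral_bind[OF _ bounds(2) N' M.finite_measure_axioms bnd]) measurable
    also have "\<dots> = (\<integral>x. Im (char (N x) t) \<partial>M)"
      by (intro Bochner_Integration.integral_cong refl) (simp add: Im[OF dist])
    finally show "Im (char (M \<bind> N) t) = Im (\<integral>x. char (N x) t \<partial>M)"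
      by (simp add: integral_Im[OF int])
  qed
qed

lemma char_rhs_law:
  assumes \<kappa>: "\<kappa> \<in> pos_reals \<rightarrow>\<^sub>M prob_algebra borel" and l: "0 < l"
  shows "real_distribution (rhs_law \<kappa> l)"
    and "char (rhs_law \<kappa> l) t = (CLINT u|unif01_open. char (theta_law l u) t *
      (char (\<kappa> (l * u)) (u\<^sup>2 * t) * char (\<kappa> (l * (1 - u))) ((1 - u)\<^sup>2 * t)))"
    and "integrable unif01_open (\<lambda>u. char (theta_law l u) t *
      (char (\<kappa> (l * u)) (u\<^sup>2 * t) * char (\<kappa> (l * (1 - u))) ((1 - u)\<^sup>2 * t)))"
proof -
  have rhs: "rhs_law \<kappa> l = unif01_open \<bind> rhs_kernel \<kappa> l"
    by (simp add: rhs_law_def rhs_kernel_def[abs_def])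
  note b = char_bind[OF prob_space_unif01_open rhs_kernel_measurable[OF \<kappa> l]]
  have ck: "char (rhs_kernel \<kappa> l u) t = char (theta_law l u) t *
      (char (\<kappa> (l * u)) (u\<^sup>2 * t) * char (\<kappa> (l * (1 - u))) ((1 - u)\<^sup>2 * t))"
    if "u \<in> space unif01_open" for u
    by (rule char_rhs_kernel[OF \<kappa> l]) (use that in \<open>auto simp: space_unif01_open\<close>)
  show "real_distribution (rhs_law \<kappa> l)" unfolding rhs by (rule b(1))
  show "char (rhs_law \<kappa> l) t = (CLINT u|unif01_open. char (theta_law l u) t *
      (char (\<kappa> (l * u)) (u\<^sup>2 * t) * char (\<kappa> (l * (1 - u))) ((1 - u)\<^sup>2 * t)))"
    unfolding rhs b(2) by (intro Bochner_Integration.integral_cong refl ck)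
  show "integrable unif01_open (\<lambda>u. char (theta_law l u) t *
      (char (\<kappa> (l * u)) (u\<^sup>2 * t) * char (\<kappa> (l * (1 - u))) ((1 - u)\<^sup>2 * t)))"
    using b(3)[of t] by (subst (asm) Bochner_Integration.integrable_cong[OF refl ck]) auto
qed

section \<open>Measurability in the intensity, and a process with given laws\<close>

text \<open>It suffices to test cylinder sets, on which the measure is a finite product of Poisson probabilities, each a
power series in the intensity times an exponential.\<close>

lemma poisson_counts_kernel:
  "poisson_counts \<in> pos_reals \<rightarrow>\<^sub>M prob_algebra (\<Pi>\<^sub>M k\<in>{1..}. count_space UNIV)"
proof (rule measurable_prob_algebra_generated[OF sets_PiM Int_stable_prod_algebra])
  show "prod_algebra {1::nat..} (\<lambda>_. count_space (UNIV :: nat set)) \<subseteq> Pow (\<Pi>\<^sub>E i\<in>{1..}. space (count_space UNIV))"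
    by (rule prod_algebra_sets_into_space)
  show "prob_space (poisson_counts l)" for l by (rule counts.prob_space_axioms)
  show "sets (poisson_counts l) = sets (\<Pi>\<^sub>M k\<in>{1..}. count_space UNIV)" for l
    by (rule sets_PiM_cong) auto
  fix A assume "A \<in> prod_algebra {1::nat..} (\<lambda>_. count_space (UNIV :: nat set))"
  then obtain J E where A: "A = prod_emb {1..} (\<lambda>_. count_space (UNIV :: nat set)) J (\<Pi>\<^sub>E j\<in>J. E j)"
    and J: "finite J" "J \<subseteq> {1..}"
    by (elim prod_algebraE) auto
  have "emeasure (poisson_counts l) A = (\<Prod>j\<in>J. emeasure (measure_pmf (poisson_pmf l)) (E j))" for l
  proof -
    have "A = prod_emb {1..} (\<lambda>_. measure_pmf (poisson_pmf l)) J (\<Pi>\<^sub>E j\<in>J. E j)"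
      by (simp add: A prod_emb_def)
    then show ?thesis
      using J by (simp add: emeasure_PiM_emb prob_space_measure_pmf)
  qed
  moreover have "(\<lambda>l. emeasure (measure_pmf (poisson_pmf l)) B) \<in> borel_measurable pos_reals" for B
  proof -
    have "emeasure (measure_pmf (poisson_pmf l)) B =
        (\<Sum>n. ennreal (l ^ n / fact n * exp (- l)) * indicator B n)" if "0 < l" for l
      using that unfolding measure_pmf_eq_density
      by (subst emeasure_density) (auto simp: nn_integral_count_space_nat)
    moreover have "(\<lambda>l. \<Sum>n. ennreal (l ^ n / fact n * exp (- l)) * indicator B n) \<in> borel_measurable pos_reals"
      by (rule measurable_restrict_space1) measurable
    ultimately show ?thesis
      by (subst measurable_cong) (auto simp: space_restrict_space)
  qed
  ultimately show "(\<lambda>l. emeasure (poisson_counts l) A) \<in> borel_measurable pos_reals"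
    by simp
qed

text \<open>The function \<open>l * X l\<close> does not depend on \<open>l\<close>, and the intensity enters the sample space only through the
counts.\<close>

lemma nu_kernel: "nu \<in> pos_reals \<rightarrow>\<^sub>M prob_algebra borel"
  unfolding nu_def[abs_def]
proof (rule measurable_distr_prob_space2)
  let ?S = "(\<Pi>\<^sub>M k\<in>{1::nat..}. count_space (UNIV :: nat set)) \<Otimes>\<^sub>M (mark_space \<Otimes>\<^sub>M tree_space)"
  show "(\<lambda>l. sample_space l) \<in> pos_reals \<rightarrow>\<^sub>M prob_algebra ?S"
    unfolding sample_space_def[abs_def]
  proof (rule measurable_pair_prob[OF poisson_counts_kernel measurable_const])
    show "mark_space \<Otimes>\<^sub>M tree_space \<in> space (prob_algebra (mark_space \<Otimes>\<^sub>M tree_space))"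
      by (auto simp: space_prob_algebra intro!: prob_space_pair marks.prob_space_axioms tree.prob_space_axioms)
  qed
  have S: "sets (sample_space 1) = sets ?S"
    unfolding sample_space_def by (intro sets_pair_measure_cong sets_PiM_cong) auto
  have X1: "X 1 \<in> borel_measurable ?S"
    using measurable_X[of 1 1] unfolding measurable_cong_sets[OF S refl] .
  have "(\<lambda>l. l) \<in> borel_measurable pos_reals" by (rule measurable_restrict_space1) simp
  then have fst: "fst \<in> borel_measurable (pos_reals \<Otimes>\<^sub>M ?S)"
    by (rule measurable_compose[OF measurable_fst])
  have "X l w = 1 / l * X 1 w" for l w
    by (simp add: X_def case_prod_unfold)
  then have eq: "(\<lambda>(l, w). X l w) = (\<lambda>q. 1 / fst q * X 1 (snd q))"
    unfolding case_prod_unfold by (rule ext)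
  show "(\<lambda>(l, w). X l w) \<in> borel_measurable (pos_reals \<Otimes>\<^sub>M ?S)"
    unfolding eq
    by (intro borel_measurable_times borel_measurable_divide borel_measurable_const fst
        measurable_compose[OF measurable_snd X1])
qed

text \<open>The inverse distribution functions, all applied to the same uniform variable. Since \<open>Inf {x. w \<le> F x} \<le> y\<close> is
equivalent to \<open>w \<le> F y\<close>, joint measurability reduces to the measurability in \<open>l\<close> of the distribution function at
a fixed point.\<close>

lemma quantile_process:
  assumes \<kappa>: "\<kappa> \<in> pos_reals \<rightarrow>\<^sub>M prob_algebra borel"
    and nonneg: "\<And>l. 0 < l \<Longrightarrow> emeasure (\<kappa> l) {..<0} = 0"
  shows "process_with_laws (restrict_space lborel {0<..<1})
    (\<lambda>l w. Inf {x. w \<le> cdf (\<kappa> l) x}) \<kappa>"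
  unfolding process_with_laws_def
proof (intro conjI allI impI)
  let ?P = "restrict_space lborel {0<..<1 :: real}"
  let ?Y = "\<lambda>l w. Inf {x. w \<le> cdf (\<kappa> l) x}"
  show "prob_space ?P"
    by (auto simp: space_restrict_space emeasure_restrict_space intro!: prob_spaceI)
  have cdf: "cdf_distribution (\<kappa> l)" if "0 < l" for l
    unfolding cdf_distribution_def by (rule pos_kernelD(3)[OF \<kappa> that])
  have Y_le: "?Y l w \<le> x \<longleftrightarrow> w \<le> cdf (\<kappa> l) x" if "0 < l" "0 < w" "w < 1" for l w x
  proof -
    interpret cdf_distribution "\<kappa> l" by (rule cdf) fact
    show ?thesis using pseudoinverse[of w x] that by simp
  qed
  show "\<kappa> l = distr ?P borel (?Y l)" if "0 < l" for l
    using cdf_distribution.distr_I_eq_M[OF cdf[OF that]] by simp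
  show "(\<lambda>(l, w). ?Y l w) \<in> pos_reals \<Otimes>\<^sub>M ?P \<rightarrow>\<^sub>M restrict_space borel {0..}"
  proof (rule measurable_restrict_space2)
    show "(\<lambda>(l, w). ?Y l w) \<in> space (pos_reals \<Otimes>\<^sub>M ?P) \<rightarrow> {0..}"
    proof
      fix q assume "q \<in> space (pos_reals \<Otimes>\<^sub>M ?P)"
      then obtain l w where q: "q = (l, w)" "0 < l" "0 < w" "w < 1"
        by (auto simp: space_pair_measure space_restrict_space)
      \<comment> \<open>A quantile is nonnegative because the distribution function vanishes on the negative axis.\<close>
      have "\<not> ?Y l w \<le> x" if "x < 0" for x
      proof -
        have "emeasure (\<kappa> l) {..x} \<le> emeasure (\<kappa> l) {..<0}"
          using that q pos_kernelD(2)[OF \<kappa>] by (intro emeasure_mono) auto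
        then have "cdf (\<kappa> l) x = 0"
          using nonneg[OF q(2)] by (simp add: cdf_def measure_def)
        then show ?thesis using q by (subst Y_le) auto
      qed
      then have "0 \<le> ?Y l w" by (metis le_less_linear order_refl)
      then show "(case q of (l, w) \<Rightarrow> ?Y l w) \<in> {0..}" by (simp add: q)
    qed
    show "(\<lambda>(l, w). ?Y l w) \<in> borel_measurable (pos_reals \<Otimes>\<^sub>M ?P)"
    proof (rule borel_measurableI_le)
      fix x :: real
      have "(\<lambda>l. measure (\<kappa> l) {..x}) \<in> borel_measurable pos_reals"
        by (rule measurable_compose[OF measurable_prob_algebraD[OF \<kappa>] measurable_measure_subprob_algebra]) simp
      then have [measurable]: "(\<lambda>q. cdf (\<kappa> (fst q)) x) \<in> borel_measurable (pos_reals \<Otimes>\<^sub>M ?P)"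
        unfolding cdf_def by (rule measurable_compose[OF measurable_fst])
      have [measurable]: "(\<lambda>q. snd q) \<in> borel_measurable (pos_reals \<Otimes>\<^sub>M ?P)"
        by (rule measurable_compose[OF measurable_snd]) (rule measurable_restrict_space1, simp)
      have "{q \<in> space (pos_reals \<Otimes>\<^sub>M ?P). (case q of (l, w) \<Rightarrow> ?Y l w) \<le> x} =
          {q \<in> space (pos_reals \<Otimes>\<^sub>M ?P). snd q \<le> cdf (\<kappa> (fst q)) x}"
        by (auto simp: space_pair_measure space_restrict_space Y_le)
      also have "\<dots> \<in> sets (pos_reals \<Otimes>\<^sub>M ?P)" by measurable
      finally show "{q \<in> space (pos_reals \<Otimes>\<^sub>M ?P). (case q of (l, w) \<Rightarrow> ?Y l w) \<le> x} \<in> sets (pos_reals \<Otimes>\<^sub>M ?P)" .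
    qed
  qed
qed

section \<open>The family nu belongs to the class and solves the identity\<close>

lemma nu_nonneg:
  assumes "0 < l"
  shows "emeasure (nu l) {..<0} = 0"
proof -
  have "X l -` {..<0} \<inter> space (sample_space l) = {}"
    using X_nonneg[OF assms] by (auto simp: not_less[symmetric])
  then show ?thesis unfolding nu_def by (subst emeasure_distr) auto
qed

lemma nn_integral_nu_le:
  assumes "0 < l"
  shows "(\<integral>\<^sup>+x. ennreal x \<partial>nu l) \<le> 3"
  unfolding nu_def using nn_integral_X_le[OF assms] by (subst nn_integral_distr) auto

lemma quantile_process_nu:
  obtains P :: "real measure" and Y where "process_with_laws P Y nu"
  using quantile_process[OF nu_kernel nu_nonneg] by blast

text \<open>The means are bounded uniformly in \<open>l\<close>, so every exponent in \<open>(0, 1)\<close> would do.\<close>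

lemma class_M_nu: "class_M TYPE(real) nu"
proof -
  obtain P :: "real measure" and Y where Y: "process_with_laws P Y nu"
    by (rule quantile_process_nu)
  have mean: "(\<integral>\<^sup>+w. ennreal (Y l w) \<partial>P) \<le> 3" if "0 < l" for l
  proof -
    have "Y l \<in> borel_measurable P"
    proof -
      have "(\<lambda>(l, w). Y l w) \<in> borel_measurable (pos_reals \<Otimes>\<^sub>M P)"
        using Y by (simp add: process_with_laws_def measurable_restrict_space2_iff)
      from measurable_Pair2[OF this, of l] that show ?thesis by (simp add: space_restrict_space)
    qed
    moreover have "nu l = distr P borel (Y l)" using Y that by (simp add: process_with_laws_def)
    ultimately have "(\<integral>\<^sup>+w. ennreal (Y l w) \<partial>P) = (\<integral>\<^sup>+x. ennreal x \<partial>nu l)"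
      by (simp add: nn_integral_distr)
    then show ?thesis using nn_integral_nu_le[OF that] by simp
  qed
  have "\<exists>C :: real. \<forall>l\<in>I. ennreal (l powr (1 / 2)) * (\<integral>\<^sup>+w. ennreal (Y l w) \<partial>P) \<le> ennreal C"
    if I: "is_interval I" "bounded I" "I \<subseteq> {0<..}" for I :: "real set"
  proof -
    obtain B where B: "\<And>l. l \<in> I \<Longrightarrow> \<bar>l\<bar> \<le> B"
      using I(2) unfolding bounded_iff by auto
    have "ennreal (l powr (1 / 2)) * (\<integral>\<^sup>+w. ennreal (Y l w) \<partial>P) \<le> ennreal (B powr (1 / 2) * 3)"
      if "l \<in> I" for l
    proof -
      have "0 < l" "l \<le> B" using I(3) B[OF that] that by auto
      then have "ennreal (l powr (1 / 2)) * (\<integral>\<^sup>+w. ennreal (Y l w) \<partial>P) \<le> ennreal (B powr (1 / 2)) * 3"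
        by (intro mult_mono mean ennreal_leI powr_mono2) auto
      also have "\<dots> = ennreal (B powr (1 / 2) * 3)" by (simp add: ennreal_mult)
      finally show ?thesis .
    qed
    then show ?thesis by blast
  qed
  then show ?thesis
    unfolding class_M_def using Y
    by (intro exI[of _ P] exI[of _ Y] conjI exI[of _ "1 / 2 :: real"]) auto
qed

text \<open>Stated for a family that agrees with \<open>nu\<close> at positive parameters only: the laws of a process need not coincide
with \<open>nu\<close> elsewhere.\<close>

lemma rhs_law_eq_nu:
  assumes \<kappa>: "\<kappa> \<in> pos_reals \<rightarrow>\<^sub>M prob_algebra borel" and eq: "\<And>r. 0 < r \<Longrightarrow> \<kappa> r = nu r"
    and l: "0 < l"
  shows "rhs_law \<kappa> l = nu l"
proof (rule Levy_uniqueness)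
  show "real_distribution (rhs_law \<kappa> l)" by (rule char_rhs_law(1)[OF \<kappa> l])
  show "real_distribution (nu l)" by (rule pos_kernelD(3)[OF nu_kernel l])
  show "char (rhs_law \<kappa> l) = char (nu l)"
  proof
    fix t
    have "char (rhs_law \<kappa> l) t = (CLINT u|unif01_open. char (theta_law l u) t *
        (char (nu (l * u)) (u\<^sup>2 * t) * char (nu (l * (1 - u))) ((1 - u)\<^sup>2 * t)))"
      unfolding char_rhs_law(2)[OF \<kappa> l]
      by (intro Bochner_Integration.integral_cong refl) (use l in \<open>simp add: space_unif01_open eq\<close>)
    also have "\<dots> = char (nu l) t"
      by (subst integral_restrict_space) (simp_all add: char_nu_fixed_point[OF l])
    finally show "char (rhs_law \<kappa> l) t = char (nu l) t" .
  qed
qed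

lemma solution_nu: "solution TYPE(real) nu"
proof -
  obtain P :: "real measure" and Y where Y: "process_with_laws P Y nu"
    by (rule quantile_process_nu)
  have eq: "distr P borel (Y r) = nu r" if "0 < r" for r
    using Y that by (simp add: process_with_laws_def)
  have "distr P borel (Y l) = rhs_law (\<lambda>r. distr P borel (Y r)) l" if "0 < l" for l
    using rhs_law_eq_nu[OF process_kernel[OF Y] eq that] eq[OF that] by simp
  then show ?thesis unfolding solution_def using Y by blast
qed

section \<open>Uniqueness by contraction\<close>

lemma norm_char_minus_1_le:
  assumes "real_distribution M" "emeasure M {..<0} = 0" "(\<integral>\<^sup>+x. ennreal x \<partial>M) \<le> ennreal c" "0 \<le> c"
  shows "norm (char M t - 1) \<le> \<bar>t\<bar> * c"
proof -
  interpret real_distribution M by fact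
  have pos: "AE x in M. 0 \<le> x"
    using assms(2) by (intro AE_I[where N="{..<0}"]) auto
  have int: "integrable M (\<lambda>x. x)"
  proof (rule integrableI_bounded)
    have "(\<integral>\<^sup>+x. ennreal (norm x) \<partial>M) = (\<integral>\<^sup>+x. ennreal x \<partial>M)"
      by (rule nn_integral_cong_AE, use pos in eventually_elim) simp
    also have "\<dots> < \<infinity>" using assms(3) by (simp add: le_less_trans)
    finally show "(\<integral>\<^sup>+x. ennreal (norm x) \<partial>M) < \<infinity>" .
  qed simp
  have iint: "integrable M (\<lambda>x. iexp (t * x))"
    by (rule integrable_const_bound[where B=1]) auto
  have mean: "(\<integral>x. x \<partial>M) \<le> c"
  proof -
    have "ennreal (\<integral>x. x \<partial>M) = (\<integral>\<^sup>+x. ennreal x \<partial>M)"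
      by (rule nn_integral_eq_integral[symmetric, OF int pos])
    then have "ennreal (\<integral>x. x \<partial>M) \<le> ennreal c" using assms(3) by simp
    then show ?thesis using assms(4) by (simp only: ennreal_le_iff)
  qed
  have "char M t - 1 = (\<integral>x. iexp (t * x) - 1 \<partial>M)"
    unfolding char_def using iint prob_space by simp
  also have "norm \<dots> \<le> (\<integral>x. norm (iexp (t * x) - 1) \<partial>M)" by (rule integral_norm_bound)
  also have "\<dots> \<le> (\<integral>x. \<bar>t\<bar> * x \<partial>M)"
  proof (rule integral_mono_AE)
    show "integrable M (\<lambda>x. norm (iexp (t * x) - 1))"
      by (intro integrable_norm Bochner_Integration.integrable_diff iint) simp
    show "integrable M (\<lambda>x. \<bar>t\<bar> * x)" using int by simp
    show "AE x in M. norm (iexp (t * x) - 1) \<le> \<bar>t\<bar> * x"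
      using pos
    proof eventually_elim
      case (elim x)
      then show ?case using iexp_approx1[of "t * x" 0] by (simp add: abs_mult)
    qed
  qed
  also have "\<dots> \<le> \<bar>t\<bar> * c" using mean by (simp add: mult_left_mono)
  finally show ?thesis .
qed

text \<open>Weighted geometric and arithmetic mean of \<open>u\<^sup>2\<close> and \<open>u\<close>. The polynomial bound avoids integrating a power with
real exponent and is still sharp enough for the contraction.\<close>

lemma powr_two_minus_le:
  fixes u \<alpha> :: real
  assumes "0 < u" "0 < \<alpha>" "\<alpha> < 1"
  shows "u powr (2 - \<alpha>) \<le> (1 - \<alpha>) * u\<^sup>2 + \<alpha> * u"
proof -
  have "u powr (2 - \<alpha>) = (u\<^sup>2) powr (1 - \<alpha>) * u powr \<alpha>"
    using assms by (simp add: powr_powr powr_add[symmetric] flip: powr_numeral)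
  also have "\<dots> \<le> (1 - \<alpha>) * u\<^sup>2 + \<alpha> * u"
    using assms by (intro Youngs_inequality_0) auto
  finally show ?thesis .
qed

text \<open>The integrand is the sum of the polynomial bound of \<open>powr_two_minus_le\<close> at \<open>u\<close> and at \<open>1 - u\<close>.\<close>

lemma integral_contraction_factor:
  fixes \<alpha> :: real
  shows "(\<integral>u. (1 - \<alpha>) * (u\<^sup>2 + (1 - u)\<^sup>2) + \<alpha> \<partial>unif01_open) = (2 + \<alpha>) / 3"
    and "integrable unif01_open (\<lambda>u. (1 - \<alpha>) * (u\<^sup>2 + (1 - u)\<^sup>2) + \<alpha>)"
proof -
  interpret UO: prob_space unif01_open by (rule prob_space_unif01_open)
  have mean: "(\<integral>u. f u \<partial>unif01_open) = 1 / 3" and int: "integrable unif01_open f"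
    if f: "f \<in> borel_measurable borel" "\<And>u. 0 < u \<Longrightarrow> u < 1 \<Longrightarrow> 0 \<le> f u \<and> f u \<le> 1"
      and nn: "(\<integral>\<^sup>+u. ennreal (f u) \<partial>unif01) = ennreal (1 / 3)" for f :: "real \<Rightarrow> real"
  proof -
    have m: "f \<in> borel_measurable unif01_open" by (rule measurable_restrict_space1) (simp add: f)
    show int: "integrable unif01_open f"
      by (rule UO.integrable_const_bound[where B=1, OF _ m])
        (auto intro!: AE_I2 simp: space_unif01_open f abs_of_nonneg)
    have "(\<integral>\<^sup>+u. ennreal (f u) \<partial>unif01_open) = (\<integral>\<^sup>+u. ennreal (f u) * indicator {0<..<1} u \<partial>unif01)"
      by (rule nn_integral_restrict_space) simp
    also have "\<dots> = (\<integral>\<^sup>+u. ennreal (f u) \<partial>unif01)"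
      by (rule nn_integral_cong_AE, use AE_unif01 in eventually_elim) auto
    finally have "(\<integral>\<^sup>+u. ennreal (f u) \<partial>unif01_open) = ennreal (1 / 3)" by (simp add: nn)
    then show "(\<integral>u. f u \<partial>unif01_open) = 1 / 3"
      by (intro integral_eq_nn_integral[THEN trans, OF m]) (auto intro!: AE_I2 simp: space_unif01_open f)
  qed
  have 1: "(\<integral>\<^sup>+u. ennreal (u\<^sup>2) \<partial>unif01) = ennreal (1 / 3)" by (rule nn_integral_unif01_square)
  have 2: "(\<integral>\<^sup>+u. ennreal ((1 - u)\<^sup>2) \<partial>unif01) = ennreal (1 / 3)"
    using nn_integral_unif01_reflect[of "\<lambda>u. ennreal (u\<^sup>2)"] nn_integral_unif01_square by simp
  have bound: "0 \<le> u\<^sup>2 \<and> u\<^sup>2 \<le> 1" if "0 < u" "u < 1" for u :: real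
    using that by (simp add: power_le_one)
  have i1: "integrable unif01_open (\<lambda>u. u\<^sup>2)" and m1: "(\<integral>u. u\<^sup>2 \<partial>unif01_open) = 1 / 3"
    by (rule int[OF _ _ 1] mean[OF _ _ 1]; use bound in simp)+
  have i2: "integrable unif01_open (\<lambda>u. (1 - u)\<^sup>2)" and m2: "(\<integral>u. (1 - u)\<^sup>2 \<partial>unif01_open) = 1 / 3"
    by (rule int[OF _ _ 2] mean[OF _ _ 2]; use bound in simp)+
  show "integrable unif01_open (\<lambda>u. (1 - \<alpha>) * (u\<^sup>2 + (1 - u)\<^sup>2) + \<alpha>)"
    by (intro Bochner_Integration.integrable_add integrable_mult_right i1 i2) simp
  show "(\<integral>u. (1 - \<alpha>) * (u\<^sup>2 + (1 - u)\<^sup>2) + \<alpha> \<partial>unif01_open) = (2 + \<alpha>) / 3"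
    using i1 i2 UO.prob_space
    by (simp add: m1 m2 space_unif01_open field_simps)
qed

lemma norm_mult3_diff_le:
  fixes c :: complex
  assumes "norm c \<le> 1" "norm a \<le> 1" "norm b' \<le> 1"
  shows "norm (c * (a * b) - c * (a' * b')) \<le> norm (b - b') + norm (a - a')"
proof -
  have "c * (a * b) - c * (a' * b') = c * (a * (b - b') + (a - a') * b')" by (simp add: algebra_simps)
  also have "norm \<dots> \<le> 1 * (1 * norm (b - b') + norm (a - a') * 1)"
    unfolding norm_mult
    by (intro mult_mono order_trans[OF norm_triangle_ineq] add_mono)
      (use assms in \<open>auto simp: norm_mult intro!: mult_mono mult_left_le mult_left_le_one_le\<close>)
  finally show ?thesis by simp
qed

text \<open>A bound proportional to \<open>\<bar>s\<bar> * r powr (- \<alpha>)\<close> is compatible with the scaling of the identity: at intensity \<open>l * u\<close>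
and argument \<open>u\<^sup>2 * t\<close> it becomes the bound at \<open>l\<close> and \<open>t\<close> times \<open>u powr (2 - \<alpha>)\<close>. Twice the mean of this factor is
below \<open>1\<close> exactly for \<open>\<alpha> < 1\<close>, which is where the moment condition enters. The bound may be restricted to
intensities up to \<open>\<Lambda>\<close>, because the right-hand side involves only smaller intensities.\<close>

lemma char_contraction:
  assumes \<kappa>: "\<kappa> \<in> pos_reals \<rightarrow>\<^sub>M prob_algebra borel" and \<kappa>': "\<kappa>' \<in> pos_reals \<rightarrow>\<^sub>M prob_algebra borel"
    and \<alpha>: "0 < \<alpha>" "\<alpha> < 1" and l: "0 < l" "l \<le> \<Lambda>" and D: "0 \<le> D"
    and bound: "\<And>r s. 0 < r \<Longrightarrow> r \<le> \<Lambda> \<Longrightarrow> norm (char (\<kappa> r) s - char (\<kappa>' r) s) \<le> D * \<bar>s\<bar> * r powr (- \<alpha>)"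
  shows "norm (char (rhs_law \<kappa> l) t - char (rhs_law \<kappa>' l) t) \<le> ((2 + \<alpha>) / 3 * D) * \<bar>t\<bar> * l powr (- \<alpha>)"
proof -
  let ?f = "\<lambda>\<kappa> u. char (theta_law l u) t *
      (char (\<kappa> (l * u)) (u\<^sup>2 * t) * char (\<kappa> (l * (1 - u))) ((1 - u)\<^sup>2 * t))"
  let ?C = "D * \<bar>t\<bar> * l powr (- \<alpha>)"
  let ?p = "\<lambda>u. (1 - \<alpha>) * (u\<^sup>2 + (1 - u)\<^sup>2) + \<alpha>"
  note f = char_rhs_law(2,3)[OF \<kappa> l(1), of t] and f' = char_rhs_law(2,3)[OF \<kappa>' l(1), of t]
  have scaled: "norm (char (\<kappa> (l * u)) (u\<^sup>2 * t) - char (\<kappa>' (l * u)) (u\<^sup>2 * t)) \<le>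
      ?C * ((1 - \<alpha>) * u\<^sup>2 + \<alpha> * u)" if u: "0 < u" "u < 1" for u
  proof -
    have "l * u \<le> l * 1" using l u by (intro mult_left_mono) auto
    then have "l * u \<le> \<Lambda>" using l by linarith
    then have "norm (char (\<kappa> (l * u)) (u\<^sup>2 * t) - char (\<kappa>' (l * u)) (u\<^sup>2 * t)) \<le>
        D * \<bar>u\<^sup>2 * t\<bar> * (l * u) powr (- \<alpha>)"
      using l u by (intro bound) auto
    also have "\<dots> = ?C * (u\<^sup>2 * u powr (- \<alpha>))"
      using l u by (simp add: powr_mult abs_mult)
    also have "u\<^sup>2 * u powr (- \<alpha>) = u powr (2 - \<alpha>)"
      using u by (simp add: powr_add[symmetric] flip: powr_numeral)
    also have "?C * u powr (2 - \<alpha>) \<le> ?C * ((1 - \<alpha>) * u\<^sup>2 + \<alpha> * u)"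
      using D u \<alpha> by (intro mult_left_mono powr_two_minus_le) auto
    finally show ?thesis .
  qed
  have pointwise: "norm (?f \<kappa> u - ?f \<kappa>' u) \<le> ?C * ?p u" if u: "0 < u" "u < 1" for u
  proof -
    have "norm (char (\<kappa> (l * u)) (u\<^sup>2 * t)) \<le> 1" "norm (char (\<kappa>' (l * (1 - u))) ((1 - u)\<^sup>2 * t)) \<le> 1"
      using l u by (auto intro!: real_distribution.cmod_char_le_1 pos_kernelD(3)[OF \<kappa>] pos_kernelD(3)[OF \<kappa>'])
    then have "norm (?f \<kappa> u - ?f \<kappa>' u) \<le>
        norm (char (\<kappa> (l * (1 - u))) ((1 - u)\<^sup>2 * t) - char (\<kappa>' (l * (1 - u))) ((1 - u)\<^sup>2 * t)) +
        norm (char (\<kappa> (l * u)) (u\<^sup>2 * t) - char (\<kappa>' (l * u)) (u\<^sup>2 * t))"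
      by (intro norm_mult3_diff_le norm_char_theta_law_le)
    also have "\<dots> \<le> ?C * ((1 - \<alpha>) * (1 - u)\<^sup>2 + \<alpha> * (1 - u)) + ?C * ((1 - \<alpha>) * u\<^sup>2 + \<alpha> * u)"
      using u by (intro add_mono scaled) auto
    also have "\<dots> = ?C * ?p u" by (simp add: algebra_simps)
    finally show ?thesis .
  qed
  have "norm (char (rhs_law \<kappa> l) t - char (rhs_law \<kappa>' l) t) = norm (CLINT u|unif01_open. ?f \<kappa> u - ?f \<kappa>' u)"
    by (simp add: f(1) f'(1) Bochner_Integration.integral_diff[OF f(2) f'(2)])
  also have "\<dots> \<le> (\<integral>u. norm (?f \<kappa> u - ?f \<kappa>' u) \<partial>unif01_open)" by (rule integral_norm_bound)
  also have "\<dots> \<le> (\<integral>u. ?C * ?p u \<partial>unif01_open)"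
    by (intro integral_mono integrable_norm Bochner_Integration.integrable_diff f(2) f'(2)
        integrable_mult_right integral_contraction_factor(2) pointwise) (auto simp: space_unif01_open)
  also have "\<dots> = ?C * ((2 + \<alpha>) / 3)"
    by (subst integral_mult_right_zero) (simp only: integral_contraction_factor(1))
  finally show ?thesis by (simp add: mult_ac)
qed

text \<open>The moment condition is a property of the laws, so the process that witnesses it and the process that solves
the identity may live on different probability spaces.\<close>

lemma solution_unique:
  assumes "class_M TYPE('v) \<mu>" "solution TYPE('w) \<mu>" and l: "0 < l"
  shows "\<mu> l = nu l"
proof -
  obtain P :: "'v measure" and Y \<alpha> where Y: "process_with_laws P Y \<mu>" and \<alpha>: "0 < \<alpha>" "\<alpha> < 1"
    and mom: "\<forall>I. is_interval I \<and> bounded I \<and> I \<subseteq> {0<..} \<longrightarrow>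
        (\<exists>C :: real. \<forall>l\<in>I. ennreal (l powr \<alpha>) * (\<integral>\<^sup>+w. ennreal (Y l w) \<partial>P) \<le> ennreal C)"
    using assms(1) unfolding class_M_def by (elim exE conjE)
  obtain P' :: "'w measure" and Y' where Y': "process_with_laws P' Y' \<mu>"
    and fixed: "\<And>l. 0 < l \<Longrightarrow> distr P' borel (Y' l) = rhs_law (\<lambda>r. distr P' borel (Y' r)) l"
    using assms(2) unfolding solution_def by blast
  define \<kappa> where "\<kappa> = (\<lambda>r. distr P' borel (Y' r))"
  have \<kappa>: "\<kappa> \<in> pos_reals \<rightarrow>\<^sub>M prob_algebra borel"
    unfolding \<kappa>_def by (rule process_kernel[OF Y'])
  have \<kappa>_\<mu>: "\<kappa> r = \<mu> r" if "0 < r" for r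
    using Y' that by (simp add: \<kappa>_def process_with_laws_def)
  have \<kappa>_fixed: "\<kappa> r = rhs_law \<kappa> r" if "0 < r" for r
    using fixed[OF that] by (simp add: \<kappa>_def)
  have \<kappa>_distr: "\<kappa> r = distr P borel (Y r)" if "0 < r" for r
    using Y that \<kappa>_\<mu>[OF that] by (simp add: process_with_laws_def)
  have Ym: "Y r \<in> borel_measurable P" and Ynonneg: "w \<in> space P \<Longrightarrow> 0 \<le> Y r w" if "0 < r" for r w
  proof -
    have m: "(\<lambda>(l, w). Y l w) \<in> borel_measurable (pos_reals \<Otimes>\<^sub>M P)"
      and s: "(\<lambda>(l, w). Y l w) \<in> space (pos_reals \<Otimes>\<^sub>M P) \<rightarrow> {0..}"
      using Y by (simp_all add: process_with_laws_def measurable_restrict_space2_iff)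
    from measurable_Pair2[OF m, of r] that show "Y r \<in> borel_measurable P"
      by (simp add: space_restrict_space)
    show "0 \<le> Y r w" if "w \<in> space P"
      using s \<open>0 < r\<close> that by (auto simp: space_pair_measure space_restrict_space Pi_iff)
  qed
  have "is_interval {0<..l}" by (simp add: is_interval_convex_1)
  moreover have "{0<..l} \<subseteq> {0<..}" by auto
  moreover have "bounded {0<..l}" by (rule bounded_subset[of "{0..l}"]) auto
  ultimately obtain C0 where C0: "\<And>r. r \<in> {0<..l} \<Longrightarrow>
      ennreal (r powr \<alpha>) * (\<integral>\<^sup>+w. ennreal (Y r w) \<partial>P) \<le> ennreal C0"
    using mom by blast
  \<comment> \<open>The constant in the moment condition may be negative, in which case it bounds only a vanishing moment.\<close>
  define C where "C = max C0 0"
  \<comment> \<open>On \<open>(0, l]\<close> the mean bound \<open>3\<close> for \<open>nu\<close> is at most \<open>3 * l powr \<alpha> * r powr (- \<alpha>)\<close>.\<close>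
  define D where "D = C + 3 * l powr \<alpha>"
  have C: "0 \<le> C" and D: "0 \<le> D" by (simp_all add: C_def D_def)
  have start: "norm (char (\<kappa> r) s - char (nu r) s) \<le> D * \<bar>s\<bar> * r powr (- \<alpha>)" if r: "0 < r" "r \<le> l" for r s
  proof -
    have "norm (char (\<kappa> r) s - 1) \<le> \<bar>s\<bar> * (C * r powr (- \<alpha>))"
    proof (rule norm_char_minus_1_le)
      show "real_distribution (\<kappa> r)" by (rule pos_kernelD(3)[OF \<kappa> r(1)])
      have "Y r -` {..<0} \<inter> space P = {}" using Ynonneg[OF r(1)] by (force simp: not_le[symmetric])
      then show "emeasure (\<kappa> r) {..<0} = 0"
        by (simp add: \<kappa>_distr[OF r(1)] emeasure_distr Ym[OF r(1)])
      have "(\<integral>\<^sup>+x. ennreal x \<partial>\<kappa> r) = (\<integral>\<^sup>+w. ennreal (Y r w) \<partial>P)"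
        by (simp add: \<kappa>_distr[OF r(1)] nn_integral_distr Ym[OF r(1)])
      also have "\<dots> = ennreal (r powr (- \<alpha>)) * (ennreal (r powr \<alpha>) * (\<integral>\<^sup>+w. ennreal (Y r w) \<partial>P))"
        using r by (simp add: mult.assoc[symmetric] ennreal_mult[symmetric] powr_add[symmetric])
      also have "\<dots> \<le> ennreal (r powr (- \<alpha>)) * ennreal C"
        using C0[of r] r by (intro mult_left_mono order_trans[OF C0]) (auto simp: C_def intro!: ennreal_leI)
      also have "\<dots> = ennreal (C * r powr (- \<alpha>))"
        using C by (simp add: ennreal_mult[symmetric] mult.commute)
      finally show "(\<integral>\<^sup>+x. ennreal x \<partial>\<kappa> r) \<le> ennreal (C * r powr (- \<alpha>))" .
    qed (use C in simp)
    moreover have "norm (char (nu r) s - 1) \<le> \<bar>s\<bar> * 3"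
      by (rule norm_char_minus_1_le)
        (use nn_integral_nu_le[OF r(1)] nu_nonneg[OF r(1)] pos_kernelD(3)[OF nu_kernel r(1)] in auto)
    moreover have "norm (char (\<kappa> r) s - char (nu r) s) \<le> norm (char (\<kappa> r) s - 1) + norm (char (nu r) s - 1)"
      using norm_triangle_ineq4[of "char (\<kappa> r) s - 1" "char (nu r) s - 1"] by simp
    moreover have "(1 :: real) \<le> l powr \<alpha> * r powr (- \<alpha>)"
      using r \<alpha> powr_mono2[of \<alpha> r l] by (simp add: powr_minus field_simps)
    then have "\<bar>s\<bar> * 3 \<le> \<bar>s\<bar> * (3 * (l powr \<alpha> * r powr (- \<alpha>)))"
      by (intro mult_left_mono) auto
    ultimately show ?thesis by (simp add: D_def algebra_simps)
  qed
  define q where "q = (2 + \<alpha>) / 3"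
  have q: "0 \<le> q" "q < 1" using \<alpha> by (simp_all add: q_def)
  have iter: "norm (char (\<kappa> r) s - char (nu r) s) \<le> (q ^ n * D) * \<bar>s\<bar> * r powr (- \<alpha>)"
    if "0 < r" "r \<le> l" for n r s
    using that
  proof (induction n arbitrary: r s)
    case (Suc n)
    have "norm (char (rhs_law \<kappa> r) s - char (rhs_law nu r) s) \<le>
        ((2 + \<alpha>) / 3 * (q ^ n * D)) * \<bar>s\<bar> * r powr (- \<alpha>)"
      by (rule char_contraction[OF \<kappa> nu_kernel \<alpha> Suc.prems _ Suc.IH]) (use q D in auto)
    moreover have "rhs_law nu r = nu r"
      by (rule rhs_law_eq_nu[OF nu_kernel _ Suc.prems(1)]) simp
    ultimately show ?case using \<kappa>_fixed[OF Suc.prems(1)] by (simp add: q_def mult_ac)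
  qed (use start in simp)
  have "char (\<kappa> l) s = char (nu l) s" for s
  proof -
    have "(\<lambda>n. (q ^ n * D) * \<bar>s\<bar> * l powr (- \<alpha>)) \<longlonglongrightarrow> (0 * D) * \<bar>s\<bar> * l powr (- \<alpha>)"
      using q by (intro tendsto_intros LIMSEQ_power_zero) auto
    then have "norm (char (\<kappa> l) s - char (nu l) s) \<le> 0"
      using iter[OF l order_refl, of s] by (intro LIMSEQ_le_const) auto
    then show ?thesis by simp
  qed
  then have "\<kappa> l = nu l"
    by (intro Levy_uniqueness pos_kernelD(3)[OF \<kappa> l] pos_kernelD(3)[OF nu_kernel l]) auto
  then show ?thesis using \<kappa>_\<mu>[OF l] by simp
qed

theorem theorem2p6:
  "class_M TYPE(real) nu \<and> solution TYPE(real) nu \<and>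
   (\<forall>\<mu>. class_M TYPE('v) \<mu> \<and> solution TYPE('w) \<mu> \<longrightarrow> (\<forall>l>0. \<mu> l = nu l))"
  using class_M_nu solution_nu solution_unique by blast

end
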